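(* Let $\Sigma$ be a finite set of tokens and let $\vec\varphi=(\varphi_1,\dots,\varphi_m)$ be a tuple of $\Sigma$-formulae of $\mathrm{GPTL}^{-}$. Then one can construct an encoder--decoder transformer $T$ over $\Sigma$ (without a final $\mathrm{softmax}$), with output dimension $d_{\text{out}}=m$, that is feature-wise equivalent to $\vec\varphi$: for every $\Sigma$-labelled two-sorted graph $\mathcal{G}$ and every vertex $v$ in the suffix of $\mathcal{G}$, every entry of the output vector of $T$ at $v$ represents $0$ or $1$, and the bit string $b_1\cdots b_m$ with $b_i=1$ iff the $i$-th entry represents $1$ equals the output of $\vec\varphi$ at $(\mathcal{G},v)$.
   Context: Floating-point numbers: for $p,q\in\mathbb{Z}_+$ a float over $p,q$ is a bit string $b_0b_1\cdots b_{q+p}$; $b_0$ is the sign, $b_1\cdots b_q$ the exponent (value $e$), $b_{q+1}\cdots b_{q+p}$ the significand (value $s$). With $a=2^{p-1}$, $b=2^{q-1}-1$ it represents $(-1)^{b_0}\frac{s}{a}2^{e-b}$, except that significand $0^p$ with exponent $1^q$ represents $\infty$ ($b_0=0$) or $-\infty$ ($b_0=1$). The format $\mathcal F(p,q)$ consists of normalised ($b_{q+1}=1$) and subnormalised ($b_{q+1}=0$, exponent $0^q$) floats together with $\infty,-\infty,\mathrm{NaN}$. Operations $+,-,\cdot,\div,\sqrt{\ }$ compute the exact result and round to the nearest element of the format (with overflow to $\pm\infty$ and NaN for undefined operations or NaN inputs); $\exp$ is implemented by an approximation inside the format. A sum of a multiset of floats is always computed by adding the floats in increasing order. Two-sorted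 graphs: $\mathrm{BOS}\notin\Sigma$ is a special token. A $\Sigma$-labelled two-sorted graph is $\mathcal{G}=(V,E,\lambda)$ with $V=[n]$, $E=\{(i,i+1)\}$, $\lambda:V\to\Sigma\cup\{\mathrm{BOS}\}$ such that exactly one vertex $w$ has label $\mathrm{BOS}$; the prefix $\mathcal{G}_p$ consists of vertices $1,\dots,w-1$ and the suffix $\mathcal{G}_s$ of vertices $w,\dots,n$. Encoder--decoder transformer over a format $\mathcal F$ with dimensions $(d,d_k,d_v,d_{ff},d_{\text{out}})$ (all computations in $\mathcal F$): an embedding $\mathrm{em}:\Sigma\cup\{\mathrm{BOS}\}\to\mathcal F^d$ applied vertex-wise gives matrices $\mathrm{em}(\mathcal{G}_p)\in\mathcal F^{|\mathcal G_p|\times d}$ and $\mathrm{em}(\mathcal{G}_s)\in\mathcal F^{|\mathcal G_s|\times d}$. The strict causal mask sets entry $(i,j)$ of a square matrix to $-\infty$ when $j\ge i$. $\mathrm{softmax}(\mathbf x)_i=e^{x_i-\beta}/\sum_j e^{x_j-\beta}$ with $\beta=\max_j x_j$, with the convention $\mathrm{softmax}(-\infty,\dots,-\infty)=(0,\dots,0)$. An attention head with $W^Q,W^K\in\mathcal F^{d\times d_k}$, $W^V\in\mathcal F^{d\times d_v}$ maps $(X,Y)$ to $\mathrm{softmax}\big((YW^Q)(XW^K)^\top/\sqrt{d_k}\big)(XW^V)$ (softmax row-wise); the masked head inserts the mask before softmax. A multi-head layer with heads $H^{(1)},\dots,H^{(h)}$ is $\mathrm{concat}(H^{(1)},\dots,H^{(h)})W^O$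 with $W^O\in\mathcal F^{hd_v\times d}$; self-attention means $X=Y$, cross-attention is unmasked with distinct $X,Y$. An MLP is $M(\mathbf x)=\mathrm{ReLU}(\mathbf xW_1+b_1)W_2+b_2$ applied row-wise. Encoder layer: $\mathsf{EL}(X)=M(X')+X'$, $X'=\mathsf{MHSA}(X)+X$ (unmasked). Decoder layer: $\mathsf{DL}(X,Y)=M(Y'')+Y''$, $Y''=\mathsf{MHCA}(X,Y')+Y'$, $Y'=\mathsf{MHSA}_{\mathrm{mask}}(Y)+Y$. Encoder $\mathsf E=\mathsf{EL}_{L_1}\circ\dots\circ\mathsf{EL}_1$; decoder $\mathsf D(X,Y)=\mathsf{DL}_{L_2}(X,\mathsf{DL}_{L_2-1}(X,\dots\mathsf{DL}_1(X,Y)\dots))$. Output head $\mathrm{Out}(Y)=YW^{\mathrm{out}}+b^{\mathrm{out}}$ with $W^{\mathrm{out}}\in\mathcal F^{d\times d_{\text{out}}}$. The transformer (without final softmax) is $T(\mathcal G)=\mathrm{Out}(\mathsf D(\mathsf E(\mathrm{em}(\mathcal G_p)),\mathrm{em}(\mathcal G_s)))$; the row corresponding to a suffix vertex $v$ is the output of $T$ at $v$. Logic $\mathrm{GPTL}^{-}$: $\varphi::=\bot\mid p\mid\neg\varphi\mid(\varphi\wedge\varphi)\mid\langle G\rangle^{\text{pre}}_{\ge k}\varphi\mid\langle P\rangle^{\text{suf}}\varphi$ with $p\in\Sigma$, $k\in\mathbb N$. Semantics at a vertex $w$ of a two-sorted graph $\mathcal G$: $\bot$ never holds; $p$ holds iff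 $\lambda(w)=p$; Boolean connectives as usual; $\langle G\rangle^{\text{pre}}_{\ge k}\varphi$ holds iff at least $k$ vertices of the prefix satisfy $\varphi$; $\langle P\rangle^{\text{suf}}\varphi$ holds iff some suffix vertex $v<w$ satisfies $\varphi$. The output of $(\varphi_1,\dots,\varphi_m)$ at $(\mathcal G,v)$ is $b_1\cdots b_m$ with $b_i=1$ iff $\mathcal G,v\models\varphi_i$. *)

theory Defs
  imports
    Complex_Main
    "HOL-Library.Extended_Real"
    "Jordan_Normal_Form.Matrix"
begin

section \<open>Floating-point formats\<close>

text \<open>
  The fixed-length exponent and significand strings are identified with their values:
  \<open>Fin b\<^sub>0 e s\<close> is the bit string with sign bit \<open>b\<^sub>0\<close> (True for 1), exponent value \<open>e\<close> and
  significand value \<open>s\<close>. The string with exponent \<open>1\<^sup>q\<close> and significand \<open>0\<^sup>p\<close> is \<open>Inf b\<^sub>0\<close>.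
\<close>

datatype fp = NaN | Inf (sgn_bit: bool) | Fin (sgn_bit: bool) (expo: nat) (signif: nat)

record fmt =
  sig_bits :: nat
  exp_bits :: nat
  fexp :: "fp \<Rightarrow> fp"

definition bias :: "fmt \<Rightarrow> int" where
  "bias F = 2 ^ (exp_bits F - 1) - 1"

text \<open>A significand has leading bit 1 iff its value is at least \<open>2\<^sup>p\<^sup>-\<^sup>1\<close>; all finite floats of the
  format are thus normalised or subnormalised.\<close>

definition fin_floats :: "fmt \<Rightarrow> fp set" where
  "fin_floats F = {Fin b e s | b e s.
     e < 2 ^ exp_bits F \<and> s < 2 ^ sig_bits F \<and> (2 ^ (sig_bits F - 1) \<le> s \<or> e = 0)}"

definition floats :: "fmt \<Rightarrow> fp set" where
  "floats F = fin_floats F \<union> {Inf False, Inf True, NaN}"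

fun rval :: "fmt \<Rightarrow> fp \<Rightarrow> real" where
  "rval F (Fin b e s) =
     (if b then -1 else 1) * (real s / 2 ^ (sig_bits F - 1)) * 2 powi (int e - bias F)"
| "rval F _ = 0"

text \<open>The value of NaN is irrelevant; being infinite, it is never mistaken for a number.\<close>

fun fval :: "fmt \<Rightarrow> fp \<Rightarrow> ereal" where
  "fval F (Fin b e s) = ereal (rval F (Fin b e s))"
| "fval F (Inf b) = (if b then -\<infinity> else \<infinity>)"
| "fval F NaN = \<infinity>"

definition represents :: "fmt \<Rightarrow> fp \<Rightarrow> real \<Rightarrow> bool" where
  "represents F x r \<longleftrightarrow> x \<noteq> NaN \<and> fval F x = ereal r"

section \<open>Rounding\<close>

definition nearest :: "fmt \<Rightarrow> bool \<Rightarrow> real \<Rightarrow> fp set" where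
  "nearest F b x = {f \<in> fin_floats F. sgn_bit f = b \<and>
     (\<forall>g \<in> fin_floats F. sgn_bit g = b \<longrightarrow> \<bar>rval F f - x\<bar> \<le> \<bar>rval F g - x\<bar>)}"

text \<open>
  Half a unit in the last place above the largest finite float
  \<open>(2\<^sup>p - 1) / 2\<^sup>p\<^sup>-\<^sup>1 \<cdot> 2\<^sup>E\<close>, where \<open>E = 2\<^sup>q - 1 - bias\<close>.
\<close>

definition overflow_bound :: "fmt \<Rightarrow> real" where
  "overflow_bound F =
     (2 ^ sig_bits F - 1 / 2) / 2 ^ (sig_bits F - 1) * 2 powi (2 ^ exp_bits F - 1 - bias F)"

text \<open>
  Round to nearest as in IEEE 754: ties go to the even significand and, if both are odd (which
  happens only for one-bit significands), to the larger magnitude. The flag \<open>z\<close> is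
  the sign of the result in case the exact result is 0; otherwise the sign of the exact result is
  kept, also when it underflows to 0.
\<close>

definition fround :: "fmt \<Rightarrow> bool \<Rightarrow> real \<Rightarrow> fp" where
  "fround F z x =
     (let b = (if x = 0 then z else x < 0) in
      if overflow_bound F \<le> \<bar>x\<bar> then Inf b
      else (THE f. f \<in> nearest F b x \<and>
              (\<forall>g \<in> nearest F b x. g \<noteq> f \<longrightarrow>
                 even (signif f) \<or> odd (signif g) \<and> \<bar>rval F g\<bar> < \<bar>rval F f\<bar>)))"

section \<open>Arithmetic\<close>

fun fneg :: "fp \<Rightarrow> fp" where
  "fneg (Fin b e s) = Fin (\<not> b) e s"
| "fneg (Inf b) = Inf (\<not> b)"
| "fneg NaN = NaN"

fun fadd :: "fmt \<Rightarrow> fp \<Rightarrow> fp \<Rightarrow> fp" where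
  "fadd F (Fin b e s) (Fin b' e' s') =
     fround F (b \<and> b') (rval F (Fin b e s) + rval F (Fin b' e' s'))"
| "fadd F (Inf b) (Fin _ _ _) = Inf b"
| "fadd F (Fin _ _ _) (Inf b) = Inf b"
| "fadd F (Inf b) (Inf b') = (if b = b' then Inf b else NaN)"
| "fadd F NaN _ = NaN"
| "fadd F _ NaN = NaN"

definition fsub :: "fmt \<Rightarrow> fp \<Rightarrow> fp \<Rightarrow> fp" where
  "fsub F x y = fadd F x (fneg y)"

fun fmul :: "fmt \<Rightarrow> fp \<Rightarrow> fp \<Rightarrow> fp" where
  "fmul F (Fin b e s) (Fin b' e' s') =
     fround F (b \<noteq> b') (rval F (Fin b e s) * rval F (Fin b' e' s'))"
| "fmul F (Inf b) (Fin b' _ s') = (if s' = 0 then NaN else Inf (b \<noteq> b'))"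
| "fmul F (Fin b _ s) (Inf b') = (if s = 0 then NaN else Inf (b \<noteq> b'))"
| "fmul F (Inf b) (Inf b') = Inf (b \<noteq> b')"
| "fmul F NaN _ = NaN"
| "fmul F _ NaN = NaN"

fun fdiv :: "fmt \<Rightarrow> fp \<Rightarrow> fp \<Rightarrow> fp" where
  "fdiv F (Fin b e s) (Fin b' e' s') =
     (if s' = 0 then NaN
      else fround F (b \<noteq> b') (rval F (Fin b e s) / rval F (Fin b' e' s')))"
| "fdiv F (Inf b) (Fin b' _ s') = (if s' = 0 then NaN else Inf (b \<noteq> b'))"
| "fdiv F (Fin b _ _) (Inf b') = Fin (b \<noteq> b') 0 0"
| "fdiv F (Inf _) (Inf _) = NaN"
| "fdiv F NaN _ = NaN"
| "fdiv F _ NaN = NaN"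

fun fsqrt :: "fmt \<Rightarrow> fp \<Rightarrow> fp" where
  "fsqrt F (Fin b e s) =
     (if s = 0 then Fin b e s else if b then NaN
      else fround F False (sqrt (rval F (Fin b e s))))"
| "fsqrt F (Inf b) = (if b then NaN else Inf False)"
| "fsqrt F NaN = NaN"

abbreviation fzero :: fp where
  "fzero \<equiv> Fin False 0 0"

text \<open>
  The exponential function of the format is an arbitrary approximation of exp inside the format:
  it is exact where exp is exactly representable, and otherwise at most \<open>N\<close> finite floats lie
  strictly between the exact and the computed value (\<open>N = 0\<close> is faithful rounding and includes
  correct rounding).
\<close>

definition exp_approx :: "nat \<Rightarrow> fmt \<Rightarrow> bool" where
  "exp_approx N F \<longleftrightarrow>
     fexp F NaN = NaN \<and>
     fexp F (Inf False) = Inf False \<and>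
     represents F (fexp F (Inf True)) 0 \<and>
     (\<forall>x \<in> floats F. fexp F x \<in> floats F) \<and>
     (\<forall>x \<in> fin_floats F.
        (rval F x = 0 \<longrightarrow> represents F (fexp F x) 1) \<and>
        fexp F x \<noteq> NaN \<and>
        card {y \<in> rval F ` fin_floats F.
          min (ereal (exp (rval F x))) (fval F (fexp F x)) < ereal y \<and>
          ereal y < max (ereal (exp (rval F x))) (fval F (fexp F x))} \<le> N)"

definition relu :: "fmt \<Rightarrow> fp \<Rightarrow> fp" where
  "relu F x = (if x = NaN then NaN else if 0 < fval F x then x else fzero)"

definition fmax :: "fmt \<Rightarrow> fp \<Rightarrow> fp \<Rightarrow> fp" where
  "fmax F x y = (if x = NaN \<or> y = NaN then NaN else if fval F x < fval F y then y else x)"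

text \<open>
  Addition in increasing order. The relative order of \<open>-0\<close> and \<open>+0\<close> does not affect the result,
  and any NaN makes the sum NaN, so the sum depends only on the multiset of entries.
\<close>

definition fsum :: "fmt \<Rightarrow> fp list \<Rightarrow> fp" where
  "fsum F xs = (case sort_key (fval F) xs of [] \<Rightarrow> fzero | y # ys \<Rightarrow> foldl (fadd F) y ys)"

section \<open>Matrices of floats\<close>

definition fmats :: "fmt \<Rightarrow> nat \<Rightarrow> nat \<Rightarrow> fp mat set" where
  "fmats F nr nc = {A \<in> carrier_mat nr nc. \<forall>i < nr. \<forall>j < nc. A $$ (i, j) \<in> floats F}"

definition fvecs :: "fmt \<Rightarrow> nat \<Rightarrow> fp vec set" where
  "fvecs F n = {v \<in> carrier_vec n. \<forall>i < n. v $ i \<in> floats F}"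

definition mmul :: "fmt \<Rightarrow> fp mat \<Rightarrow> fp mat \<Rightarrow> fp mat" where
  "mmul F A B = mat (dim_row A) (dim_col B)
     (\<lambda>(i, j). fsum F (map (\<lambda>k. fmul F (A $$ (i, k)) (B $$ (k, j))) [0..<dim_col A]))"

definition madd :: "fmt \<Rightarrow> fp mat \<Rightarrow> fp mat \<Rightarrow> fp mat" where
  "madd F A B = mat (dim_row A) (dim_col A) (\<lambda>ij. fadd F (A $$ ij) (B $$ ij))"

definition add_bias :: "fmt \<Rightarrow> fp mat \<Rightarrow> fp vec \<Rightarrow> fp mat" where
  "add_bias F A b = mat (dim_row A) (dim_col A) (\<lambda>(i, j). fadd F (A $$ (i, j)) (b $ j))"

definition hconcat :: "nat \<Rightarrow> fp mat list \<Rightarrow> fp mat" where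
  "hconcat n As = mat n (sum_list (map dim_col As))
     (\<lambda>(i, j). concat (map (\<lambda>A. list_of_vec (row A i)) As) ! j)"

section \<open>Transformers\<close>

definition softmax :: "fmt \<Rightarrow> fp vec \<Rightarrow> fp vec" where
  "softmax F x =
     (let xs = list_of_vec x in
      if \<forall>a \<in> set xs. a = Inf True then vec (dim_vec x) (\<lambda>_. fzero)
      else
        let \<beta> = foldl (fmax F) (hd xs) (tl xs);
            y = map_vec (\<lambda>a. fexp F (fsub F a \<beta>)) x
        in map_vec (\<lambda>a. fdiv F a (fsum F (list_of_vec y))) y)"

definition softmax_rows :: "fmt \<Rightarrow> fp mat \<Rightarrow> fp mat" where
  "softmax_rows F A = mat (dim_row A) (dim_col A) (\<lambda>(i, j). softmax F (row A i) $ j)"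

definition causal_mask :: "fp mat \<Rightarrow> fp mat" where
  "causal_mask A = mat (dim_row A) (dim_col A)
     (\<lambda>(i, j). if i \<le> j then Inf True else A $$ (i, j))"

record head =
  W_Q :: "fp mat"
  W_K :: "fp mat"
  W_V :: "fp mat"

record mha =
  heads :: "head list"
  W_O :: "fp mat"

record mlp =
  W_1 :: "fp mat"
  b_1 :: "fp vec"
  W_2 :: "fp mat"
  b_2 :: "fp vec"

record enc_layer =
  enc_self :: mha
  enc_mlp :: mlp

record dec_layer =
  dec_self :: mha
  dec_cross :: mha
  dec_mlp :: mlp

record dims =
  d_model :: nat
  d_k :: nat
  d_v :: nat
  d_ff :: nat
  d_out :: nat

datatype 'a token = BOS | Tok 'a

record 'a transformer =
  emb :: "'a token \<Rightarrow> fp vec"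
  enc_layers :: "enc_layer list"
  dec_layers :: "dec_layer list"
  W_out :: "fp mat"
  b_out :: "fp vec"

definition is_head :: "fmt \<Rightarrow> dims \<Rightarrow> head \<Rightarrow> bool" where
  "is_head F D H \<longleftrightarrow>
     W_Q H \<in> fmats F (d_model D) (d_k D) \<and>
     W_K H \<in> fmats F (d_model D) (d_k D) \<and>
     W_V H \<in> fmats F (d_model D) (d_v D)"

definition is_mha :: "fmt \<Rightarrow> dims \<Rightarrow> mha \<Rightarrow> bool" where
  "is_mha F D A \<longleftrightarrow>
     heads A \<noteq> [] \<and> (\<forall>H \<in> set (heads A). is_head F D H) \<and>
     W_O A \<in> fmats F (length (heads A) * d_v D) (d_model D)"

definition is_mlp :: "fmt \<Rightarrow> dims \<Rightarrow> mlp \<Rightarrow> bool" where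
  "is_mlp F D M \<longleftrightarrow>
     W_1 M \<in> fmats F (d_model D) (d_ff D) \<and> b_1 M \<in> fvecs F (d_ff D) \<and>
     W_2 M \<in> fmats F (d_ff D) (d_model D) \<and> b_2 M \<in> fvecs F (d_model D)"

definition is_transformer :: "'a set \<Rightarrow> fmt \<Rightarrow> dims \<Rightarrow> 'a transformer \<Rightarrow> bool" where
  "is_transformer \<Sigma> F D T \<longleftrightarrow>
     0 < d_model D \<and> 0 < d_k D \<and> 0 < d_v D \<and> 0 < d_ff D \<and>
     (\<forall>t \<in> insert BOS (Tok ` \<Sigma>). emb T t \<in> fvecs F (d_model D)) \<and>
     enc_layers T \<noteq> [] \<and>
     (\<forall>L \<in> set (enc_layers T). is_mha F D (enc_self L) \<and> is_mlp F D (enc_mlp L)) \<and>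
     dec_layers T \<noteq> [] \<and>
     (\<forall>L \<in> set (dec_layers T).
        is_mha F D (dec_self L) \<and> is_mha F D (dec_cross L) \<and> is_mlp F D (dec_mlp L)) \<and>
     W_out T \<in> fmats F (d_model D) (d_out D) \<and> b_out T \<in> fvecs F (d_out D)"

text \<open>The Boolean flag selects the masked variant.\<close>

definition head_eval :: "fmt \<Rightarrow> bool \<Rightarrow> head \<Rightarrow> fp mat \<Rightarrow> fp mat \<Rightarrow> fp mat" where
  "head_eval F masked H X Y =
     (let S = mmul F (mmul F Y (W_Q H)) (transpose_mat (mmul F X (W_K H)));
          S' = map_mat (\<lambda>a. fdiv F a (fsqrt F (fround F False (real (dim_col (W_K H)))))) S
      in mmul F (softmax_rows F (if masked then causal_mask S' else S')) (mmul F X (W_V H)))"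

definition mha_eval :: "fmt \<Rightarrow> bool \<Rightarrow> mha \<Rightarrow> fp mat \<Rightarrow> fp mat \<Rightarrow> fp mat" where
  "mha_eval F masked A X Y =
     mmul F (hconcat (dim_row Y) (map (\<lambda>H. head_eval F masked H X Y) (heads A))) (W_O A)"

definition mlp_eval :: "fmt \<Rightarrow> mlp \<Rightarrow> fp mat \<Rightarrow> fp mat" where
  "mlp_eval F M X =
     add_bias F
       (mmul F (map_mat (relu F) (add_bias F (mmul F X (W_1 M)) (b_1 M))) (W_2 M)) (b_2 M)"

definition enc_layer_eval :: "fmt \<Rightarrow> enc_layer \<Rightarrow> fp mat \<Rightarrow> fp mat" where
  "enc_layer_eval F L X =
     (let X' = madd F (mha_eval F False (enc_self L) X X) X
      in madd F (mlp_eval F (enc_mlp L) X') X')"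

definition dec_layer_eval :: "fmt \<Rightarrow> dec_layer \<Rightarrow> fp mat \<Rightarrow> fp mat \<Rightarrow> fp mat" where
  "dec_layer_eval F L X Y =
     (let Y' = madd F (mha_eval F True (dec_self L) Y Y) Y;
          Y'' = madd F (mha_eval F False (dec_cross L) X Y') Y'
      in madd F (mlp_eval F (dec_mlp L) Y'') Y'')"

definition encoder_eval :: "fmt \<Rightarrow> enc_layer list \<Rightarrow> fp mat \<Rightarrow> fp mat" where
  "encoder_eval F Ls X = foldl (\<lambda>Z L. enc_layer_eval F L Z) X Ls"

definition decoder_eval :: "fmt \<Rightarrow> dec_layer list \<Rightarrow> fp mat \<Rightarrow> fp mat \<Rightarrow> fp mat" where
  "decoder_eval F Ls X Y = foldl (\<lambda>Z L. dec_layer_eval F L X Z) Y Ls"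

section \<open>Two-sorted graphs\<close>

record 'a tsgraph =
  verts :: "nat set"
  edges :: "(nat \<times> nat) set"
  lab :: "nat \<Rightarrow> 'a token"

definition is_tsgraph :: "'a set \<Rightarrow> 'a tsgraph \<Rightarrow> bool" where
  "is_tsgraph \<Sigma> G \<longleftrightarrow>
     (\<exists>n. verts G = {1..n} \<and> edges G = {(i, i + 1) | i. 1 \<le> i \<and> i < n}) \<and>
     lab G ` verts G \<subseteq> insert BOS (Tok ` \<Sigma>) \<and>
     (\<exists>!w. w \<in> verts G \<and> lab G w = BOS)"

definition bos :: "'a tsgraph \<Rightarrow> nat" where
  "bos G = (THE w. w \<in> verts G \<and> lab G w = BOS)"

definition prefix_verts :: "'a tsgraph \<Rightarrow> nat set" where
  "prefix_verts G = {v \<in> verts G. v < bos G}"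

definition suffix_verts :: "'a tsgraph \<Rightarrow> nat set" where
  "suffix_verts G = {v \<in> verts G. bos G \<le> v}"

definition embed :: "nat \<Rightarrow> ('a token \<Rightarrow> fp vec) \<Rightarrow> 'a tsgraph \<Rightarrow> nat set \<Rightarrow> fp mat" where
  "embed d em G S = (let vs = sorted_list_of_set S in
     mat (length vs) d (\<lambda>(i, j). em (lab G (vs ! i)) $ j))"

definition transformer_eval :: "fmt \<Rightarrow> dims \<Rightarrow> 'a transformer \<Rightarrow> 'a tsgraph \<Rightarrow> fp mat" where
  "transformer_eval F D T G =
     (let X = encoder_eval F (enc_layers T) (embed (d_model D) (emb T) G (prefix_verts G));
          Y = decoder_eval F (dec_layers T) X (embed (d_model D) (emb T) G (suffix_verts G))
      in add_bias F (mmul F Y (W_out T)) (b_out T))"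

text \<open>Rows are numbered from 0, and the first suffix vertex is the one labelled BOS.\<close>

definition transformer_output ::
    "fmt \<Rightarrow> dims \<Rightarrow> 'a transformer \<Rightarrow> 'a tsgraph \<Rightarrow> nat \<Rightarrow> fp vec" where
  "transformer_output F D T G v = row (transformer_eval F D T G) (v - bos G)"

section \<open>The logic\<close>

datatype 'a gptl =
    Bot
  | Prop 'a
  | Neg "'a gptl"
  | Conj "'a gptl" "'a gptl"
  | GPre nat "'a gptl"
  | PSuf "'a gptl"

fun sat :: "'a tsgraph \<Rightarrow> nat \<Rightarrow> 'a gptl \<Rightarrow> bool" where
  "sat G w Bot = False"
| "sat G w (Prop a) = (lab G w = Tok a)"
| "sat G w (Neg \<phi>) = (\<not> sat G w \<phi>)"
| "sat G w (Conj \<phi> \<psi>) = (sat G w \<phi> \<and> sat G w \<psi>)"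
| "sat G w (GPre k \<phi>) = (k \<le> card {v \<in> prefix_verts G. sat G v \<phi>})"
| "sat G w (PSuf \<phi>) = (\<exists>v \<in> suffix_verts G. v < w \<and> sat G v \<phi>)"

definition formulas_output :: "'a gptl list \<Rightarrow> 'a tsgraph \<Rightarrow> nat \<Rightarrow> bool list" where
  "formulas_output \<phi>s G v = map (sat G v) \<phi>s"

definition featurewise_equiv ::
    "'a set \<Rightarrow> fmt \<Rightarrow> dims \<Rightarrow> 'a transformer \<Rightarrow> 'a gptl list \<Rightarrow> bool" where
  "featurewise_equiv \<Sigma> F D T \<phi>s \<longleftrightarrow>
     (\<forall>G v. is_tsgraph \<Sigma> G \<longrightarrow> v \<in> suffix_verts G \<longrightarrow>
        (let ys = list_of_vec (transformer_output F D T G v) in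
           (\<forall>y \<in> set ys. represents F y 0 \<or> represents F y 1) \<and>
           map (\<lambda>y. represents F y 1) ys = formulas_output \<phi>s G v))"

end

theory Submission
  imports Defs
begin

text \<open>
  Each layer evaluates one subformula, keeping truth values as the exact floats 0 and 1. A head with
  constant scores averages a truth value over the visible vertices; the average is at least \<open>2\<^sup>-\<^sup>p\<close> iff
  the truth value is 1 somewhere, because float addition of ones saturates at \<open>2\<^sup>p\<close>.

  Averages alone cannot count, so counting exploits underflow. If only the \<open>c\<close> vertices satisfying a
  formula are attended, each of them has a weight close to \<open>1/c\<close>. With the value \<open>j\<delta>\<close>, where \<open>\<delta>\<close> is the
  smallest positive float, each product is rounded to an integer multiple \<open>r\<delta>\<close>, and \<open>r = j/c\<close> if \<open>c\<close>
  divides \<open>j\<close>. The exact sum \<open>c r \<delta>\<close> therefore equals \<open>j\<delta>\<close> iff \<open>c\<close> divides \<open>j\<close>. Finally, \<open>c \<ge> k\<close> iff \<open>c \<ge> 1\<close> and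
  \<open>c\<close> divides none of \<open>1, \<dots>, k - 1\<close>. Scores are only ever 0 or minus infinity, so the exponential
  function is used only where it is exact.
\<close>

section \<open>Rounding to nearest\<close>

text \<open>The format depends on the formulas alone while prefixes are arbitrarily long, so every
  count formed by addition saturates: the softmax denominator for \<open>c\<close> attended vertices
  is only \<open>min c (2 ^ p)\<close>. Divisibility survives this. A count of at least
  \<open>4 * 2 ^ l\<close> makes all shares underflow to 0, and such a count divides no modulus up
  to \<open>2 ^ l\<close>; smaller counts lie below the saturation point, where the weight really
  approximates \<open>1 / c\<close>.

  The constants follow. All moduli are at most \<open>2 ^ l\<close>, so the rounded shares add up to
  at most \<open>4 * (2 ^ l * 2 ^ l)\<close> units \<delta>; \<open>p = 2 * l + 8\<close> makes
  these integers, and the small combinations of them formed in a perceptron, exact. With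
  \<open>p + 1\<close> exponent bits the range is wide enough for \<delta>, for scores that overflow
  on purpose and for the factors that rescale tiny results.

  The sign of a zero is not controlled along the way, so statements speak of the value of a float
  (\<open>val\<close>) instead of equality of floats; both zeros stand for the truth value
  0.\<close>

definition val :: "fmt \<Rightarrow> fp \<Rightarrow> real \<Rightarrow> bool" where
  "val F x r \<longleftrightarrow> x \<in> fin_floats F \<and> rval F x = r"

lemma valI: "x \<in> fin_floats F \<Longrightarrow> val F x (rval F x)"
  by (simp add: val_def)

lemma val_fin: "val F x r \<Longrightarrow> x \<in> fin_floats F"
  and val_rval: "val F x r \<Longrightarrow> rval F x = r"
  by (simp_all add: val_def)

lemma val_cases:
  assumes "val F x r"
  obtains b e s where "x = Fin b e s"
  using assms by (auto simp: val_def fin_floats_def)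

lemma val_floats: "val F x r \<Longrightarrow> x \<in> floats F"
  by (simp add: val_def floats_def)

lemma val_fval: "val F x r \<Longrightarrow> fval F x = ereal r"
  by (auto simp: val_def fin_floats_def)

lemma val_represents: "val F x r \<Longrightarrow> represents F x s \<longleftrightarrow> r = s"
  by (auto simp: represents_def val_fval val_def fin_floats_def)

lemma represents_val: "represents F x r \<Longrightarrow> x \<in> floats F \<Longrightarrow> val F x r"
  by (cases x) (auto simp: represents_def val_def floats_def split: if_splits)

lemma fneg_val: "val F x r \<Longrightarrow> val F (fneg x) (- r)"
  by (auto simp: val_def fin_floats_def)

declare rval.simps(1) [simp del]

text \<open>With \<open>p + 1\<close> exponent bits the bias is \<open>B\<close>, and \<open>\<delta>\<close> is the smallest positive subnormal float, so the
  finite floats are the numbers \<open>\<plusminus>s 2\<^sup>e \<delta>\<close>.\<close>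

locale float_format =
  fixes F :: fmt and l p B :: nat and \<delta> :: real
  assumes sig: "sig_bits F = p" and ex: "exp_bits F = p + 1"
    and p_def: "p = 2 * l + 8" and B_def: "B = 2 ^ p - 1"
    and \<delta>_def: "\<delta> = 1 / 2 ^ (B + p - 1)"
    and exp_zero: "\<And>x. val F x 0 \<Longrightarrow> val F (fexp F x) 1"
    and exp_minf: "val F (fexp F (Inf True)) 0"
begin

text \<open>Room in the exponent range: 1 is \<open>2 ^ (B + p - 1)\<close> units \<delta>, and
  scaling by powers up to \<open>2 ^ (3 * p)\<close> then keeps the exponent at most
  \<open>2 * B + 1\<close>.\<close>

lemma four_p_le_B: "4 * p \<le> B"
proof -
  have "4 * (2 * n + 8) < (2::nat) ^ (2 * n + 8)" for n
    by (induction n) (auto simp: power_add)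
  from this[of l] show ?thesis unfolding B_def p_def by simp
qed

lemma p_ge: "8 \<le> p" by (simp add: p_def)

lemma emax: "(2::nat) ^ (p + 1) = 2 * B + 2"
proof -
  have "1 \<le> (2::nat) ^ p" by simp
  then show ?thesis unfolding B_def by (simp only: power_add power_one_right)
qed

lemma \<delta>_pos: "0 < \<delta>" by (simp add: \<delta>_def)

lemma one_unit: "2 ^ (B + p - 1) * \<delta> = 1" by (simp add: \<delta>_def)

lemma bias_eq: "bias F = int B"
  by (simp add: bias_def ex B_def of_nat_diff)

section \<open>Finite floats as integer multiples of \<delta>\<close>

lemma rval_Fin: "rval F (Fin b e s) = (if b then -1 else 1) * (real s * 2 ^ e * \<delta>)"
proof -
  have "2 powi (int e - int B) = 2 ^ e / (2::real) ^ B"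
    by (simp add: power_int_diff)
  moreover have "B + p - 1 = B + (p - 1)" using p_ge by simp
  ultimately show ?thesis
    by (simp add: sig bias_eq \<delta>_def power_add rval.simps(1))
qed

lemma abs_rval_Fin: "\<bar>rval F (Fin b e s)\<bar> = real s * 2 ^ e * \<delta>"
  using \<delta>_pos by (cases b) (simp_all add: rval_Fin abs_mult)

definition wf_float :: "nat \<Rightarrow> nat \<Rightarrow> bool" where
  "wf_float e s \<longleftrightarrow> e \<le> 2 * B + 1 \<and> s < 2 ^ p \<and> (2 ^ (p - 1) \<le> s \<or> e = 0)"

lemma Fin_fin_floats: "Fin b e s \<in> fin_floats F \<longleftrightarrow> wf_float e s"
  unfolding fin_floats_def sig ex emax wf_float_def by auto

lemma fin_floats_cases:
  assumes "x \<in> fin_floats F"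
  obtains b e s where "x = Fin b e s" "wf_float e s"
  using assms by (cases x) (auto simp: Fin_fin_floats, auto simp: fin_floats_def)

lemma val_zero: "val F (Fin z 0 0) 0"
  by (simp add: val_def Fin_fin_floats wf_float_def rval_Fin)

lemma double_pow: "(2::nat) ^ p = 2 * 2 ^ (p - 1)"
  using p_ge by (cases p) auto

text \<open>A positive exponent forces a normalised significand, at least
  \<open>2 ^ (p - 1)\<close>; one exponent step up, this already exceeds everything below
  \<open>2 ^ p\<close>.\<close>

lemma magnitude_less:
  assumes "wf_float e s" "wf_float e' s'" "e < e'"
  shows "s * 2 ^ e < s' * 2 ^ e'"
proof -
  have "s * 2 ^ e < 2 ^ p * 2 ^ e" using assms by (simp add: wf_float_def)
  also have "\<dots> = 2 ^ (p - 1) * 2 ^ Suc e" by (simp add: double_pow)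
  also have "\<dots> \<le> 2 ^ (p - 1) * 2 ^ e'"
    using assms(3) by (intro mult_left_mono power_increasing) auto
  also have "\<dots> \<le> s' * 2 ^ e'" using assms by (auto simp: wf_float_def)
  finally show ?thesis .
qed

lemma magnitude_inj:
  assumes "wf_float e s" "wf_float e' s'" "s * 2 ^ e = s' * 2 ^ e'"
  shows "e = e' \<and> s = s'"
  using magnitude_less[of e s e' s'] magnitude_less[of e' s' e s] assms
  by (cases e e' rule: linorder_cases) auto

lemma magnitude_eq_real: "real s * 2 ^ e * \<delta> = real s' * 2 ^ e' * \<delta> \<longleftrightarrow> s * 2 ^ e = s' * 2 ^ e'"
proof -
  have "real s * 2 ^ e * \<delta> = real s' * 2 ^ e' * \<delta> \<longleftrightarrow> real (s * 2 ^ e) = real (s' * 2 ^ e')"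
    using \<delta>_pos by simp
  then show ?thesis by (simp only: of_nat_eq_iff)
qed

lemma magnitude_less_real: "real s * 2 ^ e * \<delta> < real s' * 2 ^ e' * \<delta> \<longleftrightarrow> s * 2 ^ e < s' * 2 ^ e'"
proof -
  have "real s * 2 ^ e * \<delta> < real s' * 2 ^ e' * \<delta> \<longleftrightarrow> real (s * 2 ^ e) < real (s' * 2 ^ e')"
    using \<delta>_pos by simp
  then show ?thesis by (simp only: of_nat_less_iff)
qed

text \<open>Each step trades one power of two in the exponent for a doubled significand, until the
  leading bit is set or the exponent is 0.\<close>

lemma normalize:
  "s < 2 ^ p \<Longrightarrow> e \<le> 2 * B + 1 \<Longrightarrow> \<exists>e' s'. wf_float e' s' \<and> s' * 2 ^ e' = s * 2 ^ e"
proof (induction e arbitrary: s)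
  case 0
  then show ?case by - (rule exI[of _ 0], rule exI[of _ s], auto simp: wf_float_def)
next
  case (Suc e)
  show ?case
  proof (cases "2 ^ (p - 1) \<le> s")
    case True
    then show ?thesis using Suc.prems
      by - (rule exI[of _ "Suc e"], rule exI[of _ s], auto simp: wf_float_def)
  next
    case False
    then show ?thesis using Suc.IH[of "2 * s"] Suc.prems double_pow by (auto simp: mult_ac)
  qed
qed

lemma representable:
  assumes "\<bar>k\<bar> < 2 ^ p" "e \<le> 2 * B + 1"
  shows "\<exists>f. val F f (of_int k * 2 ^ e * \<delta>)"
proof -
  have "nat \<bar>k\<bar> < 2 ^ p" using assms(1) by (simp add: nat_less_iff)
  from normalize[OF this assms(2)] obtain e' s' where
    w: "wf_float e' s'" "s' * 2 ^ e' = nat \<bar>k\<bar> * 2 ^ e" by blast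
  have "real s' * 2 ^ e' * \<delta> = real (nat \<bar>k\<bar>) * 2 ^ e * \<delta>"
    using w(2) by (simp only: magnitude_eq_real)
  then have "val F (Fin (k < 0) e' s') (of_int k * 2 ^ e * \<delta>)"
    using w(1) by (auto simp: val_def Fin_fin_floats rval_Fin)
  then show ?thesis ..
qed

lemma overflow_bound_eq: "overflow_bound F = (2 ^ p - 1 / 2) * 2 ^ (2 * B + 1) * \<delta>"
proof -
  have "(2::int) ^ (p + 1) - 1 - int B = int (2 * B + 1) - int B"
  proof -
    have "int (2 ^ (p + 1)) = int (2 * B + 2)" by (simp only: emax)
    then show ?thesis by simp
  qed
  then have "2 powi (2 ^ exp_bits F - 1 - bias F) = (2::real) powi (int (2 * B + 1) - int B)"
    by (simp add: ex bias_eq)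
  also have "\<dots> = 2 ^ (2 * B + 1) / 2 ^ B"
    by (subst power_int_diff) (simp_all only: power_int_of_nat, simp)
  finally have *: "2 powi (2 ^ exp_bits F - 1 - bias F) = (2::real) ^ (2 * B + 1) / 2 ^ B" .
  have "B + p - 1 = B + (p - 1)" using p_ge by simp
  then show ?thesis unfolding overflow_bound_def *
    by (simp add: sig \<delta>_def power_add)
qed

lemma less_overflow_bound:
  assumes "f \<in> fin_floats F" "\<bar>x\<bar> \<le> \<bar>rval F f\<bar>"
  shows "\<bar>x\<bar> < overflow_bound F"
proof -
  obtain b e s where f: "f = Fin b e s" "wf_float e s" using assms(1) by (rule fin_floats_cases)
  have "s + 1 \<le> 2 ^ p" using f(2) by (simp add: wf_float_def)
  then have "real (s + 1) \<le> real (2 ^ p)" by (simp only: of_nat_le_iff)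
  then have s: "real s \<le> 2 ^ p - 1" by simp
  have "\<bar>x\<bar> \<le> real s * 2 ^ e * \<delta>" using assms(2) by (simp add: f abs_rval_Fin)
  also have "\<dots> \<le> (2 ^ p - 1) * 2 ^ (2 * B + 1) * \<delta>"
    using s f(2) \<delta>_pos
    by (intro mult_mono power_increasing) (auto simp: wf_float_def)
  also have "\<dots> < overflow_bound F"
    unfolding overflow_bound_eq using \<delta>_pos by (intro mult_strict_right_mono) auto
  finally show ?thesis .
qed

text \<open>The next larger magnitude has significand \<open>s + 1\<close>, or, if \<open>s\<close>
  is all ones and hence odd, the even significand \<open>2 ^ (p - 1)\<close> at the next exponent.
  Parity changes in both cases, which is what makes ties-to-even well defined.\<close>

lemma succ_float:
  assumes "wf_float e s" "wf_float e' s'" "s * 2 ^ e < s' * 2 ^ e'"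
  shows "\<exists>e'' s''. wf_float e'' s'' \<and> s * 2 ^ e < s'' * 2 ^ e'' \<and> s'' * 2 ^ e'' \<le> s' * 2 ^ e' \<and>
    even s'' = odd s"
proof -
  have ee: "e \<le> e'" using magnitude_less[OF assms(2,1)] assms(3) by (meson leI less_asym)
  have ev: "even ((2::nat) ^ (p - 1))" using p_ge by simp
  show ?thesis
  proof (cases "e = e'")
    case True
    then have "s < s'" using assms(3) by simp
    then have "Suc s * 2 ^ e \<le> s' * 2 ^ e" by (intro mult_right_mono) auto
    then show ?thesis using assms True \<open>s < s'\<close>
      by - (rule exI[of _ e], rule exI[of _ "Suc s"], auto simp: wf_float_def)
  next
    case False
    show ?thesis
    proof (cases "Suc s < 2 ^ p")
      case True
      then have "wf_float e (Suc s)" using assms(1) by (auto simp: wf_float_def)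
      then show ?thesis using magnitude_less[of e "Suc s" e' s'] assms False ee
        by - (rule exI[of _ e], rule exI[of _ "Suc s"], auto)
    next
      case False': False
      then have s: "Suc s = 2 * 2 ^ (p - 1)" using assms(1) double_pow by (auto simp: wf_float_def)
      have "odd s" using s by presburger
      have "Suc e \<le> e'" using ee False by simp
      then have "wf_float (Suc e) (2 ^ (p - 1))" "(2::nat) ^ (p - 1) * 2 ^ Suc e \<le> s' * 2 ^ e'"
        using assms(2) double_pow
        by (auto simp: wf_float_def simp del: power_Suc intro!: mult_mono power_increasing)
      moreover have "s * 2 ^ e < 2 ^ (p - 1) * 2 ^ Suc e"
      proof -
        have "s * 2 ^ e < Suc s * 2 ^ e" by simp
        also have "\<dots> = 2 ^ (p - 1) * 2 ^ Suc e" unfolding s by simp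
        finally show ?thesis .
      qed
      ultimately show ?thesis using ev \<open>odd s\<close> by blast
    qed
  qed
qed

section \<open>Nearest floats and tie-breaking\<close>

lemma nearest_cases:
  assumes "f \<in> nearest F b x"
  obtains e s where "f = Fin b e s" "wf_float e s"
proof -
  have "f \<in> fin_floats F" "sgn_bit f = b" using assms by (simp_all add: nearest_def)
  then show ?thesis using that by (cases rule: fin_floats_cases) auto
qed

lemma nearest_le:
  assumes "f \<in> nearest F b x" "wf_float e s"
  shows "\<bar>rval F f - x\<bar> \<le> \<bar>rval F (Fin b e s) - x\<bar>"
  using assms by (simp add: nearest_def Fin_fin_floats)

text \<open>Two nearest floats are neighbours: a float strictly between them would be strictly
  closer to \<open>x\<close> than one of the two. Neighbours differ in parity by
  \<open>succ_float\<close>.\<close>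

lemma nearest_parity_aux:
  assumes "f \<in> nearest F b x" "g \<in> nearest F b x" "\<bar>rval F f\<bar> < \<bar>rval F g\<bar>"
  shows "even (signif f) = odd (signif g)"
proof -
  obtain e s where f: "f = Fin b e s" "wf_float e s" using assms(1) by (rule nearest_cases)
  obtain e' s' where g: "g = Fin b e' s'" "wf_float e' s'" using assms(2) by (rule nearest_cases)
  have "real s * 2 ^ e * \<delta> < real s' * 2 ^ e' * \<delta>"
    using assms(3) by (simp add: f g abs_rval_Fin)
  then have "s * 2 ^ e < s' * 2 ^ e'" by (simp only: magnitude_less_real)
  from succ_float[OF f(2) g(2) this] obtain e'' s'' where h: "wf_float e'' s''"
    "s * 2 ^ e < s'' * 2 ^ e''" "s'' * 2 ^ e'' \<le> s' * 2 ^ e'" "even s'' = odd s" by blast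
  have "s'' * 2 ^ e'' = s' * 2 ^ e'"
  proof (rule ccontr)
    assume "\<not> ?thesis"
    then have "s'' * 2 ^ e'' < s' * 2 ^ e'" using h(3) by simp
    then have lt: "real s'' * 2 ^ e'' * \<delta> < real s' * 2 ^ e' * \<delta>" "real s * 2 ^ e * \<delta> < real s'' * 2 ^ e'' * \<delta>"
      using h(2) by (simp_all only: magnitude_less_real)
    have "\<bar>rval F f - x\<bar> \<le> \<bar>rval F (Fin b e'' s'') - x\<bar>" "\<bar>rval F g - x\<bar> \<le> \<bar>rval F (Fin b e'' s'') - x\<bar>"
      using assms(1,2) h(1) by (simp_all add: nearest_le)
    then show False using lt unfolding f g rval_Fin by (cases b) auto
  qed
  with magnitude_inj[OF h(1) g(2)] h(4) show ?thesis by (simp add: f g)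
qed

lemma nearest_parity:
  assumes "f \<in> nearest F b x" "g \<in> nearest F b x" "f \<noteq> g"
  shows "even (signif f) = odd (signif g)"
proof -
  obtain e s where f: "f = Fin b e s" "wf_float e s" using assms(1) by (rule nearest_cases)
  obtain e' s' where g: "g = Fin b e' s'" "wf_float e' s'" using assms(2) by (rule nearest_cases)
  have "\<bar>rval F f\<bar> \<noteq> \<bar>rval F g\<bar>"
    using magnitude_inj[OF f(2) g(2)] assms(3) by (simp only: f g abs_rval_Fin magnitude_eq_real) auto
  then show ?thesis using nearest_parity_aux[OF assms(1,2)] nearest_parity_aux[OF assms(2,1)]
    by (cases "\<bar>rval F f\<bar>" "\<bar>rval F g\<bar>" rule: linorder_cases) auto
qed

lemma finite_fin_floats: "finite (fin_floats F)"
proof -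
  have "fin_floats F \<subseteq> (\<lambda>(b, e, s). Fin b e s) ` (UNIV \<times> {..2 * B + 1} \<times> {..<2 ^ p})"
  proof
    fix x assume "x \<in> fin_floats F"
    then obtain b e s where "x = Fin b e s" "wf_float e s" by (rule fin_floats_cases)
    then show "x \<in> (\<lambda>(b, e, s). Fin b e s) ` (UNIV \<times> {..2 * B + 1} \<times> {..<2 ^ p})"
      by (intro image_eqI[of _ _ "(b, e, s)"]) (simp_all add: wf_float_def)
  qed
  then show ?thesis by (rule finite_subset) auto
qed

lemma nearest_nonempty: "nearest F b x \<noteq> {}"
proof -
  let ?S = "{f \<in> fin_floats F. sgn_bit f = b}"
  have "finite ?S" using finite_fin_floats by simp
  moreover have "Fin b 0 0 \<in> ?S" by (simp add: Fin_fin_floats wf_float_def)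
  ultimately obtain f where "f \<in> ?S" "\<forall>g\<in>?S. \<bar>rval F f - x\<bar> \<le> \<bar>rval F g - x\<bar>"
    using arg_min_if_finite[of ?S "\<lambda>f. \<bar>rval F f - x\<bar>"]
    by (metis (no_types, lifting) empty_iff linorder_not_less)
  then have "f \<in> nearest F b x" by (auto simp: nearest_def)
  then show ?thesis by blast
qed

text \<open>The condition under the definite description in \<open>fround\<close>, isolated so that
  the description can be opened once it is known to be unique.\<close>

definition even_rule :: "bool \<Rightarrow> real \<Rightarrow> fp \<Rightarrow> bool" where
  "even_rule b x f \<longleftrightarrow> f \<in> nearest F b x \<and> (\<forall>g \<in> nearest F b x. g \<noteq> f \<longrightarrow>
     even (signif f) \<or> odd (signif g) \<and> \<bar>rval F g\<bar> < \<bar>rval F f\<bar>)"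

text \<open>Distinct nearest floats have opposite parity, so if there are several, exactly one of
  them is even, and it wins against the odd one.\<close>

lemma even_rule_unique: "\<exists>!f. even_rule b x f"
proof (cases "\<exists>f \<in> nearest F b x. \<exists>g \<in> nearest F b x. f \<noteq> g")
  case True
  then obtain f where f: "f \<in> nearest F b x" "even (signif f)" using nearest_parity by blast
  show ?thesis
  proof (rule ex1I[of _ f])
    show "even_rule b x f" using f by (simp add: even_rule_def)
    fix g assume "even_rule b x g"
    then show "g = f" using f nearest_parity[of f b x g] unfolding even_rule_def by metis
  qed
next
  case False
  then show ?thesis using nearest_nonempty[of b x] by (auto simp: even_rule_def)
qed

section \<open>Exactness and monotonicity of rounding\<close>

lemma fround_even_rule:
  assumes "\<bar>x\<bar> < overflow_bound F"
  shows "even_rule (if x = 0 then z else x < 0) x (fround F z x)"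
proof -
  have "fround F z x = (THE f. even_rule (if x = 0 then z else x < 0) x f)"
    using assms by (simp add: fround_def Let_def even_rule_def)
  then show ?thesis using theI'[OF even_rule_unique] by simp
qed

lemma fround_nearest:
  "\<bar>x\<bar> < overflow_bound F \<Longrightarrow> fround F z x \<in> nearest F (if x = 0 then z else x < 0) x"
  using fround_even_rule[of x z] by (simp add: even_rule_def)

lemma fround_fin: "\<bar>x\<bar> < overflow_bound F \<Longrightarrow> fround F z x \<in> fin_floats F"
  using fround_nearest[of x z] by (simp add: nearest_def)

text \<open>Only floats of one sign bit compete in \<open>nearest\<close>. A value on the right side
  of 0, including 0 itself, can be encoded with that bit and so enters the competition.\<close>

lemma same_sign:
  assumes "val F f y" "y \<ge> 0 \<and> \<not> b \<or> y \<le> 0 \<and> b"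
  shows "\<exists>f'. val F f' y \<and> sgn_bit f' = b"
proof -
  obtain b' e s where f: "f = Fin b' e s" "wf_float e s" using assms(1)
    by (auto simp: val_def elim: fin_floats_cases)
  have "0 \<le> real s * 2 ^ e * \<delta>" using \<delta>_pos by simp
  then have "rval F (Fin b e s) = y"
    using assms unfolding val_def f rval_Fin by (cases b; cases b') auto
  then have "val F (Fin b e s) y" using f(2) by (simp add: val_def Fin_fin_floats)
  then show ?thesis by force
qed

text \<open>Nearest rounding freed of sign bits: \<open>0 \<le> x * y\<close> places
  \<open>y\<close> on the same side of 0 as \<open>x\<close>. Exactness on representable values and
  the bounds \<open>fround_ge\<close> and \<open>fround_le\<close> all come from this
  estimate.\<close>

lemma fround_dist:
  assumes "\<bar>x\<bar> < overflow_bound F" "val F g y" "0 \<le> x * y"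
  shows "\<bar>rval F (fround F z x) - x\<bar> \<le> \<bar>y - x\<bar>"
proof (cases "x = 0")
  case True
  have "val F (Fin z 0 0) 0" by (rule val_zero)
  then have "\<bar>rval F (fround F z x) - x\<bar> \<le> \<bar>0 - x\<bar>"
    using fround_nearest[OF assms(1), of z] True by (auto simp: nearest_def val_def)
  then show ?thesis using True by simp
next
  case False
  have "y \<ge> 0 \<and> \<not> (x < 0) \<or> y \<le> 0 \<and> x < 0"
    using assms(3) False by (auto simp: zero_le_mult_iff)
  from same_sign[OF assms(2) this] obtain g' where "val F g' y" "sgn_bit g' = (x < 0)" by blast
  then show ?thesis using fround_nearest[OF assms(1), of z] False by (auto simp: nearest_def val_def)
qed

lemma fround_exact:
  assumes "val F f x" shows "val F (fround F z x) x"
proof -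
  have o: "\<bar>x\<bar> < overflow_bound F" using less_overflow_bound[of f x] assms by (auto simp: val_def)
  show ?thesis using fround_fin[OF o, of z] fround_dist[OF o assms, of z] by (simp add: val_def)
qed

text \<open>Rounding cannot cross a representable value: a result below \<open>y\<close> would be
  farther from \<open>x\<close> than \<open>y\<close> is.\<close>

lemma fround_ge:
  assumes "\<bar>x\<bar> < overflow_bound F" "val F g y" "0 \<le> y" "y \<le> x"
  shows "y \<le> rval F (fround F z x)"
  using fround_dist[OF assms(1,2), of z] assms(3,4) by auto

lemma fround_le:
  assumes "\<bar>x\<bar> < overflow_bound F" "val F g y" "0 \<le> x" "x \<le> y"
  shows "rval F (fround F z x) \<le> y"
  using fround_dist[OF assms(1,2), of z] assms(3,4) by auto

lemma fround_nonpos: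
  assumes "\<bar>x\<bar> < overflow_bound F" "x \<le> 0"
  shows "rval F (fround F z x) \<le> 0"
proof -
  obtain e s where f: "fround F z x = Fin (if x = 0 then z else x < 0) e s"
    using fround_nearest[OF assms(1)] by (rule nearest_cases)
  show ?thesis
  proof (cases "x = 0")
    case True
    then show ?thesis using fround_dist[OF assms(1) val_zero, of z] by simp
  next
    case False
    then show ?thesis using f assms(2) \<delta>_pos by (simp add: rval_Fin)
  qed
qed

lemma representable_mult:
  assumes "a = of_int k * (2 ^ e * \<delta>)" "\<bar>a\<bar> < 2 ^ p * (2 ^ e * \<delta>)" "e \<le> 2 * B + 1"
  shows "\<exists>f. val F f a"
proof -
  have "real_of_int \<bar>k\<bar> < 2 ^ p" using assms(1,2) \<delta>_pos by (simp add: abs_mult)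
  then have "\<bar>k\<bar> < 2 ^ p" by (metis of_int_less_iff of_int_numeral of_int_power)
  from representable[OF this assms(3)] show ?thesis using assms(1) by (simp add: mult.assoc)
qed

lemma representable_power:
  assumes "e \<le> 2 * B + 1" shows "\<exists>f. val F f (2 ^ e * \<delta>)"
  using representable[of 1 e] assms p_ge by simp

lemma inverse_power_unit: "n \<le> B + p - 1 \<Longrightarrow> 1 / 2 ^ n = 2 ^ (B + p - 1 - n) * \<delta>"
proof -
  assume "n \<le> B + p - 1"
  then have "(2::real) ^ n * 2 ^ (B + p - 1 - n) = 2 ^ (B + p - 1)"
    by (simp only: power_add[symmetric] le_add_diff_inverse)
  then show ?thesis using one_unit by (simp add: field_simps)
qed

lemma power_unit: "2 ^ n = 2 ^ (B + p - 1 + n) * \<delta>"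
  using one_unit by (simp add: power_add)

lemma representable_inverse_power: "n \<le> B + p - 1 \<Longrightarrow> \<exists>f. val F f (1 / 2 ^ n)"
  using representable_power[of "B + p - 1 - n"] four_p_le_B inverse_power_unit[of n] by simp

lemma representable_two_power: "n \<le> 3 * p \<Longrightarrow> \<exists>f. val F f (2 ^ n)"
  using representable_power[of "B + p - 1 + n"] four_p_le_B power_unit[of n] by simp

lemma representable_int: "\<bar>k\<bar> < 2 ^ p \<Longrightarrow> \<exists>f. val F f (of_int k)"
  using representable[of k "B + p - 1"] four_p_le_B one_unit by (simp add: mult.assoc)

lemma representable_nat: "k < 2 ^ p \<Longrightarrow> \<exists>f. val F f (real k)"
  using representable_int[of "int k"] by (simp add: nat_less_iff)

section \<open>Exact operations and sums\<close>

lemma fadd_fround: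
  assumes "val F x a" "val F y b" shows "\<exists>z. fadd F x y = fround F z (a + b)"
  using assms by (cases x; cases y) (auto simp: val_def fin_floats_def)

lemma fmul_fround:
  assumes "val F x a" "val F y b" shows "\<exists>z. fmul F x y = fround F z (a * b)"
  using assms by (cases x; cases y) (auto simp: val_def fin_floats_def)

lemma fdiv_fround:
  assumes "val F x a" "val F y b" "b \<noteq> 0" shows "\<exists>z. fdiv F x y = fround F z (a / b)"
  using assms by (cases x; cases y) (auto simp: val_def fin_floats_def rval_Fin)

lemma fadd_exact:
  assumes "val F x a" "val F y b" "val F f (a + b)" shows "val F (fadd F x y) (a + b)"
  using fadd_fround[OF assms(1,2)] fround_exact[OF assms(3)] by auto

lemma fmul_exact:
  assumes "val F x a" "val F y b" "val F f (a * b)" shows "val F (fmul F x y) (a * b)"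
  using fmul_fround[OF assms(1,2)] fround_exact[OF assms(3)] by auto

lemma fadd_zero_left: "val F x 0 \<Longrightarrow> val F y b \<Longrightarrow> val F (fadd F x y) b"
  using fadd_exact[of x 0 y b y] by simp

lemma fadd_zero_right: "val F x a \<Longrightarrow> val F y 0 \<Longrightarrow> val F (fadd F x y) a"
  using fadd_exact[of x a y 0 x] by simp

lemma fmul_zero_left: "val F x 0 \<Longrightarrow> y \<in> fin_floats F \<Longrightarrow> val F (fmul F x y) 0"
  using fmul_exact[of x 0 y _ x] valI by fastforce

lemma fmul_zero_right: "x \<in> fin_floats F \<Longrightarrow> val F y 0 \<Longrightarrow> val F (fmul F x y) 0"
  using fmul_exact[of x _ y 0 y] valI by fastforce

lemma fmul_one_right: "val F x a \<Longrightarrow> val F y 1 \<Longrightarrow> val F (fmul F x y) a"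
  using fmul_exact[of x a y 1 x] by simp

lemma fround_nonzero: "x \<noteq> 0 \<Longrightarrow> fround F z x = fround F False x"
  by (simp add: fround_def)

lemma fsum_single: "fsum F [x] = x"
  by (simp add: fsum_def)

text \<open>Adding a zero keeps the value of the accumulator, so only the number \<open>i\<close> of
  copies of \<open>x\<close> seen so far matters. The invariant \<open>P\<close> relates this number
  to the accumulated value and need only be preserved below \<open>n\<close>.\<close>

lemma foldl_fadd_invariant:
  assumes "x \<noteq> 0" "\<forall>y\<in>set ys. val F y 0 \<or> val F y x"
    and step: "\<And>i acc a z. i < n \<Longrightarrow> P i a \<Longrightarrow> val F acc a \<Longrightarrow>
          \<exists>a'. val F (fround F z (a + x)) a' \<and> P (Suc i) a'"
    and "val F acc a" "P i a" "i + length (filter (\<lambda>y. val F y x) ys) \<le> n"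
  shows "\<exists>a. val F (foldl (fadd F) acc ys) a \<and> P (i + length (filter (\<lambda>y. val F y x) ys)) a"
  using assms(2,4-)
proof (induction ys arbitrary: acc a i)
  case Nil
  then show ?case by auto
next
  case (Cons y ys)
  show ?case
  proof (cases "val F y x")
    case True
    obtain z where "fadd F acc y = fround F z (a + x)" using fadd_fround Cons.prems(2) True by blast
    with step[of i a acc z] Cons.prems True obtain a' where "val F (fadd F acc y) a'" "P (Suc i) a'" by auto
    from Cons.IH[OF _ this] Cons.prems True show ?thesis by auto
  next
    case False
    then have "val F y 0" using Cons.prems by simp
    then have "val F (fadd F acc y) a" using fadd_zero_right Cons.prems by blast
    from Cons.IH[OF _ this] Cons.prems False show ?thesis by auto
  qed
qed

lemma fsum_invariant:
  assumes "x \<noteq> 0" "\<forall>y\<in>set xs. val F y 0 \<or> val F y x" "P 0 0"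
    and step: "\<And>i acc a z. i < length (filter (\<lambda>y. val F y x) xs) \<Longrightarrow> P i a \<Longrightarrow> val F acc a \<Longrightarrow>
          \<exists>a'. val F (fround F z (a + x)) a' \<and> P (Suc i) a'"
  shows "\<exists>a. val F (fsum F xs) a \<and> P (length (filter (\<lambda>y. val F y x) xs)) a"
proof -
  let ?ys = "sort_key (fval F) xs"
  have len: "length (filter (\<lambda>y. val F y x) ?ys) = length (filter (\<lambda>y. val F y x) xs)"
    by (metis mset_sort mset_filter size_mset)
  have set: "set ?ys = set xs" by simp
  show ?thesis
  proof (cases ?ys)
    case Nil
    then show ?thesis using assms(3) val_zero len by (auto simp: fsum_def)
  next
    case (Cons y ys)
    have ys: "\<forall>y\<in>set ys. val F y 0 \<or> val F y x" using assms(2) set Cons by auto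
    have sum: "fsum F xs = foldl (fadd F) y ys" by (simp add: fsum_def Cons)
    show ?thesis
    proof (cases "val F y x")
      case True
      then have lt: "0 < length (filter (\<lambda>y. val F y x) xs)" using len Cons by (simp del: length_greater_0_conv)
      \<comment> \<open>The fold starts with the first summand and not with 0. Rounding
        \<open>0 + x\<close> is exact, so the invariant step from 0 also yields the invariant for
        this start.\<close>
      obtain a' where "val F (fround F False (0 + x)) a'" "P (Suc 0) a'"
        using step[OF lt assms(3) val_zero] by blast
      then have "P 1 x" using fround_exact[OF True, of False] by (auto simp: val_def)
      from foldl_fadd_invariant[where P=P, OF assms(1) ys step True this] show ?thesis
        using True len Cons by (simp add: sum)
    next
      case False
      then have "val F y 0" using assms(2) set Cons by auto
      from foldl_fadd_invariant[where P=P, OF assms(1) ys step this assms(3)] show ?thesis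
        using False len Cons by (simp add: sum)
    qed
  qed
qed

text \<open>Every partial sum is a multiple of the common unit and, by the bound on the absolute
  values, less than \<open>2 ^ p\<close> units in size. It is thus representable, and no addition
  rounds, whatever the order.\<close>

lemma foldl_fadd_exact:
  assumes "e \<le> 2 * B + 1" "\<forall>y\<in>set ys. y \<in> fin_floats F \<and> (\<exists>k::int. rval F y = of_int k * (2 ^ e * \<delta>))"
    "val F acc a" "a = of_int k * (2 ^ e * \<delta>)"
    "\<bar>a\<bar> + sum_list (map (\<lambda>y. \<bar>rval F y\<bar>) ys) < 2 ^ p * (2 ^ e * \<delta>)"
  shows "val F (foldl (fadd F) acc ys) (a + sum_list (map (rval F) ys))"
  using assms(2-)
proof (induction ys arbitrary: acc a k)
  case Nil
  then show ?case by simp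
next
  case (Cons y ys)
  obtain k' :: int where k': "rval F y = of_int k' * (2 ^ e * \<delta>)" using Cons.prems by auto
  have y: "val F y (rval F y)" using Cons.prems valI by simp
  have nn: "0 \<le> sum_list (map (\<lambda>y. \<bar>rval F y\<bar>) ys)" by (intro sum_list_nonneg) auto
  have eq: "a + rval F y = of_int (k + k') * (2 ^ e * \<delta>)" using Cons.prems k' by (simp add: algebra_simps)
  have "\<bar>a + rval F y\<bar> < 2 ^ p * (2 ^ e * \<delta>)" using Cons.prems(4) nn by simp
  from representable_mult[OF eq this assms(1)]
  have "val F (fadd F acc y) (a + rval F y)" using fadd_exact[OF Cons.prems(2) y] by blast
  from Cons.IH[OF _ this eq] Cons.prems show ?case by (simp add: add.assoc)
qed

lemma fsum_exact:
  assumes "e \<le> 2 * B + 1" "\<forall>y\<in>set xs. y \<in> fin_floats F \<and> (\<exists>k::int. rval F y = of_int k * (2 ^ e * \<delta>))"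
    "sum_list (map (\<lambda>y. \<bar>rval F y\<bar>) xs) < 2 ^ p * (2 ^ e * \<delta>)"
  shows "val F (fsum F xs) (sum_list (map (rval F) xs))"
proof -
  let ?ys = "sort_key (fval F) xs"
  have perm: "sum_list (map f ?ys) = sum_list (map f xs)" for f :: "fp \<Rightarrow> real"
    by (metis mset_map mset_sort sum_mset_sum_list)
  show ?thesis
  proof (cases ?ys)
    case Nil
    then show ?thesis using val_zero perm[of "rval F"] by (auto simp: fsum_def)
  next
    case (Cons y ys)
    have m: "\<forall>y\<in>set (y # ys). y \<in> fin_floats F \<and> (\<exists>k::int. rval F y = of_int k * (2 ^ e * \<delta>))"
      using assms(2) by (metis Cons set_sort)
    then obtain k :: int where k: "rval F y = of_int k * (2 ^ e * \<delta>)" by auto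
    have y: "val F y (rval F y)" using m valI by simp
    have "val F (foldl (fadd F) y ys) (rval F y + sum_list (map (rval F) ys))"
      using m perm[of "\<lambda>y. \<bar>rval F y\<bar>"] assms(3) Cons
      by (intro foldl_fadd_exact[OF assms(1) _ y k]) auto
    then show ?thesis using perm[of "rval F"] by (simp add: fsum_def Cons)
  qed
qed

lemma fsum_map_exact:
  assumes "e \<le> 2 * B + 1" "\<And>i. i < n \<Longrightarrow> val F (f i) (a i)"
    "\<And>i. i < n \<Longrightarrow> \<exists>k::int. a i = of_int k * (2 ^ e * \<delta>)"
    "(\<Sum>i<n. \<bar>a i\<bar>) < 2 ^ p * (2 ^ e * \<delta>)"
  shows "val F (fsum F (map f [0..<n])) (\<Sum>i<n. a i)"
proof -
  have sums: "sum_list (map g (map f [0..<n])) = (\<Sum>i<n. g (f i))" for g :: "fp \<Rightarrow> real"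
    by (simp add: interv_sum_list_conv_sum_set_nat atLeast0LessThan)
  have r: "rval F (f i) = a i" if "i < n" for i using assms(2)[OF that] by (simp add: val_def)
  have "val F (fsum F (map f [0..<n])) (sum_list (map (rval F) (map f [0..<n])))"
  proof (rule fsum_exact[OF assms(1)])
    show "\<forall>y\<in>set (map f [0..<n]). y \<in> fin_floats F \<and> (\<exists>k::int. rval F y = of_int k * (2 ^ e * \<delta>))"
      using assms(3) r val_fin[OF assms(2)] by auto
    show "sum_list (map (\<lambda>y. \<bar>rval F y\<bar>) (map f [0..<n])) < 2 ^ p * (2 ^ e * \<delta>)"
      unfolding sums using assms(4) r by simp
  qed
  then show ?thesis by (simp only: sums) (simp add: r)
qed

text \<open>With the exponent of \<open>f j\<close> as common unit, the absolute sum is its own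
  significand, below \<open>2 ^ p\<close>. Selecting a coordinate is therefore exact for every
  finite float, including subnormal ones.\<close>

lemma fsum_map_single:
  assumes "j < n" "val F (f j) r" "\<And>i. i < n \<Longrightarrow> i \<noteq> j \<Longrightarrow> val F (f i) 0"
  shows "val F (fsum F (map f [0..<n])) r"
proof -
  let ?a = "\<lambda>i. if i = j then r else 0"
  obtain b e s where f: "f j = Fin b e s" "wf_float e s"
    using val_fin[OF assms(2)] by (rule fin_floats_cases)
  have r: "r = (if b then -1 else 1) * (real s * 2 ^ e * \<delta>)"
    using assms(2) by (simp add: val_def f rval_Fin)
  then have r': "r = of_int (if b then - int s else int s) * (2 ^ e * \<delta>)" by simp
  have s: "real s < 2 ^ p" using f(2) by (simp add: wf_float_def)
  have "val F (fsum F (map f [0..<n])) (\<Sum>i<n. ?a i)"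
  proof (rule fsum_map_exact)
    show "e \<le> 2 * B + 1" using f(2) by (simp add: wf_float_def)
    show "val F (f i) (?a i)" if "i < n" for i using assms that by auto
    show "\<exists>k::int. ?a i = of_int k * (2 ^ e * \<delta>)" if "i < n" for i
      using r' by (cases "i = j") (auto intro: exI[of _ 0])
    have "(\<Sum>i<n. \<bar>?a i\<bar>) = (\<Sum>i<n. if i = j then \<bar>r\<bar> else 0)" by (intro sum.cong) auto
    also have "\<dots> = \<bar>r\<bar>" using assms(1) by simp
    also have "\<dots> < 2 ^ p * (2 ^ e * \<delta>)" unfolding r using \<delta>_pos s by (simp add: abs_mult)
    finally show "(\<Sum>i<n. \<bar>?a i\<bar>) < 2 ^ p * (2 ^ e * \<delta>)" .
  qed
  then show ?thesis using assms(1) by simp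
qed

lemma fsum_map_zero:
  assumes "\<And>i. i < n \<Longrightarrow> val F (f i) 0"
  shows "val F (fsum F (map f [0..<n])) 0"
  using fsum_map_exact[of 0 n f "\<lambda>_. 0"] assms \<delta>_pos by (force intro: exI[of _ 0])

lemma val_less_overflow: "val F f y \<Longrightarrow> 0 \<le> x \<Longrightarrow> x \<le> y \<Longrightarrow> \<bar>x\<bar> < overflow_bound F"
  by (intro less_overflow_bound[of f]) (auto simp: val_def)

end

section \<open>Saturating sums and attention weights\<close>

context float_format
begin

text \<open>Floats of exponent \<open>Suc e\<close> are two units apart, so \<open>2 ^ p + 1\<close>
  units is the midpoint between the significands \<open>2 ^ (p - 1)\<close> and
  \<open>2 ^ (p - 1) + 1\<close>. The lower one is even.\<close>

lemma fround_tie: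
  assumes "e \<le> 2 * B"
  shows "val F (fround F z ((2 ^ p + 1) * (2 ^ e * \<delta>))) (2 ^ p * (2 ^ e * \<delta>))"
proof -
  define u where "u = 2 ^ e * \<delta>"
  define x where "x = (2 ^ p + 1) * u"
  define h where "h = Fin False (Suc e) (2 ^ (p - 1))"
  have u: "0 < u" using \<delta>_pos by (simp add: u_def)
  then have x: "0 < x" by (simp add: x_def add_pos_pos)
  have wf: "wf_float (Suc e) (2 ^ (p - 1))" using assms double_pow by (simp add: wf_float_def)
  have wf': "wf_float (Suc e) (2 ^ (p - 1) + 1)" using assms double_pow p_ge
    one_less_power[of "2::nat" "p - 1"] by (simp add: wf_float_def)
  have dp: "(2::real) ^ p = 2 * 2 ^ (p - 1)" using p_ge by (cases p) auto
  have h: "val F h (2 ^ p * u)" using wf by (simp add: val_def h_def Fin_fin_floats rval_Fin u_def dp)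
  have h': "val F (Fin False (Suc e) (2 ^ (p - 1) + 1)) ((2 ^ p + 2) * u)"
    using wf' by (simp add: val_def Fin_fin_floats rval_Fin u_def dp algebra_simps)
  have o: "\<bar>x\<bar> < overflow_bound F"
    using less_overflow_bound[OF val_fin[OF h'], of x] u by (simp only: val_rval[OF h']) (simp add: x_def)
  let ?r = "fround F z x"
  have rule: "even_rule False x ?r" using fround_even_rule[OF o, of z] x by simp
  then have near: "?r \<in> nearest F False x" by (simp add: even_rule_def)
  then obtain e' s where r: "?r = Fin False e' s" "wf_float e' s" by (rule nearest_cases)
  have dist: "\<bar>rval F ?r - x\<bar> \<le> u"
    using fround_dist[OF o h, of z] x u by (simp add: x_def algebra_simps)
  then have lo: "2 ^ p * u \<le> rval F ?r" and hi: "rval F ?r \<le> (2 ^ p + 2) * u"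
    by (auto simp: x_def algebra_simps)
  have lo': "2 ^ p * 2 ^ e \<le> s * 2 ^ e'"
  proof (rule ccontr)
    assume "\<not> ?thesis"
    then have "real s * 2 ^ e' * \<delta> < real (2 ^ p) * 2 ^ e * \<delta>" by (simp only: magnitude_less_real not_le)
    then show False using lo by (simp add: r rval_Fin u_def mult.assoc)
  qed
  have hi': "s * 2 ^ e' \<le> (2 ^ p + 2) * 2 ^ e"
  proof (rule ccontr)
    assume "\<not> ?thesis"
    then have "real (2 ^ p + 2) * 2 ^ e * \<delta> < real s * 2 ^ e' * \<delta>" by (simp only: magnitude_less_real not_le)
    then show False using hi by (simp add: r rval_Fin u_def mult.assoc add.commute)
  qed
  \<comment> \<open>The bounds on the result determine its exponent: at most \<open>e\<close> gives
    less than \<open>2 ^ p\<close> units, at least \<open>e + 2\<close> more than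
    \<open>2 ^ p + 2\<close>.\<close>
  have "e < e'"
  proof (rule ccontr)
    assume "\<not> e < e'"
    have "s * 2 ^ e' < 2 ^ p * 2 ^ e'" using r(2) by (simp add: wf_float_def)
    also have "\<dots> \<le> 2 ^ p * 2 ^ e" using \<open>\<not> e < e'\<close> by (intro mult_left_mono power_increasing) auto
    finally show False using lo' by simp
  qed
  have "e' < e + 2"
  proof (rule ccontr)
    assume "\<not> e' < e + 2"
    have "(2::nat) < 2 ^ p" using power_strict_increasing[of 1 p "2::nat"] p_ge by simp
    then have "(2 ^ p + 2) * 2 ^ e < (2 ^ p + 2 ^ p) * (2::nat) ^ e" by (intro mult_strict_right_mono) auto
    also have "\<dots> = 2 ^ (p - 1) * 2 ^ (e + 2)" by (simp add: double_pow)
    also have "\<dots> \<le> 2 ^ (p - 1) * 2 ^ e'" using \<open>\<not> e' < e + 2\<close> by (intro mult_left_mono power_increasing) auto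
    also have "\<dots> \<le> s * 2 ^ e'" using r(2) \<open>e < e'\<close> by (simp add: wf_float_def)
    finally show False using hi' by simp
  qed
  with \<open>e < e'\<close> have e': "e' = Suc e" by simp
  have "2 ^ p * 2 ^ e \<le> (2 * s) * 2 ^ e" "(2 * s) * 2 ^ e \<le> (2 ^ p + 2) * 2 ^ e"
    using lo' hi' by (simp_all add: e' mult_ac)
  then have "2 ^ p \<le> 2 * s" "2 * s \<le> 2 ^ p + 2" by (simp_all only: mult_le_cancel2) simp_all
  then have s: "s = 2 ^ (p - 1) \<or> s = 2 ^ (p - 1) + 1" using double_pow by linarith
  have ev: "even ((2::nat) ^ (p - 1))" using p_ge by simp
  \<comment> \<open>The odd upper neighbour is equally near, but then the even float
    \<open>h\<close> is nearest as well and the tie rule excludes the odd one.\<close>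
  have "s = 2 ^ (p - 1)"
  proof (rule ccontr)
    assume "s \<noteq> 2 ^ (p - 1)"
    then have s1: "s = 2 ^ (p - 1) + 1" using s by simp
    then have "rval F ?r = (2 ^ p + 2) * u" using h' by (simp add: r e' val_def)
    then have "\<bar>rval F ?r - x\<bar> = \<bar>rval F h - x\<bar>" using u by (simp add: x_def val_rval[OF h] algebra_simps)
    then have "h \<in> nearest F False x" using near val_fin[OF h] by (simp add: nearest_def h_def)
    moreover have "h \<noteq> ?r" using s1 by (simp add: h_def r)
    ultimately show False using rule ev s1 by (auto simp: even_rule_def r h_def)
  qed
  then have "?r = h" by (simp add: h_def r e')
  then show ?thesis using h by (simp add: x_def u_def)
qed

text \<open>Float addition of equal powers of two gets stuck at \<open>2\<^sup>p\<close> summands, where the next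
  increment is exactly half a unit in the last place.\<close>

lemma fsum_saturates:
  assumes "e \<le> 2 * B" "\<forall>y\<in>set xs. val F y 0 \<or> val F y (2 ^ e * \<delta>)"
  shows "val F (fsum F xs)
    (real (min (length (filter (\<lambda>y. val F y (2 ^ e * \<delta>)) xs)) (2 ^ p)) * (2 ^ e * \<delta>))"
proof -
  let ?u = "2 ^ e * \<delta>"
  let ?P = "\<lambda>i a. a = real (min i (2 ^ p)) * ?u"
  have "\<exists>a. val F (fsum F xs) a \<and> ?P (length (filter (\<lambda>y. val F y ?u) xs)) a"
  proof (rule fsum_invariant[OF _ assms(2)])
    show "?u \<noteq> 0" using \<delta>_pos by simp
    show "?P 0 0" by simp
    fix i acc a z assume a: "?P i a"
    show "\<exists>a'. val F (fround F z (a + ?u)) a' \<and> ?P (Suc i) a'"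
    proof (cases "i < 2 ^ p")
      case True
      have rep: "\<exists>f. val F f (real (Suc i) * ?u)"
      proof (cases "Suc i < 2 ^ p")
        case True
        then have "real (Suc i) < real (2 ^ p)" by (simp only: of_nat_less_iff)
        then show ?thesis using \<delta>_pos assms(1)
          by (intro representable_mult[of _ "int (Suc i)" e]) (auto simp: abs_mult)
      next
        case False
        \<comment> \<open>\<open>2 ^ p\<close> units need one bit too many at exponent
          \<open>e\<close>, but are \<open>2 ^ (p - 1)\<close> units at exponent
          \<open>Suc e\<close>.\<close>
        then have "Suc i = 2 ^ p" using True by simp
        then have "real (Suc i) = 2 ^ p" by (metis of_nat_numeral of_nat_power)
        then have "real (Suc i) * ?u = of_int (2 ^ (p - 1)) * (2 ^ Suc e * \<delta>)"
          using p_ge by (cases p) auto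
        then show ?thesis using \<delta>_pos assms(1) p_ge
          by (intro representable_mult[of _ "2 ^ (p - 1)" "Suc e"]) (auto simp: abs_mult power_strict_increasing)
      qed
      have "a + ?u = real (Suc i) * ?u" using a True by (simp add: algebra_simps)
      then show ?thesis using rep fround_exact True by (intro exI[of _ "real (Suc i) * ?u"]) auto
    next
      case False
      then have "a + ?u = (2 ^ p + 1) * ?u" using a by (simp add: algebra_simps)
      then show ?thesis using fround_tie[OF assms(1), of z] False
        by (intro exI[of _ "2 ^ p * ?u"]) (simp add: min_absorb2)
    qed
  qed
  then show ?thesis by auto
qed

text \<open>The value that softmax gives to each of \<open>c\<close> vertices with score 0 when all
  other scores are minus infinity; the minimum is the saturated denominator.\<close>

definition weight :: "nat \<Rightarrow> real" where
  "weight c = rval F (fround F False (1 / real (min c (2 ^ p))))"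

lemma weight_arg:
  assumes "1 \<le> c"
  shows "1 / 2 ^ p \<le> 1 / real (min c (2 ^ p))" "1 / real (min c (2 ^ p)) \<le> 1"
    "\<bar>1 / real (min c (2 ^ p))\<bar> < overflow_bound F"
proof -
  have "real (min c (2 ^ p)) \<le> real (2 ^ p)" by (simp only: of_nat_le_iff min.cobounded2)
  moreover have "1 \<le> real (min c (2 ^ p))" using assms by auto
  ultimately show 1: "1 / 2 ^ p \<le> 1 / real (min c (2 ^ p))" "1 / real (min c (2 ^ p)) \<le> 1"
    by (auto simp: divide_simps)
  obtain f where f: "val F f 1" using representable_two_power[of 0] by auto
  show "\<bar>1 / real (min c (2 ^ p))\<bar> < overflow_bound F"
    using less_overflow_bound[OF val_fin[OF f], of "1 / real (min c (2 ^ p))"] 1 by (simp add: val_rval[OF f])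
qed

lemma fround_weight:
  assumes "1 \<le> c"
  shows "val F (fround F z (1 / real (min c (2 ^ p)))) (weight c)"
proof -
  have "1 / real (min c (2 ^ p)) \<noteq> 0" using assms by simp
  from fround_nonzero[OF this, of z] show ?thesis
    using fround_fin[OF weight_arg(3)[OF assms], of False] by (simp add: val_def weight_def)
qed

lemma weight_ge:
  assumes "1 \<le> c" shows "1 / 2 ^ p \<le> weight c"
proof -
  obtain f where "val F f (1 / 2 ^ p)" using representable_inverse_power[of p] four_p_le_B p_ge by fastforce
  then show ?thesis unfolding weight_def using weight_arg[OF assms] by (intro fround_ge) auto
qed

lemma weight_le:
  assumes "1 \<le> c" "val F f y" "1 / real (min c (2 ^ p)) \<le> y"
  shows "weight c \<le> y"
  unfolding weight_def using assms weight_arg[OF assms(1)] by (intro fround_le) auto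

lemma weight_le_1: "1 \<le> c \<Longrightarrow> weight c \<le> 1"
  using weight_le weight_arg(2) representable_two_power[of 0] by auto

text \<open>Truncating \<open>1 / min c (2 ^ p)\<close> to \<open>p - 1\<close> binary places gives
  a representable number with this error, and rounding to nearest does no worse.\<close>

lemma weight_error:
  assumes "1 \<le> c"
  shows "\<bar>weight c - 1 / real (min c (2 ^ p))\<bar> \<le> 1 / 2 ^ (p - 1)"
proof -
  define x where "x = 1 / real (min c (2 ^ p))"
  have x: "0 \<le> x" "x \<le> 1" "\<bar>x\<bar> < overflow_bound F"
    using weight_arg[OF assms] by (auto simp: x_def)
  define k where "k = \<lfloor>x * 2 ^ (p - 1)\<rfloor>"
  have k: "of_int k \<le> x * 2 ^ (p - 1)" "x * 2 ^ (p - 1) < of_int k + 1" "0 \<le> k"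
    using x by (auto simp: k_def)
  define y where "y = of_int k / (2::real) ^ (p - 1)"
  have y: "y \<le> x" "x - y \<le> 1 / 2 ^ (p - 1)" "0 \<le> y"
  proof -
    show "y \<le> x" "0 \<le> y" using k by (auto simp: y_def field_simps)
    have "x - y = (x * 2 ^ (p - 1) - of_int k) / 2 ^ (p - 1)" by (simp add: y_def field_simps)
    also have "\<dots> \<le> 1 / 2 ^ (p - 1)" using k by (intro divide_right_mono) auto
    finally show "x - y \<le> 1 / 2 ^ (p - 1)" .
  qed
  have eq: "y = of_int k * (2 ^ B * \<delta>)"
  proof -
    have "1 / 2 ^ (p - 1) = 2 ^ (B + p - 1 - (p - 1)) * \<delta>" using p_ge by (intro inverse_power_unit) simp
    also have "B + p - 1 - (p - 1) = B" using p_ge by simp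
    finally show ?thesis by (simp add: y_def divide_inverse)
  qed
  have "\<exists>f. val F f y"
  proof (rule representable_mult[OF eq])
    have "y < 2" using y x by simp
    also have "\<dots> = 2 ^ p * (2 ^ B * \<delta>)"
      using one_unit p_ge by (cases p) (auto simp: power_add mult_ac)
    finally show "\<bar>y\<bar> < 2 ^ p * (2 ^ B * \<delta>)" using y by simp
  qed simp
  then obtain f where "val F f y" ..
  from fround_dist[OF x(3) this, of False] x y show ?thesis by (simp add: weight_def flip: x_def)
qed

lemma weight_saturated: "2 ^ p \<le> c \<Longrightarrow> weight c = 1 / 2 ^ p"
proof -
  assume c: "2 ^ p \<le> c"
  have c1: "1 \<le> c" using c one_le_power[of "2::nat" p] by linarith
  obtain f where f: "val F f (1 / 2 ^ p)" using representable_inverse_power[of p] four_p_le_B p_ge by fastforce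
  have "weight c \<le> 1 / 2 ^ p" using weight_le[OF c1 f] c by (simp add: min_absorb2)
  with weight_ge[OF c1] show ?thesis by simp
qed

lemma filter_map_card:
  "length (filter P (map f [0..<n])) = card {i. i < n \<and> P (f i)}"
  by (simp add: length_filter_conv_card cong: conj_cong)

lemma weight_pos: "1 \<le> c \<Longrightarrow> 0 < weight c"
  using weight_ge[of c] by (simp add: less_le_trans[of 0 "1 / 2 ^ p"])

text \<open>There are two regimes. If \<open>2 ^ p \<le> n\<close>, the weights are exactly
  \<open>1 / 2 ^ p\<close> and the sum saturates. Otherwise the sum may be inexact, but monotone
  rounding keeps nonempty partial sums between one weight and the number of summands.\<close>

lemma exists_sum:
  assumes n: "1 \<le> n" and xs: "\<forall>y\<in>set xs. val F y 0 \<or> val F y (weight n)"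
    and c: "c = length (filter (\<lambda>y. val F y (weight n)) xs)" "c \<le> n"
  shows "\<exists>y. val F (fsum F xs) y \<and> (c = 0 \<longrightarrow> y = 0) \<and> (c \<noteq> 0 \<longrightarrow> 1 / 2 ^ p \<le> y) \<and> y \<le> 2 ^ p"
proof (cases "2 ^ p \<le> n")
  case True
  \<comment> \<open>The exponent for which \<open>2 ^ ?e * \<delta>\<close> is
    \<open>1 / 2 ^ p\<close>.\<close>
  let ?e = "B - 1"
  have u: "weight n = 2 ^ ?e * \<delta>"
    using weight_saturated[OF True] inverse_power_unit[of p] four_p_le_B p_ge by simp
  have e: "?e \<le> 2 * B" by simp
  from fsum_saturates[OF e, of xs] xs
  have v: "val F (fsum F xs) (real (min c (2 ^ p)) * weight n)"
    unfolding u by (simp add: c(1) u)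
  have m: "real (min c (2 ^ p)) \<le> real (2 ^ p)" by (simp only: of_nat_le_iff min.cobounded2)
  have "real (min c (2 ^ p)) * (1 / 2 ^ p) \<le> 2 ^ p * 1"
    using m by (intro mult_mono) auto
  moreover have "1 * (1 / 2 ^ p) \<le> real (min c (2 ^ p)) * (1 / 2 ^ p)" if "c \<noteq> 0"
    using that by (intro mult_right_mono) auto
  ultimately show ?thesis using v
    by (intro exI[of _ "real (min c (2 ^ p)) * weight n"]) (auto simp: weight_saturated[OF True])
next
  case False
  let ?P = "\<lambda>i a. (i = 0 \<longrightarrow> a = 0) \<and> (i \<noteq> 0 \<longrightarrow> weight n \<le> a) \<and> a \<le> real i"
  have "\<exists>a. val F (fsum F xs) a \<and> ?P c a"
    unfolding c(1)
  proof (rule fsum_invariant[OF _ xs])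
    show "weight n \<noteq> 0" using weight_pos[OF n] by simp
    show "?P 0 0" by simp
    fix i acc a z
    assume i: "i < length (filter (\<lambda>y. val F y (weight n)) xs)" and P: "?P i a"
    have a: "0 \<le> a" using P weight_pos[OF n] by (cases "i = 0") auto
    have "Suc i < 2 ^ p" using i c False by linarith
    then obtain f where f: "val F f (real (Suc i))" using representable_nat by blast
    have le: "a + weight n \<le> real (Suc i)" using P weight_le_1[OF n] by simp
    have o: "\<bar>a + weight n\<bar> < overflow_bound F"
      using val_less_overflow[OF f] le a weight_pos[OF n] by simp
    have "val F (fround F False (1 / real (min n (2 ^ p)))) (weight n)" using fround_weight[OF n] .
    then have "weight n \<le> rval F (fround F z (a + weight n))"
      using a weight_pos[OF n] by (intro fround_ge[OF o]) auto
    moreover have "rval F (fround F z (a + weight n)) \<le> real (Suc i)"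
      using a weight_pos[OF n] le by (intro fround_le[OF o f]) auto
    ultimately show "\<exists>a'. val F (fround F z (a + weight n)) a' \<and> ?P (Suc i) a'"
      using valI[OF fround_fin[OF o, of z]] by blast
  qed
  then obtain a where a: "val F (fsum F xs) a" "?P c a" by blast
  have "real c \<le> real (2 ^ p)" using c(2) False by (simp only: of_nat_le_iff not_le)
  then have "real c \<le> 2 ^ p" by simp
  then have "a \<le> 2 ^ p" using a(2) by linarith
  then show ?thesis using a weight_ge[OF n] by (intro exI[of _ a] conjI impI) linarith+
qed

section \<open>Divisibility from underflow\<close>

lemma rval_multiple:
  assumes "x \<in> fin_floats F" "0 \<le> rval F x" shows "\<exists>r::nat. rval F x = real r * \<delta>"
proof -
  obtain b e s where f: "x = Fin b e s" using assms(1) by (rule fin_floats_cases)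
  have "rval F x = \<bar>rval F x\<bar>" using assms by simp
  also have "\<dots> = real (s * 2 ^ e) * \<delta>" by (simp add: f abs_rval_Fin)
  finally show ?thesis ..
qed

lemma two_p: "(2::nat) ^ p = 256 * (2 ^ l * 2 ^ l)"
proof -
  have "p = l + l + 8" by (simp add: p_def)
  then show ?thesis by (simp only: power_add) simp
qed

text \<open>In the subnormal range the products \<open>w \<sqdot> m\<delta>\<close> with \<open>w \<approx> 1/c\<close> are rounded to the multiple
  \<open>r\<delta>\<close> of \<open>\<delta>\<close> nearest to \<open>(m/c)\<delta>\<close>. The \<open>c\<close> copies add up to \<open>cr\<delta>\<close> exactly, and this is
  \<open>m\<delta>\<close> only if \<open>c\<close> divides \<open>m\<close>.\<close>

lemma rounded_share:
  assumes c: "1 \<le> c" and m: "1 \<le> m" "m \<le> 2 ^ l"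
  shows "\<exists>r::nat. (\<forall>z. val F (fround F z (weight c * (real m * \<delta>))) (real r * \<delta>)) \<and>
    c * r \<le> 4 * (2 ^ l * 2 ^ l) \<and> (c * r = m \<longleftrightarrow> c dvd m)"
proof -
  define X where "X = weight c * (real m * \<delta>)"
  have X: "0 < X" "X \<le> real m * \<delta>"
    using weight_pos[OF c] weight_le_1[OF c] m \<delta>_pos by (auto simp: X_def)
  have ml: "(2::nat) ^ l \<le> 2 ^ l * 2 ^ l" by simp
  have "real m \<le> real (2 ^ l)" using m(2) by (simp only: of_nat_le_iff)
  then have mR: "real m \<le> 2 ^ l" by simp
  have "\<exists>f. val F f (real k * \<delta>)" if "k \<le> m" for k
  proof -
    have "k < 2 ^ p" using that m ml two_p by linarith
    then have "\<bar>int k\<bar> < 2 ^ p" by (simp add: nat_less_iff)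
    then show ?thesis using representable[of "int k" 0] by simp
  qed
  note rep = this
  obtain f where f: "val F f (real m * \<delta>)" using rep by blast
  have o: "\<bar>X\<bar> < overflow_bound F"
    using val_less_overflow[OF f] X by simp
  have "0 \<le> rval F (fround F False X)" using fround_ge[OF o val_zero] X by simp
  from rval_multiple[OF fround_fin[OF o] this] obtain r :: nat
    where r: "rval F (fround F False X) = real r * \<delta>" by blast
  have v: "val F (fround F z X) (real r * \<delta>)" for z
    using fround_nonzero[of X z] X r fround_fin[OF o] by (simp add: val_def)
  \<comment> \<open>Measured in units of \<delta>, this is rounding to the nearest integer, with
    every \<open>k \<le> m\<close> as a competitor.\<close>
  have dist: "\<bar>real r - X / \<delta>\<bar> \<le> \<bar>real k - X / \<delta>\<bar>" if "k \<le> m" for k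
  proof -
    obtain g where "val F g (real k * \<delta>)" using rep[OF \<open>k \<le> m\<close>] by blast
    from fround_dist[OF o this, of False] X \<delta>_pos
    have "\<bar>real r * \<delta> - X\<bar> \<le> \<bar>real k * \<delta> - X\<bar>" by (simp add: r)
    then have "\<bar>(real r - X / \<delta>) * \<delta>\<bar> \<le> \<bar>(real k - X / \<delta>) * \<delta>\<bar>" using \<delta>_pos by (simp add: algebra_simps)
    then show ?thesis using \<delta>_pos by (simp add: abs_mult)
  qed
  have Xd: "X / \<delta> = weight c * real m" using \<delta>_pos by (simp add: X_def)
  show ?thesis
  \<comment> \<open>A large count pushes the share down to at most a quarter of \<delta>, so it
    rounds to 0, and \<open>c > m\<close> excludes divisibility. A small count is below
    \<open>2 ^ p\<close>, so its weight is not distorted by saturation.\<close>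
  proof (cases "4 * 2 ^ l \<le> c")
    case True
    have "l + 2 \<le> B + p - 1" using p_def by simp
    then obtain g where g: "val F g (1 / 2 ^ (l + 2))" using representable_inverse_power by blast
    have "4 * 2 ^ l \<le> min c (2 ^ p)" using True two_p ml by simp
    then have "real (4 * 2 ^ l) \<le> real (min c (2 ^ p))" by (simp only: of_nat_le_iff)
    then have "1 / real (min c (2 ^ p)) \<le> 1 / real (4 * 2 ^ l)" by (intro divide_left_mono) (use c in auto)
    then have "weight c \<le> 1 / 2 ^ (l + 2)" using weight_le[OF c g] by (simp add: mult.commute)
    moreover have "real m \<le> 2 ^ l" by (rule mR)
    ultimately have "weight c * real m \<le> 1 / 2 ^ (l + 2) * 2 ^ l"
      using weight_pos[OF c] by (intro mult_mono) auto
    then have "weight c * real m \<le> 1 / 4" by simp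
    then have "real r < 1" using dist[of 0] by (simp add: Xd)
    then have "r = 0" by simp
    moreover have "\<not> c dvd m"
    proof
      assume "c dvd m"
      then have "c \<le> m" using m by (intro dvd_imp_le) auto
      moreover have "(0::nat) < 2 ^ l" by simp
      ultimately show False using True m by linarith
    qed
    ultimately show ?thesis using v m by (intro exI[of _ 0]) (simp add: X_def)
  next
    case False
    then have "c \<le> 2 ^ p" using two_p ml by linarith
    then have cm: "min c (2 ^ p) = c" by simp
    have "real r * \<delta> \<le> real m * \<delta>" using fround_le[OF o f, of False] X by (simp add: r)
    then have rm: "r \<le> m" using \<delta>_pos by simp
    have "c * r \<le> (4 * 2 ^ l) * 2 ^ l" using False rm m(2) by (intro mult_mono) auto
    \<comment> \<open>The ideal share is the integer \<open>k\<close>. The weight error times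
      \<open>m\<close> is below 1/2, and \<open>r\<close> is at least as near to the product as
      \<open>k\<close>, so the integers \<open>r\<close> and \<open>k\<close> differ by less than
      1.\<close>
    moreover have "c * r = m" if cd: "c dvd m"
    proof -
      obtain k where k: "m = c * k" using cd by blast
      have "k \<le> m" using k c by simp
      have "weight c * real m - real k = (weight c - 1 / real c) * real m"
        using c by (simp add: k algebra_simps)
      also have "\<bar>\<dots>\<bar> \<le> 1 / 2 ^ (p - 1) * 2 ^ l"
      proof -
        have "real m \<le> 2 ^ l" by (rule mR)
        then show ?thesis using weight_error[OF c] unfolding abs_mult cm by (intro mult_mono) auto
      qed
      also have "\<dots> < 1 / 2"
      proof -
        have "(2::real) * 2 ^ l = 2 ^ (l + 1)" by simp
        also have "\<dots> < 2 ^ (p - 1)" by (intro power_strict_increasing) (simp_all add: p_def)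
        finally show ?thesis by (simp add: field_simps)
      qed
      finally have "\<bar>real k - X / \<delta>\<bar> < 1 / 2" by (simp add: Xd abs_minus_commute)
      with dist[OF \<open>k \<le> m\<close>] have "\<bar>real r - real k\<bar> < 1" by linarith
      then have "r = k" by linarith
      then show ?thesis using k by simp
    qed
    moreover have "c dvd m" if "c * r = m" using that by auto
    ultimately show ?thesis using v by (intro exI[of _ r]) (auto simp: X_def)
  qed
qed

lemma divisor_sum:
  assumes A: "A \<subseteq> {..<n}" and m: "1 \<le> m" "m \<le> 2 ^ l"
    and w: "\<And>j. j < n \<Longrightarrow> val F (w j) (if j \<in> A then weight (card A) else 0)"
    and v: "\<And>j. j < n \<Longrightarrow> val F (v j) (if j \<in> A then real m * \<delta> else 0)"
  shows "\<exists>t::nat. val F (fsum F (map (\<lambda>j. fmul F (w j) (v j)) [0..<n])) (real t * \<delta>) \<and>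
    t \<le> 4 * (2 ^ l * 2 ^ l) \<and> (t = m \<longleftrightarrow> card A dvd m)"
proof -
  have fin: "finite A" using A finite_subset by blast
  have zero: "val F (fmul F (w j) (v j)) 0" if "j < n" "j \<notin> A" for j
    using fmul_zero_left[of "w j" "v j"] w[OF that(1)] v[OF that(1)] that(2) val_fin by auto
  show ?thesis
  proof (cases "A = {}")
    case True
    \<comment> \<open>Nothing is attended: the sum is 0, which is not \<open>m\<close>, and the
      count 0 does not divide \<open>m\<close> because \<open>1 \<le> m\<close>.\<close>
    then show ?thesis using fsum_map_zero[of n "\<lambda>j. fmul F (w j) (v j)"] zero m by (intro exI[of _ 0]) auto
  next
    case False
    then have "1 \<le> card A" using fin by (simp add: Suc_le_eq card_gt_0_iff)
    from rounded_share[OF this m] obtain r where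
      r: "\<And>z. val F (fround F z (weight (card A) * (real m * \<delta>))) (real r * \<delta>)"
        "card A * r \<le> 4 * (2 ^ l * 2 ^ l)" "card A * r = m \<longleftrightarrow> card A dvd m" by blast
    have share: "val F (fmul F (w j) (v j)) (real r * \<delta>)" if "j < n" "j \<in> A" for j
      using fmul_fround[of "w j" "weight (card A)" "v j" "real m * \<delta>"] w[OF that(1)] v[OF that(1)] that(2) r(1)
      by auto
    let ?a = "\<lambda>j. if j \<in> A then real r * \<delta> else 0"
    have sum: "(\<Sum>j<n. ?a j) = real (card A * r) * \<delta>"
    proof -
      have "(\<Sum>j<n. ?a j) = (\<Sum>j\<in>A. real r * \<delta>)" using A by (simp add: sum.If_cases Int_absorb1)
      then show ?thesis by simp
    qed
    have "val F (fsum F (map (\<lambda>j. fmul F (w j) (v j)) [0..<n])) (\<Sum>j<n. ?a j)"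
    proof (rule fsum_map_exact[of 0])
      show "val F (fmul F (w j) (v j)) (?a j)" if "j < n" for j using zero share that by simp
      show "\<exists>k::int. ?a j = of_int k * (2 ^ 0 * \<delta>)" for j
        by (intro exI[of _ "if j \<in> A then int r else 0"]) simp
      have "(\<Sum>j<n. \<bar>?a j\<bar>) = (\<Sum>j<n. ?a j)" using \<delta>_pos by (intro sum.cong) auto
      also have "\<dots> = real (card A * r) * \<delta>" by (rule sum)
      also have "\<dots> < real (2 ^ p) * \<delta>"
      proof -
        have "(0::nat) < 2 ^ l * 2 ^ l" by simp
        then have "card A * r < 2 ^ p" using r(2) two_p by linarith
        then show ?thesis using \<delta>_pos by (simp only: mult_less_cancel_right_pos of_nat_less_iff)
      qed
      finally show "(\<Sum>j<n. \<bar>?a j\<bar>) < 2 ^ p * (2 ^ 0 * \<delta>)" by simp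
    qed simp
    then show ?thesis using r(2,3) unfolding sum by blast
  qed
qed

section \<open>Softmax of scores 0 and minus infinity\<close>

lemma val_not_Inf: "\<not> val F (Inf b) r" by (auto simp: val_def fin_floats_def)
lemma val_not_NaN: "\<not> val F NaN r" by (auto simp: val_def fin_floats_def)

lemma val_unique: "val F x a \<Longrightarrow> val F x b \<longleftrightarrow> a = b" by (auto simp: val_def)

lemma foldl_fmax:
  assumes "\<forall>a\<in>set (a0 # xs). val F a 0 \<or> a = Inf True" "\<exists>a\<in>set (a0 # xs). val F a 0"
  shows "val F (foldl (fmax F) a0 xs) 0"
  using assms
proof (induction xs arbitrary: a0)
  case (Cons x xs)
  have *: "a \<noteq> NaN" if "val F a 0 \<or> a = Inf True" for a using that val_not_NaN by auto
  have "fmax F a0 x = (if val F a0 0 then a0 else x) \<or> \<not> val F a0 0 \<and> \<not> val F x 0 \<and> fmax F a0 x = a0"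
    using Cons.prems(1) *[of a0] *[of x] by (auto simp: fmax_def val_fval val_not_Inf)
  then show ?case using Cons.prems by (auto intro!: Cons.IH)
qed simp

text \<open>If some score is 0, the maximum is 0 and subtracting it changes no value. The
  exponentials are exactly 1 and 0, their sum is the saturated number of ones, and the quotient is
  \<open>weight\<close>. If no score is 0, the convention for rows of minus infinity gives
  zeros.\<close>

lemma softmax_zero_minf:
  assumes s: "\<And>j. j < n \<Longrightarrow> val F (s j) 0 \<or> s j = Inf True"
    and A: "A = {j. j < n \<and> val F (s j) 0}" and j: "j < n"
  shows "val F (softmax F (vec n s) $ j) (if j \<in> A then weight (card A) else 0)"
proof (cases "A = {}")
  case True
  then have "\<forall>a\<in>set (map s [0..<n]). a = Inf True" using s A by auto
  then show ?thesis using True j val_zero[of False] by (simp add: softmax_def)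
next
  case False
  have finA: "finite A" using A by simp
  then have c: "1 \<le> card A" using False by (simp add: Suc_le_eq card_gt_0_iff)
  define \<beta> where "\<beta> = foldl (fmax F) (hd (map s [0..<n])) (tl (map s [0..<n]))"
  define y where "y = (\<lambda>j. fexp F (fsub F (s j) \<beta>))"
  obtain i where i: "i < n" "val F (s i) 0" using False A by auto
  then have hd: "hd (map s [0..<n]) # tl (map s [0..<n]) = map s [0..<n]" by (intro list.collapse) auto
  have \<beta>: "val F \<beta> 0" unfolding \<beta>_def
    by (rule foldl_fmax; unfold hd) (use s i in auto)
  have y1: "val F (y j) 1" if "val F (s j) 0" for j
    using fadd_zero_left[OF that fneg_val[OF \<beta>]] by (simp add: y_def fsub_def exp_zero)
  have y0: "val F (y j) 0" if "s j = Inf True" for j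
  proof -
    have "fadd F (Inf True) (fneg \<beta>) = Inf True"
      using \<beta> by (cases \<beta>) (auto simp: val_not_Inf val_not_NaN)
    then show ?thesis using exp_minf that by (simp add: y_def fsub_def)
  qed
  have "\<not> (\<forall>a\<in>set (map s [0..<n]). a = Inf True)" using i val_not_Inf by force
  then have sm: "softmax F (vec n s) = map_vec (\<lambda>a. fdiv F a (fsum F (map y [0..<n]))) (vec n y)"
  proof -
    have "map_vec (\<lambda>a. fexp F (fsub F a \<beta>)) (vec n s) = vec n y" by (auto simp: y_def)
    then show ?thesis using \<open>\<not> (\<forall>a\<in>set (map s [0..<n]). a = Inf True)\<close>
      unfolding softmax_def Let_def list_of_vec_vec \<beta>_def[symmetric] by (simp only: if_False list_of_vec_vec)
  qed
  have ones: "{j. j < n \<and> val F (y j) 1} = A"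
  proof -
    have "val F (y j) 1 \<longleftrightarrow> val F (s j) 0" if "j < n" for j
      using s[OF that]
    proof
      assume "s j = Inf True"
      then show ?thesis using val_unique[OF y0[of j], of 1] val_not_Inf by simp
    qed (simp add: y1)
    then show ?thesis unfolding A by blast
  qed
  have "val F (fsum F (map y [0..<n])) (real (min (card A) (2 ^ p)))"
  proof -
    have "\<forall>a\<in>set (map y [0..<n]). val F a 0 \<or> val F a 1" using s y0 y1 by auto blast
    moreover have "B + p - 1 \<le> 2 * B" using four_p_le_B by simp
    ultimately show ?thesis using fsum_saturates[of "B + p - 1" "map y [0..<n]"]
      unfolding one_unit filter_map_card ones by simp
  qed
  moreover have "real (min (card A) (2 ^ p)) \<noteq> 0" using c by auto
  ultimately have "\<exists>z. fdiv F (y j) (fsum F (map y [0..<n])) =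
     fround F z ((if j \<in> A then 1 else 0) / real (min (card A) (2 ^ p)))"
    by (intro fdiv_fround) (use y0 y1 s[OF j] j in \<open>auto simp: A\<close>)
  then show ?thesis using fround_weight[OF c] fround_exact[OF val_zero] j sm by auto
qed

end

section \<open>Attention heads and perceptrons\<close>

context float_format
begin

text \<open>Allows parameters to be written as real numbers; the choice is meaningful for
  representable \<open>r\<close> only, hence the premise of \<open>val_flt\<close>.\<close>

definition flt :: "real \<Rightarrow> fp" where
  "flt r = (SOME f. val F f r)"

lemma val_flt: "\<exists>f. val F f r \<Longrightarrow> val F (flt r) r"
  unfolding flt_def by (rule someI_ex)

lemma val_flt_int: "\<bar>k\<bar> < 2 ^ p \<Longrightarrow> val F (flt (of_int k)) (of_int k)"
  by (rule val_flt[OF representable_int])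

lemma val_flt_small: "val F (flt 0) 0" "val F (flt 1) 1" "val F (flt 2) 2" "val F (flt 4) 4"
  "val F (flt (-1)) (-1)" "val F (flt (-2)) (-2)"
proof -
  have "(2::int) ^ 8 \<le> 2 ^ p" using p_ge by (intro power_increasing) auto
  then have "4 < (2::int) ^ p" by simp
  then show "val F (flt 0) 0" "val F (flt 1) 1" "val F (flt 2) 2" "val F (flt 4) 4"
    "val F (flt (-1)) (-1)" "val F (flt (-2)) (-2)"
    using val_flt_int[of 0] val_flt_int[of 1] val_flt_int[of 2] val_flt_int[of 4] val_flt_int[of "-1"]
      val_flt_int[of "-2"] by simp_all
qed

definition dot :: "nat \<Rightarrow> (nat \<Rightarrow> fp) \<Rightarrow> (nat \<Rightarrow> real) \<Rightarrow> fp" where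
  "dot n x w = fsum F (map (\<lambda>i. fmul F (x i) (flt (w i))) [0..<n])"

lemma dot_zero:
  assumes "\<And>i. i < n \<Longrightarrow> x i \<in> fin_floats F" "\<And>i. i < n \<Longrightarrow> w i = 0"
  shows "val F (dot n x w) 0"
  unfolding dot_def using assms val_flt_small(1) by (intro fsum_map_zero fmul_zero_right) auto

lemma dot_single:
  assumes "\<And>i. i < n \<Longrightarrow> x i \<in> fin_floats F" "\<And>i. i < n \<Longrightarrow> i \<noteq> a \<Longrightarrow> w i = 0"
    "a < n" "val F (fmul F (x a) (flt (w a))) r"
  shows "val F (dot n x w) r"
  unfolding dot_def using assms val_flt_small(1)
  by (intro fsum_map_single[of a n "\<lambda>i. fmul F (x i) (flt (w i))"]) (auto intro: fmul_zero_right)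

text \<open>A single head with key and value dimension 1: \<open>q\<close>, \<open>k\<close>,
  \<open>v\<close> are the three weight columns and \<open>w\<close> is the row distributing the
  head's scalar result over the columns.\<close>

definition simple_mha ::
    "nat \<Rightarrow> (nat \<Rightarrow> real) \<Rightarrow> (nat \<Rightarrow> real) \<Rightarrow> (nat \<Rightarrow> real) \<Rightarrow> (nat \<Rightarrow> real) \<Rightarrow> mha" where
  "simple_mha d q k v w = \<lparr>heads = [\<lparr>W_Q = mat d 1 (\<lambda>(i, _). flt (q i)), W_K = mat d 1 (\<lambda>(i, _). flt (k i)),
     W_V = mat d 1 (\<lambda>(i, _). flt (v i))\<rparr>], W_O = mat 1 d (\<lambda>(_, j). flt (w j))\<rparr>"

definition score :: "nat \<Rightarrow> (nat \<Rightarrow> real) \<Rightarrow> (nat \<Rightarrow> real) \<Rightarrow> fp mat \<Rightarrow> fp mat \<Rightarrow> nat \<Rightarrow> nat \<Rightarrow> fp" where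
  "score d q k X Y i t = fdiv F (fmul F (dot d (\<lambda>l. Y $$ (i, l)) q) (dot d (\<lambda>l. X $$ (t, l)) k))
     (fsqrt F (fround F False 1))"

definition attend :: "nat \<Rightarrow> (nat \<Rightarrow> fp) \<Rightarrow> (nat \<Rightarrow> fp) \<Rightarrow> fp" where
  "attend n s v = fsum F (map (\<lambda>t. fmul F (softmax F (vec n s) $ t) (v t)) [0..<n])"

section \<open>Attention layers entry by entry\<close>

lemma mmul_index:
  "i < dim_row M \<Longrightarrow> j < dim_col N \<Longrightarrow>
   mmul F M N $$ (i, j) = fsum F (map (\<lambda>k. fmul F (M $$ (i, k)) (N $$ (k, j))) [0..<dim_col M])"
  and mmul_dims [simp]: "dim_row (mmul F M N) = dim_row M" "dim_col (mmul F M N) = dim_col N"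
  by (simp_all add: mmul_def)

lemma mmul_index_single:
  "i < dim_row M \<Longrightarrow> j < dim_col N \<Longrightarrow> dim_col M = 1 \<Longrightarrow>
   mmul F M N $$ (i, j) = fmul F (M $$ (i, 0)) (N $$ (0, j))"
  by (simp add: mmul_index fsum_single)

lemma map_upt_cong: "(\<And>i. i < n \<Longrightarrow> f i = g i) \<Longrightarrow> map f [0..<n] = map g [0..<n]"
  by simp

text \<open>With inner dimension 1, the products forming the scores and the output are single
  multiplications, so an entry is a scalar expression; the specific heads are evaluated through
  it.\<close>

lemma mha_eval_index:
  assumes X: "X \<in> carrier_mat nX d" and Y: "Y \<in> carrier_mat nY d" and i: "i < nY" and j: "j < d"
  shows "mha_eval F masked (simple_mha d q k v w) X Y $$ (i, j) =
    fmul F (attend nX (\<lambda>t. if masked \<and> i \<le> t then Inf True else score d q k X Y i t)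
      (\<lambda>t. dot d (\<lambda>l. X $$ (t, l)) v)) (flt (w j))"
proof -
  define H where "H = \<lparr>W_Q = mat d 1 (\<lambda>(i, _). flt (q i)), W_K = mat d 1 (\<lambda>(i, _). flt (k i)),
     W_V = mat d 1 (\<lambda>(i, _). flt (v i))\<rparr>"
  have dims: "dim_row X = nX" "dim_col X = d" "dim_row Y = nY" "dim_col Y = d" using X Y by auto
  have col: "mmul F Z (mat d 1 (\<lambda>(i, _). flt (u i))) $$ (t, 0) = dot d (\<lambda>l. Z $$ (t, l)) u"
    if "dim_col Z = d" "t < dim_row Z" for Z u t
    using that unfolding dot_def by (subst mmul_index) (auto intro!: arg_cong[where f="fsum F"])
  define S where "S = map_mat (\<lambda>a. fdiv F a (fsqrt F (fround F False (real (dim_col (W_K H))))))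
    (mmul F (mmul F Y (W_Q H)) (transpose_mat (mmul F X (W_K H))))"
  have Sdim: "dim_row S = nY" "dim_col S = nX" by (simp_all add: S_def H_def dims)
  have S: "S $$ (a, t) = score d q k X Y a t" if "a < nY" "t < nX" for a t
    using that by (simp add: S_def mmul_index_single dims H_def col score_def del: One_nat_def)
  let ?M = "if masked then causal_mask S else S"
  let ?s = "\<lambda>t. if masked \<and> i \<le> t then Inf True else score d q k X Y i t"
  have row: "row ?M i = vec nX ?s"
    using i by (auto simp: Sdim S causal_mask_def intro!: eq_vecI)
  have he: "head_eval F masked H X Y = mmul F (softmax_rows F ?M) (mmul F X (W_V H))"
    by (simp add: head_eval_def S_def Let_def)
  have Mdim: "dim_row ?M = nY" "dim_col ?M = nX" by (simp_all add: causal_mask_def Sdim)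
  have hdim: "dim_row (head_eval F masked H X Y) = nY" "dim_col (head_eval F masked H X Y) = 1"
    unfolding he mmul_dims by (simp_all add: softmax_rows_def Mdim H_def del: One_nat_def)
  have hi: "head_eval F masked H X Y $$ (i, 0) = attend nX ?s (\<lambda>t. dot d (\<lambda>l. X $$ (t, l)) v)"
  proof -
    have "head_eval F masked H X Y $$ (i, 0) = fsum F (map (\<lambda>t. fmul F (softmax_rows F ?M $$ (i, t))
        (mmul F X (W_V H) $$ (t, 0))) [0..<nX])"
      unfolding he using i by (subst mmul_index) (simp_all add: softmax_rows_def Mdim H_def)
    also have "\<dots> = attend nX ?s (\<lambda>t. dot d (\<lambda>l. X $$ (t, l)) v)"
      unfolding attend_def
    proof (rule arg_cong[where f="fsum F"], rule map_upt_cong)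
      fix t assume t: "t < nX"
      have "softmax_rows F ?M $$ (i, t) = softmax F (vec nX ?s) $ t"
        unfolding softmax_rows_def using i t by (simp add: Mdim row)
      moreover have "mmul F X (W_V H) $$ (t, 0) = dot d (\<lambda>l. X $$ (t, l)) v"
        using col[of X t v] t by (simp add: H_def dims)
      ultimately show "fmul F (softmax_rows F ?M $$ (i, t)) (mmul F X (W_V H) $$ (t, 0)) =
        fmul F (softmax F (vec nX ?s) $ t) (dot d (\<lambda>l. X $$ (t, l)) v)" by simp
    qed
    finally show ?thesis .
  qed
  have cc: "hconcat nY [head_eval F masked H X Y] $$ (i, 0) = head_eval F masked H X Y $$ (i, 0)"
    using i hdim by (simp add: hconcat_def)
  have cdim: "dim_row (hconcat nY [head_eval F masked H X Y]) = nY"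
    "dim_col (hconcat nY [head_eval F masked H X Y]) = 1"
    using hdim by (simp_all add: hconcat_def)
  have ev: "mha_eval F masked (simple_mha d q k v w) X Y =
    mmul F (hconcat nY [head_eval F masked H X Y]) (mat 1 d (\<lambda>(_, j). flt (w j)))"
    by (simp add: mha_eval_def simple_mha_def H_def dims)
  show "mha_eval F masked (simple_mha d q k v w) X Y $$ (i, j) =
    fmul F (attend nX ?s (\<lambda>t. dot d (\<lambda>l. X $$ (t, l)) v)) (flt (w j))"
    unfolding ev using i j cdim by (subst mmul_index) (simp_all add: fsum_single cc hi)
qed

lemma val_one_cases:
  assumes "val F x 1" obtains e s where "x = Fin False e s" "s \<noteq> 0"
proof -
  obtain b e s where x: "x = Fin b e s" using assms by (rule val_cases)
  have "0 \<le> real s * 2 ^ e * \<delta>" using \<delta>_pos by simp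
  then have "\<not> b" "s \<noteq> 0" using assms by (auto simp: val_def x rval_Fin split: if_splits intro: gr0I)
  then show ?thesis using that x by simp
qed

lemma fsqrt_one: "val F (fsqrt F (fround F False 1)) 1"
proof -
  have 1: "val F (fround F False 1) 1" using fround_exact val_flt_small(2) by blast
  then obtain e s where x: "fround F False 1 = Fin False e s" "s \<noteq> 0" by (rule val_one_cases)
  then have "rval F (Fin False e s) = 1" using 1 by (simp add: val_def)
  then have "fsqrt F (fround F False 1) = fround F False 1" using x by simp
  then show ?thesis using 1 by simp
qed

lemma fdiv_one: "val F x a \<Longrightarrow> val F y 1 \<Longrightarrow> val F (fdiv F x y) a"
  using fdiv_fround[of x a y 1] fround_exact[of x a] by auto

lemma fdiv_minf_one: "val F y 1 \<Longrightarrow> fdiv F (Inf True) y = Inf True"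
  by (auto elim!: val_one_cases)

text \<open>Attended vertices with \<open>Q\<close> contribute one \<open>weight\<close> each, all
  others 0, so \<open>exists_sum\<close> applies. Rounding may blur the average, but not the gap
  between 0 and \<open>1 / 2 ^ p\<close>.\<close>

lemma attend_exists:
  assumes s: "\<And>t. t < n \<Longrightarrow> val F (s t) 0 \<or> s t = Inf True"
    and v: "\<And>t. t < n \<Longrightarrow> val F (v t) (if Q t then 1 else 0)"
  shows "\<exists>y. val F (attend n s v) y \<and> y \<le> 2 ^ p \<and>
    (if \<exists>t<n. val F (s t) 0 \<and> Q t then 1 / 2 ^ p \<le> y else y = 0)"
proof -
  define A where "A = {t. t < n \<and> val F (s t) 0}"
  let ?f = "\<lambda>t. fmul F (softmax F (vec n s) $ t) (v t)"
  have w: "val F (softmax F (vec n s) $ t) (if t \<in> A then weight (card A) else 0)" if "t < n" for t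
    using softmax_zero_minf[OF s A_def that] .
  have f: "val F (?f t) (if t \<in> A \<and> Q t then weight (card A) else 0)" if "t < n" for t
    using fmul_one_right[OF w[OF that], of "v t"] fmul_zero_right[OF val_fin[OF w[OF that]], of "v t"] v[OF that]
    by (cases "Q t") auto
  show ?thesis
  proof (cases "A = {}")
    case True
    have "val F (attend n s v) 0" unfolding attend_def
      using f True by (intro fsum_map_zero) auto
    then show ?thesis using True A_def by auto
  next
    case False
    have fin: "finite A" by (simp add: A_def)
    then have c: "1 \<le> card A" using False by (simp add: Suc_le_eq card_gt_0_iff)
    have set: "{t. t < n \<and> val F (?f t) (weight (card A))} = {t \<in> A. Q t}"
    proof -
      have "val F (?f t) (weight (card A)) \<longleftrightarrow> t \<in> A \<and> Q t" if "t < n" for t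
        using val_unique[OF f[OF that], of "weight (card A)"] weight_pos[OF c] by auto
      then show ?thesis by (auto simp: A_def)
    qed
    define k where "k = length (filter (\<lambda>y. val F y (weight (card A))) (map ?f [0..<n]))"
    have k: "k = card {t \<in> A. Q t}" unfolding k_def filter_map_card set ..
    have le: "k \<le> card A" unfolding k using fin by (intro card_mono) auto
    have el: "\<forall>y\<in>set (map ?f [0..<n]). val F y 0 \<or> val F y (weight (card A))"
      using f by (auto split: if_splits) metis+
    have k0: "k = 0 \<longleftrightarrow> \<not> (\<exists>t<n. val F (s t) 0 \<and> Q t)"
      using fin unfolding k by (auto simp: A_def)
    from exists_sum[OF c el k_def le] show ?thesis
      unfolding attend_def using k0 by auto
  qed
qed

definition fin_mat :: "nat \<Rightarrow> nat \<Rightarrow> fp mat \<Rightarrow> bool" where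
  "fin_mat n d X \<longleftrightarrow> X \<in> carrier_mat n d \<and> (\<forall>i<n. \<forall>j<d. X $$ (i, j) \<in> fin_floats F)"

text \<open>Zero queries and keys make all scores 0, hence uniform attention over the visible
  vertices. The output factor \<open>2 ^ p\<close> lifts a nonzero average from at least
  \<open>1 / 2 ^ p\<close> to at least 1.\<close>

definition exists_mha :: "nat \<Rightarrow> nat \<Rightarrow> nat \<Rightarrow> mha" where
  "exists_mha d a s = simple_mha d (\<lambda>_. 0) (\<lambda>_. 0) (\<lambda>l. if l = a then 1 else 0)
     (\<lambda>l. if l = s then 2 ^ p else 0)"

lemma simple_mha_carrier: "Y \<in> carrier_mat n d \<Longrightarrow> mha_eval F masked (simple_mha d q k v w) X Y \<in> carrier_mat n d"
  by (intro carrier_matI) (auto simp: mha_eval_def simple_mha_def hconcat_def)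

lemma val_flt_two_p: "val F (flt (2 ^ p)) (2 ^ p)"
  by (intro val_flt representable_two_power) simp

text \<open>The two-case premise on \<open>Q\<close> admits indices \<open>a \<ge> d\<close>, for
  which no column is read and \<open>Q\<close> has to be false; this covers the idle head.\<close>

lemma exists_mha:
  assumes X: "fin_mat nX d X" and Y: "fin_mat nY d Y" and i: "i < nY" and j: "j < d"
    and Q: "\<And>t. t < nX \<Longrightarrow> if a < d then val F (X $$ (t, a)) (if Q t then 1 else 0) else \<not> Q t"
  shows "\<exists>y. val F (mha_eval F masked (exists_mha d a s) X Y $$ (i, j)) y \<and>
    (if j = s \<and> (\<exists>t<nX. (masked \<longrightarrow> t < i) \<and> Q t) then 1 \<le> y else y = 0)"
proof -
  have fX: "X $$ (t, l) \<in> fin_floats F" if "t < nX" "l < d" for t l using X that by (simp add: fin_mat_def)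
  have fY: "Y $$ (i, l) \<in> fin_floats F" if "l < d" for l using Y i that by (simp add: fin_mat_def)
  let ?s = "\<lambda>t. if masked \<and> i \<le> t then Inf True else score d (\<lambda>_. 0) (\<lambda>_. 0) X Y i t"
  let ?v = "\<lambda>t. dot d (\<lambda>l. X $$ (t, l)) (\<lambda>l. if l = a then 1 else 0)"
  have sc: "val F (score d (\<lambda>_. 0) (\<lambda>_. 0) X Y i t) 0" if "t < nX" for t
    unfolding score_def using fX fY that fsqrt_one
    by (intro fdiv_one fmul_zero_left dot_zero val_fin[OF dot_zero]) auto
  have s: "val F (?s t) 0 \<or> ?s t = Inf True" if "t < nX" for t using sc that by simp
  have s': "val F (?s t) 0 \<longleftrightarrow> (masked \<longrightarrow> t < i)" if "t < nX" for t
    using sc[OF that] val_not_Inf by auto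
  have v: "val F (?v t) (if Q t then 1 else 0)" if "t < nX" for t
  proof (cases "a < d")
    case True
    then have "val F (X $$ (t, a)) (if Q t then 1 else 0)" using Q[OF that] by simp
    then show ?thesis using True fX that fmul_one_right val_flt_small(2)
      by (intro dot_single[where a=a]) auto
  next
    case False
    then have "val F (?v t) 0" using fX that by (intro dot_zero) auto
    then show ?thesis using Q[OF that] False by simp
  qed
  obtain y where y: "val F (attend nX ?s ?v) y" "y \<le> 2 ^ p"
    "if \<exists>t<nX. val F (?s t) 0 \<and> Q t then 1 / 2 ^ p \<le> y else y = 0"
    using attend_exists[of nX ?s ?v Q, OF s v] by blast
  have ex: "(\<exists>t<nX. val F (?s t) 0 \<and> Q t) \<longleftrightarrow> (\<exists>t<nX. (masked \<longrightarrow> t < i) \<and> Q t)"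
    using s' by blast
  have ix: "mha_eval F masked (exists_mha d a s) X Y $$ (i, j) =
      fmul F (attend nX ?s ?v) (flt (if j = s then 2 ^ p else 0))"
    unfolding exists_mha_def
    by (rule mha_eval_index[OF _ _ i j]) (use X Y in \<open>auto simp: fin_mat_def\<close>)
  show ?thesis
  proof (cases "j = s \<and> y \<noteq> 0")
    case True
    then have yy: "1 / 2 ^ p \<le> y" using y(3) by (simp split: if_splits)
    then have lo: "1 \<le> y * 2 ^ p" by (simp add: field_simps)
    \<comment> \<open>The exact average is unknown, but it is at most \<open>2 ^ p\<close>, so
      scaling it cannot overflow.\<close>
    have hi: "y * 2 ^ p \<le> 2 ^ (p + p)" using y(2) by (simp add: power_add)
    obtain g where g: "val F g (2 ^ (p + p))" using representable_two_power[of "p + p"] by auto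
    have o: "\<bar>y * 2 ^ p\<bar> < overflow_bound F" using val_less_overflow[OF g _ hi] lo by simp
    obtain z where z: "fmul F (attend nX ?s ?v) (flt (2 ^ p)) = fround F z (y * 2 ^ p)"
      using fmul_fround[OF y(1) val_flt_two_p] by blast
    have "1 \<le> rval F (fround F z (y * 2 ^ p))" using fround_ge[OF o val_flt_small(2)] lo by simp
    moreover have "\<exists>t<nX. (masked \<longrightarrow> t < i) \<and> Q t" using y(3) True unfolding ex by (auto split: if_splits)
    ultimately show ?thesis using valI[OF fround_fin[OF o]] True unfolding ix by (auto simp: z)
  next
    case False
    have "val F (fmul F (attend nX ?s ?v) (flt (if j = s then 2 ^ p else 0))) 0"
    proof (cases "j = s")
      case True
      then show ?thesis using False y(1) fmul_zero_left val_fin[OF val_flt_two_p] by simp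
    next
      case False
      then show ?thesis using fmul_zero_right[OF val_fin[OF y(1)] val_flt_small(1)] by simp
    qed
    moreover have "\<not> (j = s \<and> (\<exists>t<nX. (masked \<longrightarrow> t < i) \<and> Q t))"
    proof
      assume *: "j = s \<and> (\<exists>t<nX. (masked \<longrightarrow> t < i) \<and> Q t)"
      then have "1 / 2 ^ p \<le> y" using y(3) unfolding ex by simp
      moreover have "y = 0" using False * by simp
      moreover have "(0::real) < 1 / 2 ^ p" by simp
      ultimately show False by linarith
    qed
    ultimately show ?thesis unfolding ix by auto
  qed
qed

text \<open>The smallest power of two whose fourfold overflows, while twice it is still finite:
  \<open>- big\<close> and \<open>big\<close> can be added inside a key without leaving the
  range.\<close>

definition big :: real where "big = 2 ^ (p - 2) * (2 ^ (2 * B + 1) * \<delta>)"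

lemma val_flt_big: "val F (flt big) big" "val F (flt (- big)) (- big)"
proof -
  have "(2::int) ^ (p - 2) < 2 ^ p" using p_ge by (intro power_strict_increasing) auto
  then show "val F (flt big) big" "val F (flt (- big)) (- big)"
    using representable[of "2 ^ (p - 2)" "2 * B + 1"] representable[of "- (2 ^ (p - 2))" "2 * B + 1"]
    by (intro val_flt; simp add: big_def mult_ac)+
qed

lemma big_overflow: "overflow_bound F \<le> 4 * big"
proof -
  have "(2::real) ^ p = 4 * 2 ^ (p - 2)" 
  proof -
    have "p = 2 + (p - 2)" using p_ge by simp
    then have "(2::real) ^ p = 2 ^ 2 * 2 ^ (p - 2)" by (metis power_add)
    then show ?thesis by simp
  qed
  then have "4 * big = 2 ^ p * 2 ^ (2 * B + 1) * \<delta>" by (simp add: big_def)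
  moreover have "(2 ^ p - 1 / 2) * 2 ^ (2 * B + 1) * \<delta> \<le> 2 ^ p * 2 ^ (2 * B + 1) * \<delta>"
    using \<delta>_pos by (intro mult_right_mono) auto
  ultimately show ?thesis by (simp only: overflow_bound_eq)
qed

text \<open>The score \<open>4 \<sqdot> (-big)\<close> of the vertices with feature 0 overflows to minus infinity, so they get weight 0. The
  factor \<open>2\<^sup>B\<close> only brings the tiny result back to a range in which the MLP can rescale it.\<close>

definition dvd_mha :: "nat \<Rightarrow> nat \<Rightarrow> nat \<Rightarrow> nat \<Rightarrow> mha" where
  "dvd_mha d m a s = simple_mha d (\<lambda>l. if l = 0 then 4 else 0)
     (\<lambda>l. if l = 0 then - big else if l = a then big else 0)
     (\<lambda>l. if l = a then real m * \<delta> else 0) (\<lambda>l. if l = s then 2 ^ B else 0)"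

text \<open>The full factor \<open>2 ^ (B + p - 1)\<close> from \<delta> to 1 exceeds the largest
  float, so the rescaling is split: \<open>2 ^ B\<close> here and \<open>2 ^ (p - 1)\<close> in the
  perceptron.\<close>

lemma val_flt_two_B: "val F (flt (2 ^ B)) (2 ^ B)"
proof (rule val_flt)
  have "B + p - 1 + B = (p - 1) + 2 * B" using p_ge by simp
  then have "(2::real) ^ B = of_int (2 ^ (p - 1)) * 2 ^ (2 * B) * \<delta>"
    by (subst power_unit) (simp add: power_add power_even_eq power2_eq_square)
  moreover have "\<bar>2 ^ (p - 1)\<bar> < (2::int) ^ p" using p_ge by (simp add: power_strict_increasing)
  ultimately show "\<exists>f. val F f (2 ^ B)" using representable[of "2 ^ (p - 1)" "2 * B"] by simp
qed

lemma val_flt_mdelta: "m \<le> 2 ^ l \<Longrightarrow> val F (flt (real m * \<delta>)) (real m * \<delta>)"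
proof -
  assume "m \<le> 2 ^ l"
  moreover have "(2::nat) ^ l < 2 ^ p" by (intro power_strict_increasing) (simp_all add: p_def)
  ultimately have "m < 2 ^ p" by (rule le_less_trans)
  then have "\<bar>int m\<bar> < 2 ^ p" by (simp add: nat_less_iff)
  from representable[OF this, of 0] show ?thesis by (intro val_flt) simp
qed

lemma dvd_mha:
  assumes X: "fin_mat n d X" and i: "i < n" and j: "j < d" and a: "0 < a" "a < d"
    and m: "1 \<le> m" "m \<le> 2 ^ l"
    and one: "\<And>t. t < n \<Longrightarrow> val F (X $$ (t, 0)) 1"
    and Q: "\<And>t. t < n \<Longrightarrow> val F (X $$ (t, a)) (if Q t then 1 else 0)"
  shows "\<exists>t::nat. val F (mha_eval F False (dvd_mha d m a s) X X $$ (i, j))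
      (if j = s then real t / 2 ^ (p - 1) else 0) \<and>
    t \<le> 4 * (2 ^ l * 2 ^ l) \<and> (t = m \<longleftrightarrow> card {t. t < n \<and> Q t} dvd m)"
proof -
  have fX: "X $$ (t, l) \<in> fin_floats F" if "t < n" "l < d" for t l using X that by (simp add: fin_mat_def)
  let ?q = "\<lambda>l. if l = 0 then 4 else 0"
  let ?k = "\<lambda>l. if l = 0 then - big else if l = a then big else 0"
  let ?s = "\<lambda>t. score d ?q ?k X X i t"
  let ?v = "\<lambda>t. dot d (\<lambda>l. X $$ (t, l)) (\<lambda>l. if l = a then real m * \<delta> else 0)"
  have q: "val F (dot d (\<lambda>l. X $$ (i, l)) ?q) 4"
    using fX[OF i] fmul_exact[OF one[OF i] val_flt_small(4)] val_flt_small(4) j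
    by (intro dot_single[where a=0]) auto
  \<comment> \<open>The constant column contributes \<open>- big\<close>, and feature
    \<open>a\<close> cancels it where \<open>Q\<close> holds; both are multiples of the top unit, so
    the cancellation is exact.\<close>
  have k: "val F (dot d (\<lambda>l. X $$ (t, l)) ?k) (if Q t then 0 else - big)" if t: "t < n" for t
  proof -
    let ?a = "\<lambda>l. if l = 0 then - big else if l = a then (if Q t then big else 0) else 0"
    have e: "val F (fmul F (X $$ (t, l)) (flt (?k l))) (?a l)" if l: "l < d" for l
    proof -
      have "val F (fmul F (X $$ (t, 0)) (flt (- big))) (- big)"
        using fmul_exact[OF one[OF t] val_flt_big(2)] val_flt_big(2) by simp
      moreover have "val F (fmul F (X $$ (t, a)) (flt big)) (if Q t then big else 0)"
        using fmul_exact[OF Q[OF t] val_flt_big(1)] val_flt_big(1) val_zero by (cases "Q t") auto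
      moreover have "val F (fmul F (X $$ (t, l)) (flt 0)) 0"
        using fmul_zero_right fX[OF t l] val_flt_small(1) by blast
      ultimately show ?thesis by auto
    qed
    have split: "(\<Sum>l<d. if l = 0 then x else if l = a then y else 0) = x + y" for x y :: real
    proof -
      have "(\<Sum>l<d. if l = 0 then x else if l = a then y else 0) =
        (\<Sum>l<d. (if l = 0 then x else 0) + (if l = a then y else 0))"
        using a by (intro sum.cong) auto
      then show ?thesis using a by (simp add: sum.distrib)
    qed
    have "val F (dot d (\<lambda>l. X $$ (t, l)) ?k) (\<Sum>l<d. ?a l)"
      unfolding dot_def
    proof (rule fsum_map_exact[of "2 * B + 1"])
      show "val F (fmul F (X $$ (t, l)) (flt (?k l))) (?a l)" if "l < d" for l using e that .
      show "\<exists>k::int. ?a l = of_int k * (2 ^ (2 * B + 1) * \<delta>)" for l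
        by (intro exI[of _ "if l = 0 then - (2 ^ (p - 2)) else if l = a \<and> Q t then 2 ^ (p - 2) else 0"])
          (simp add: big_def)
      have "(\<Sum>l<d. \<bar>?a l\<bar>) = (\<Sum>l<d. if l = 0 then \<bar>big\<bar> else if l = a then (if Q t then \<bar>big\<bar> else 0) else 0)"
        by (intro sum.cong) auto
      also have "\<dots> = \<bar>big\<bar> + (if Q t then \<bar>big\<bar> else 0)" by (rule split)
      also have "\<dots> \<le> 2 * big" using \<delta>_pos by (simp add: big_def)
      also have "\<dots> = 2 ^ (p - 1) * (2 ^ (2 * B + 1) * \<delta>)"
      proof -
        have "p - 1 = Suc (p - 2)" using p_ge by simp
        then show ?thesis by (simp add: big_def)
      qed
      also have "\<dots> < 2 ^ p * (2 ^ (2 * B + 1) * \<delta>)"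
        using \<delta>_pos p_ge by (intro mult_strict_right_mono power_strict_increasing) auto
      finally show "(\<Sum>l<d. \<bar>?a l\<bar>) < 2 ^ p * (2 ^ (2 * B + 1) * \<delta>)" .
    qed simp
    then show ?thesis unfolding split by (cases "Q t") auto
  qed
  have s1: "val F (?s t) 0" if "t < n" "Q t" for t
    unfolding score_def using fsqrt_one k[OF that(1)] that(2) val_fin[OF q]
    by (intro fdiv_one fmul_zero_right) auto
  have s0: "?s t = Inf True" if "t < n" "\<not> Q t" for t
  proof -
    have "val F (dot d (\<lambda>l. X $$ (t, l)) ?k) (- big)" using k[OF that(1)] that(2) by simp
    from fmul_fround[OF q this] obtain z where
      z: "fmul F (dot d (\<lambda>l. X $$ (i, l)) ?q) (dot d (\<lambda>l. X $$ (t, l)) ?k) = fround F z (4 * - big)" by blast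
    have "0 < big" using \<delta>_pos by (simp add: big_def)
    then have "fround F z (4 * - big) = Inf True" using big_overflow by (simp add: fround_def)
    then show ?thesis unfolding score_def z using fdiv_minf_one[OF fsqrt_one] by simp
  qed
  define A where "A = {t. t < n \<and> Q t}"
  have A: "A = {t. t < n \<and> val F (?s t) 0}" using s1 s0 val_not_Inf unfolding A_def by fastforce
  have w: "val F (softmax F (vec n ?s) $ t) (if t \<in> A then weight (card A) else 0)" if "t < n" for t
    using s0 s1 that by (intro softmax_zero_minf[OF _ A]) blast+
  have v: "val F (?v t) (if t \<in> A then real m * \<delta> else 0)" if t: "t < n" for t
  proof -
    have "val F (fmul F (X $$ (t, a)) (flt (real m * \<delta>))) (if Q t then real m * \<delta> else 0)"
      using fmul_exact[OF Q[OF t] val_flt_mdelta[OF m(2)]] val_flt_mdelta[OF m(2)] val_zero by (cases "Q t") auto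
    then have "val F (?v t) (if Q t then real m * \<delta> else 0)"
      using fX[OF t] a by (intro dot_single[where a=a]) auto
    then show ?thesis using t by (simp add: A_def)
  qed
  have "A \<subseteq> {..<n}" by (auto simp: A_def)
  from divisor_sum[OF this m w v] obtain t where t: "val F (attend n ?s ?v) (real t * \<delta>)"
    "t \<le> 4 * (2 ^ l * 2 ^ l)" "t = m \<longleftrightarrow> card A dvd m" unfolding attend_def by blast
  have ix: "mha_eval F False (dvd_mha d m a s) X X $$ (i, j) =
      fmul F (attend n ?s ?v) (flt (if j = s then 2 ^ B else 0))"
    unfolding dvd_mha_def
    using mha_eval_index[of X n d X n i j False ?q ?k _ "\<lambda>l. if l = s then 2 ^ B else 0"] X i j
    by (simp only: fin_mat_def simp_thms if_False)
  have "val F (fmul F (attend n ?s ?v) (flt (if j = s then 2 ^ B else 0)))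
    (if j = s then real t / 2 ^ (p - 1) else 0)"
  proof (cases "j = s")
    case True
    have eq: "real t * \<delta> * 2 ^ B = real t / 2 ^ (p - 1)"
    proof -
      have "B + p - 1 = B + (p - 1)" using p_ge by simp
      then show ?thesis by (simp add: \<delta>_def power_add)
    qed
    have "(0::nat) < 2 ^ l * 2 ^ l" by simp
    then have "t < 2 ^ p" using t(2) two_p by linarith
    then have "\<bar>int t\<bar> < 2 ^ p" by (simp add: nat_less_iff)
    from representable[OF this, of B] have "\<exists>f. val F f (real t * \<delta> * 2 ^ B)" by (simp add: mult_ac)
    then show ?thesis using fmul_exact[OF t(1) val_flt_two_B] True by (auto simp: eq)
  next
    case False
    then show ?thesis using fmul_zero_right[OF val_fin[OF t(1)] val_flt_small(1)] by simp
  qed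
  then show ?thesis using t(2,3) unfolding ix A_def by blast
qed

text \<open>Three hidden units are what \<open>equal_mlp\<close> needs; the other perceptrons use
  only the first. Just column \<open>s\<close> is written, so \<open>s = d\<close> writes
  nothing.\<close>

definition simple_mlp ::
    "nat \<Rightarrow> nat \<Rightarrow> (nat \<Rightarrow> nat \<Rightarrow> real) \<Rightarrow> (nat \<Rightarrow> real) \<Rightarrow> (nat \<Rightarrow> real) \<Rightarrow> real \<Rightarrow> mlp" where
  "simple_mlp d s w1 b1 w2 b2 = \<lparr>W_1 = mat d 3 (\<lambda>(i, t). flt (w1 i t)), b_1 = vec 3 (\<lambda>t. flt (b1 t)),
     W_2 = mat 3 d (\<lambda>(t, j). flt (if j = s then w2 t else 0)),
     b_2 = vec d (\<lambda>j. flt (if j = s then b2 else 0))\<rparr>"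

definition hidden :: "nat \<Rightarrow> fp mat \<Rightarrow> (nat \<Rightarrow> nat \<Rightarrow> real) \<Rightarrow> (nat \<Rightarrow> real) \<Rightarrow> nat \<Rightarrow> nat \<Rightarrow> fp" where
  "hidden d X w1 b1 i t = relu F (fadd F (dot d (\<lambda>l. X $$ (i, l)) (\<lambda>l. w1 l t)) (flt (b1 t)))"

lemma simple_mlp_carrier: "X \<in> carrier_mat n d \<Longrightarrow> mlp_eval F (simple_mlp d s w1 b1 w2 b2) X \<in> carrier_mat n d"
  by (intro carrier_matI) (auto simp: mlp_eval_def simple_mlp_def add_bias_def)

lemma mlp_eval_index:
  assumes "X \<in> carrier_mat n d" "i < n" "j < d"
  shows "mlp_eval F (simple_mlp d s w1 b1 w2 b2) X $$ (i, j) =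
    fadd F (fsum F (map (\<lambda>t. fmul F (hidden d X w1 b1 i t) (flt (if j = s then w2 t else 0))) [0..<3]))
      (flt (if j = s then b2 else 0))"
proof -
  let ?M = "simple_mlp d s w1 b1 w2 b2"
  define Z where "Z = map_mat (relu F) (add_bias F (mmul F X (W_1 ?M)) (b_1 ?M))"
  have dims: "dim_row X = n" "dim_col X = d" using assms by auto
  have Z: "dim_row Z = n" "dim_col Z = 3" by (simp_all add: Z_def add_bias_def simple_mlp_def dims)
  have Zi: "Z $$ (i, t) = hidden d X w1 b1 i t" if "t < 3" for t
  proof -
    have "mmul F X (W_1 ?M) $$ (i, t) = dot d (\<lambda>l. X $$ (i, l)) (\<lambda>l. w1 l t)"
      using that assms unfolding dot_def simple_mlp_def
      by (subst mmul_index) (auto simp: dims intro!: arg_cong[where f="fsum F"])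
    then show ?thesis using that assms(2)
      by (simp add: Z_def add_bias_def simple_mlp_def dims hidden_def)
  qed
  have "mmul F Z (W_2 ?M) $$ (i, j) = fsum F (map (\<lambda>t. fmul F (Z $$ (i, t)) (W_2 ?M $$ (t, j))) [0..<3])"
    using assms by (subst mmul_index) (auto simp: Z simple_mlp_def)
  also have "\<dots> = fsum F (map (\<lambda>t. fmul F (hidden d X w1 b1 i t) (flt (if j = s then w2 t else 0))) [0..<3])"
    by (intro arg_cong[where f="fsum F"] map_upt_cong) (use assms in \<open>simp add: Zi simple_mlp_def\<close>)
  finally have *: "mmul F Z (W_2 ?M) $$ (i, j) = \<dots>" .
  have "mlp_eval F ?M X = add_bias F (mmul F Z (W_2 ?M)) (b_2 ?M)" by (simp add: mlp_eval_def Z_def)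
  then show ?thesis using assms * by (simp add: add_bias_def Z simple_mlp_def)
qed

lemma mlp_eval_other:
  assumes "X \<in> carrier_mat n d" "i < n" "j < d" "j \<noteq> s"
    "\<And>t. t < 3 \<Longrightarrow> hidden d X w1 b1 i t \<in> fin_floats F"
  shows "val F (mlp_eval F (simple_mlp d s w1 b1 w2 b2) X $$ (i, j)) 0"
  unfolding mlp_eval_index[OF assms(1-3)] using assms(4,5) val_flt_small(1)
  by (auto intro!: fadd_zero_left fsum_map_zero fmul_zero_right)

text \<open>Since 1 is the unit \<open>2 ^ (B + p - 1) * \<delta>\<close>, integers with absolute
  sum below \<open>2 ^ p\<close> are added without rounding.\<close>

lemma fsum_map_int:
  assumes "\<And>i. i < n \<Longrightarrow> val F (f i) (of_int (a i))" "(\<Sum>i<n. \<bar>a i\<bar>) < 2 ^ p"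
  shows "val F (fsum F (map f [0..<n])) (of_int (\<Sum>i<n. a i))"
proof -
  have "real_of_int (\<Sum>i<n. \<bar>a i\<bar>) < real_of_int (2 ^ p)" using assms(2) by (simp only: of_int_less_iff)
  then have "(\<Sum>i<n. \<bar>real_of_int (a i)\<bar>) < 2 ^ p" by simp
  moreover have "B + p - 1 \<le> 2 * B + 1" using four_p_le_B by simp
  ultimately have "val F (fsum F (map f [0..<n])) (\<Sum>i<n. real_of_int (a i))"
    using assms(1)
    by (intro fsum_map_exact[of "B + p - 1" n f "\<lambda>i. of_int (a i)", unfolded one_unit mult_1_right]) auto
  then show ?thesis by simp
qed

lemma fmul_int:
  assumes "val F x (of_int a)" "\<bar>a * b\<bar> < 2 ^ p" "\<bar>b\<bar> < 2 ^ p"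
  shows "val F (fmul F x (flt (of_int b))) (of_int (a * b))"
  using fmul_exact[OF assms(1) val_flt_int[OF assms(3)]] representable_int[OF assms(2)] by auto

lemma fadd_int:
  assumes "val F x (of_int a)" "val F y (of_int b)" "\<bar>a + b\<bar> < 2 ^ p"
  shows "val F (fadd F x y) (of_int (a + b))"
  using fadd_exact[OF assms(1,2)] representable_int[OF assms(3)] by auto

lemma val_relu: "val F x r \<Longrightarrow> val F (relu F x) (max r 0)"
  using val_zero[of False] by (auto simp: relu_def val_fval val_not_NaN max_def zero_ereal_def)

lemma hidden_val:
  assumes "val F (dot d (\<lambda>l. X $$ (i, l)) (\<lambda>l. w1 l t)) (of_int a)" "b1 t = of_int b"
    "\<bar>a + b\<bar> < 2 ^ p" "\<bar>b\<bar> < 2 ^ p"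
  shows "val F (hidden d X w1 b1 i t) (of_int (max (a + b) 0))"
proof -
  have "val F (fadd F (dot d (\<lambda>l. X $$ (i, l)) (\<lambda>l. w1 l t)) (flt (b1 t))) (of_int (a + b))"
    using fadd_int[OF assms(1) val_flt_int[OF assms(4)] assms(3)] assms(2) by simp
  from val_relu[OF this] show ?thesis unfolding hidden_def by (simp add: max_def split: if_splits)
qed

lemma mlp_eval_main:
  assumes "X \<in> carrier_mat n d" "i < n" "s < d"
    "\<And>t. t < 3 \<Longrightarrow> val F (hidden d X w1 b1 i t) (of_int (h t))"
    "\<And>t. t < 3 \<Longrightarrow> w2 t = of_int (w t)" "b2 = of_int b"
    "\<And>t. t < 3 \<Longrightarrow> \<bar>w t\<bar> < 2 ^ p"
    "(\<Sum>t<3. \<bar>h t * w t\<bar>) + \<bar>b\<bar> < 2 ^ p"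
  shows "val F (mlp_eval F (simple_mlp d s w1 b1 w2 b2) X $$ (i, s)) (of_int ((\<Sum>t<3. h t * w t) + b))"
proof -
  have nn: "0 \<le> (\<Sum>t<3. \<bar>h t * w t\<bar>)" by (intro sum_nonneg) auto
  have le: "\<bar>h t * w t\<bar> \<le> (\<Sum>t<3. \<bar>h t * w t\<bar>)" if "t < 3" for t
    using that by (intro member_le_sum) auto
  have abs: "\<bar>\<Sum>t<3. h t * w t\<bar> \<le> (\<Sum>t<3. \<bar>h t * w t\<bar>)" by (rule sum_abs)
  have sum: "val F (fsum F (map (\<lambda>t. fmul F (hidden d X w1 b1 i t) (flt (w2 t))) [0..<3])) (of_int (\<Sum>t<3. h t * w t))"
  proof (rule fsum_map_int)
    fix t :: nat assume t: "t < 3"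
    have "\<bar>h t * w t\<bar> < 2 ^ p" using le[OF t] assms(8) by linarith
    then show "val F (fmul F (hidden d X w1 b1 i t) (flt (w2 t))) (of_int (h t * w t))"
      unfolding assms(5)[OF t] using fmul_int[OF assms(4)[OF t]] assms(7)[OF t] by simp
  next
    show "(\<Sum>t<3. \<bar>h t * w t\<bar>) < 2 ^ p" using assms(8) by linarith
  qed
  have "\<bar>b\<bar> < 2 ^ p" "\<bar>(\<Sum>t<3. h t * w t) + b\<bar> < 2 ^ p" using assms(8) nn abs by linarith+
  from fadd_int[OF sum val_flt_int[OF this(1)] this(2)] show ?thesis
    unfolding mlp_eval_index[OF assms(1-3)] assms(6) by (simp only: if_True simp_thms)
qed

section \<open>Perceptrons for the connectives and the tests\<close>

definition on_first :: "real \<Rightarrow> nat \<Rightarrow> real" where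
  "on_first r t = (if t = 0 then r else 0)"

lemma sum_3: "(\<Sum>t<3. f t) = f 0 + f 1 + f (2::nat)" for f :: "nat \<Rightarrow> int"
  by (simp add: numeral_3_eq_3 numeral_2_eq_2)

lemma small_int: "k \<le> 20 \<Longrightarrow> k < (2::int) ^ p"
proof -
  assume "k \<le> 20"
  also have "(20::int) < 2 ^ 8" by simp
  also have "\<dots> \<le> 2 ^ p" using p_ge by (intro power_increasing) auto
  finally show ?thesis .
qed

lemma hidden_unused:
  assumes "fin_mat n d X" "i < n" "\<And>l. w1 l t = 0" "b1 t = 0"
  shows "val F (hidden d X w1 b1 i t) 0"
  using hidden_val[of d X i w1 t 0 b1 0] dot_zero[of d "\<lambda>l. X $$ (i, l)" "\<lambda>l. w1 l t"] assms
  by (simp add: fin_mat_def)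

lemma one_hidden_mlp:
  assumes X: "fin_mat n d X" "i < n" and w1: "\<And>l t. t \<noteq> 0 \<Longrightarrow> w1 l t = 0"
    and h: "val F (hidden d X w1 (on_first c) i 0) (of_int h)" "\<bar>h\<bar> \<le> 1" and w: "\<bar>w\<bar> \<le> 1" "\<bar>b\<bar> \<le> 1"
    and j: "j < d"
  shows "val F (mlp_eval F (simple_mlp d s w1 (on_first c) (on_first (of_int w)) (of_int b)) X $$ (i, j))
    (if j = s then of_int (h * w + b) else 0)"
proof -
  let ?h = "\<lambda>t::nat. if t = 0 then h else 0"
  let ?w = "\<lambda>t::nat. if t = 0 then w else 0"
  have hid: "val F (hidden d X w1 (on_first c) i t) (of_int (?h t))" for t
    using h(1) hidden_unused[OF X, of w1 t "on_first c"] w1[of t] by (simp add: on_first_def)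
  have X': "X \<in> carrier_mat n d" using X by (simp add: fin_mat_def)
  show ?thesis
  proof (cases "j = s")
    case True
    have hw: "\<bar>h * w\<bar> \<le> 1 * 1" unfolding abs_mult using h(2) w(1) by (intro mult_mono) auto
    have "val F (mlp_eval F (simple_mlp d s w1 (on_first c) (on_first (of_int w)) (of_int b)) X $$ (i, s))
      (of_int ((\<Sum>t<3. ?h t * ?w t) + b))"
    proof (rule mlp_eval_main[OF X' X(2) _ hid])
      show "s < d" using j True by simp
      show "\<bar>?w t\<bar> < 2 ^ p" for t :: nat using w by (intro small_int) auto
      show "(\<Sum>t<3. \<bar>?h t * ?w t\<bar>) + \<bar>b\<bar> < 2 ^ p" using hw w by (intro small_int) (simp add: sum_3)
    qed (auto simp: on_first_def)
    then show ?thesis using True by (simp add: sum_3)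
  next
    case False
    then show ?thesis using mlp_eval_other[OF X' X(2) j False val_fin[OF hid]] by simp
  qed
qed

definition idle_mlp :: "nat \<Rightarrow> mlp" where
  "idle_mlp d = simple_mlp d d (\<lambda>_ _. 0) (on_first 0) (on_first (of_int 0)) (of_int 0)"

lemma idle_mlp:
  assumes "fin_mat n d X" "i < n" "j < d"
  shows "val F (mlp_eval F (idle_mlp d) X $$ (i, j)) 0"
proof -
  have "val F (hidden d X (\<lambda>_ _. 0) (on_first 0) i 0) (of_int 0)"
    using hidden_unused[OF assms(1,2)] by (simp add: on_first_def)
  from one_hidden_mlp[OF assms(1,2) _ this _ _ _ assms(3), of 0 0 d] show ?thesis
    using assms(3) by (simp add: idle_mlp_def)
qed

definition neg_mlp :: "nat \<Rightarrow> nat \<Rightarrow> nat \<Rightarrow> mlp" where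
  "neg_mlp d a s = simple_mlp d s (\<lambda>l t. if l = a \<and> t = 0 then 1 else 0) (on_first 0)
     (on_first (of_int (-1))) (of_int 1)"

lemma neg_mlp:
  assumes X: "fin_mat n d X" "i < n" and j: "j < d" and a: "a < d" "val F (X $$ (i, a)) (if Q then 1 else 0)"
  shows "val F (mlp_eval F (neg_mlp d a s) X $$ (i, j)) (if j = s \<and> \<not> Q then 1 else 0)"
proof -
  let ?w1 = "\<lambda>l t. if l = a \<and> t = (0::nat) then 1 else (0::real)"
  let ?h = "if Q then 1 else 0 :: int"
  have "val F (dot d (\<lambda>l. X $$ (i, l)) (\<lambda>l. ?w1 l 0)) (of_int ?h)"
    using X a fmul_one_right[OF a(2) val_flt_small(2)]
    by (intro dot_single[where a=a]) (auto simp: fin_mat_def)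
  from hidden_val[of d X i ?w1 0, OF this, of "on_first 0" 0]
  have "val F (hidden d X ?w1 (on_first 0) i 0) (of_int ?h)"
    by (simp add: on_first_def small_int)
  from one_hidden_mlp[OF X _ this _ _ _ j, of "-1" 1 s] show ?thesis
    by (cases "j = s") (auto simp: neg_mlp_def)
qed

text \<open>The positive part of \<open>x + y - 1\<close>. The two indicators are added so that the
  weight is 2 for \<open>a = b\<close>, when a formula is conjoined with itself.\<close>

definition conj_mlp :: "nat \<Rightarrow> nat \<Rightarrow> nat \<Rightarrow> nat \<Rightarrow> mlp" where
  "conj_mlp d a b s = simple_mlp d s (\<lambda>l t. if t = 0 then of_int (of_bool (l = a) + of_bool (l = b)) else 0)
     (on_first (-1)) (on_first (of_int 1)) (of_int 0)"

lemma conj_mlp: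
  assumes X: "fin_mat n d X" "i < n" and j: "j < d"
    and a: "a < d" "val F (X $$ (i, a)) (if Q then 1 else 0)"
    and b: "b < d" "val F (X $$ (i, b)) (if R then 1 else 0)"
  shows "val F (mlp_eval F (conj_mlp d a b s) X $$ (i, j)) (if j = s \<and> Q \<and> R then 1 else 0)"
proof -
  let ?w1 = "\<lambda>l t. if t = (0::nat) then real_of_int (of_bool (l = a) + of_bool (l = b)) else 0"
  let ?c = "\<lambda>l. (if l = a then of_bool Q else 0) + (if l = b then of_bool R else 0) :: int"
  have QR: "Q = R" if "a = b" using val_unique[OF a(2)] b(2) that by (auto split: if_splits)
  have sum: "(\<Sum>l<d. ?c l) = of_bool Q + of_bool R" using a(1) b(1) by (simp add: sum.distrib)
  have "val F (dot d (\<lambda>l. X $$ (i, l)) (\<lambda>l. ?w1 l 0)) (of_int (\<Sum>l<d. ?c l))"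
    unfolding dot_def
  proof (rule fsum_map_int)
    fix t assume t: "t < d"
    show "val F (fmul F (X $$ (i, t)) (flt (?w1 t 0))) (of_int (?c t))"
    proof (cases "t = a \<or> t = b")
      case True
      have *: "val F (X $$ (i, t)) (of_int (of_bool (if t = a then Q else R)))"
        using True a(2) b(2) by (cases "t = a") (auto split: if_splits)
      have "val F (fmul F (X $$ (i, t)) (flt (of_int (of_bool (t = a) + of_bool (t = b)))))
        (of_int (of_bool (if t = a then Q else R) * (of_bool (t = a) + of_bool (t = b))))"
        by (rule fmul_int[OF *]) (auto simp: small_int)
      moreover have "of_bool (if t = a then Q else R) * (of_bool (t = a) + of_bool (t = b)) = ?c t"
        using True QR by auto
      ultimately show ?thesis by simp
    next
      case False
      then show ?thesis using fmul_zero_right[OF _ val_flt_small(1)] X t by (simp add: fin_mat_def)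
    qed
  next
    have "(\<Sum>l<d. \<bar>?c l\<bar>) = (\<Sum>l<d. ?c l)" by (intro sum.cong) auto
    then show "(\<Sum>l<d. \<bar>?c l\<bar>) < 2 ^ p" unfolding sum by (intro small_int) auto
  qed
  then have "val F (dot d (\<lambda>l. X $$ (i, l)) (\<lambda>l. ?w1 l 0)) (of_int (of_bool Q + of_bool R))"
    unfolding sum .
  from hidden_val[of d X i ?w1 0, OF this, of "on_first (-1)" "-1"]
  have "val F (hidden d X ?w1 (on_first (-1)) i 0) (of_int (of_bool (Q \<and> R)))"
    by (cases Q; cases R) (simp_all add: on_first_def small_int)
  from one_hidden_mlp[OF X _ this _ _ _ j, of 1 0 s] show ?thesis
    by (cases "j = s") (auto simp: conj_mlp_def)
qed

text \<open>One minus the positive part of \<open>1 - y\<close>: this is 0 at \<open>y = 0\<close>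
  and 1 for every \<open>y \<ge> 1\<close>, so the inexact output of attention becomes an exact
  truth value.\<close>

definition threshold_mlp :: "nat \<Rightarrow> nat \<Rightarrow> nat \<Rightarrow> mlp" where
  "threshold_mlp d a s = simple_mlp d s (\<lambda>l t. if l = a \<and> t = 0 then -1 else 0) (on_first 1)
     (on_first (of_int (-1))) (of_int 1)"

lemma threshold_mlp:
  assumes X: "fin_mat n d X" "i < n" and j: "j < d"
    and a: "a < d" "val F (X $$ (i, a)) y" "if Q then 1 \<le> y else y = 0"
  shows "val F (mlp_eval F (threshold_mlp d a s) X $$ (i, j)) (if j = s \<and> Q then 1 else 0)"
proof -
  let ?w1 = "\<lambda>l t. if l = a \<and> t = (0::nat) then -1 else (0::real)"
  let ?h = "if Q then 0 else 1 :: int"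
  have "val F (fmul F (X $$ (i, a)) (flt (-1))) (- y)"
    using fmul_exact[OF a(2) val_flt_small(5), of "fneg (X $$ (i, a))"] fneg_val[OF a(2)] by simp
  then have d: "val F (dot d (\<lambda>l. X $$ (i, l)) (\<lambda>l. ?w1 l 0)) (- y)"
    using X a by (intro dot_single[where a=a]) (auto simp: fin_mat_def)
  have "val F (hidden d X ?w1 (on_first 1) i 0) (of_int ?h)"
  proof (cases Q)
    case True
    \<comment> \<open>Here \<open>y\<close> is any float from 1 upwards and \<open>1 - y\<close> may
      be rounded; only its sign counts, and rounding cannot make it positive.\<close>
    obtain z where z: "fadd F (dot d (\<lambda>l. X $$ (i, l)) (\<lambda>l. ?w1 l 0)) (flt 1) = fround F z (- y + 1)"
      using fadd_fround[OF d val_flt_small(2)] by blast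
    have o: "\<bar>- y + 1\<bar> < overflow_bound F"
      using val_less_overflow[OF a(2), of "y - 1"] a(3) True by (simp add: abs_minus_commute)
    have "val F (relu F (fround F z (- y + 1))) 0"
      using val_relu[OF valI[OF fround_fin[OF o]]] fround_nonpos[OF o] a(3) True by (simp add: max_absorb2)
    moreover have "hidden d X ?w1 (on_first 1) i 0 = relu F (fround F z (- y + 1))"
      unfolding hidden_def z[symmetric] by (simp add: on_first_def)
    ultimately show ?thesis using True by simp
  next
    case False
    then have "val F (dot d (\<lambda>l. X $$ (i, l)) (\<lambda>l. ?w1 l 0)) (of_int 0)" using d a(3) by simp
    from hidden_val[of d X i ?w1 0, OF this, of "on_first 1" 1] False show ?thesis
      by (simp add: on_first_def small_int)
  qed
  from one_hidden_mlp[OF X _ this _ _ _ j, of "-1" 1 s] show ?thesis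
    by (cases "j = s") (auto simp: threshold_mlp_def)
qed

text \<open>Computes \<open>[x = m]\<close> on naturals as \<open>(x - m + 1)\<^sup>+ - 2 (x - m)\<^sup>+ + (x - m - 1)\<^sup>+\<close>.\<close>

definition equal_mlp :: "nat \<Rightarrow> nat \<Rightarrow> nat \<Rightarrow> nat \<Rightarrow> mlp" where
  "equal_mlp d m a s = simple_mlp d s (\<lambda>l t. if l = a then 2 ^ (p - 1) else 0) (\<lambda>t. of_int (1 - int t - int m))
     (\<lambda>t. of_int (if t = 1 then -2 else 1)) (of_int 0)"

lemma equal_mlp:
  assumes X: "fin_mat n d X" "i < n" and j: "j < d" and m: "m \<le> 2 ^ l"
    and a: "a < d" "val F (X $$ (i, a)) (real x / 2 ^ (p - 1))" "x \<le> 4 * (2 ^ l * 2 ^ l)"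
  shows "val F (mlp_eval F (equal_mlp d m a s) X $$ (i, j)) (if j = s \<and> x = m then 1 else 0)"
proof -
  let ?w1 = "\<lambda>l t::nat. if l = a then 2 ^ (p - 1) else (0::real)"
  let ?b1 = "\<lambda>t. real_of_int (1 - int t - int m)"
  let ?w = "\<lambda>t::nat. if t = 1 then -2 else 1 :: int"
  let ?h = "\<lambda>t. max (int x + (1 - int t - int m)) 0"
  have X': "X \<in> carrier_mat n d" using X by (simp add: fin_mat_def)
  have pow: "1 \<le> (2::int) ^ l * 2 ^ l" using one_le_power[of "2::int" "l + l"] by (simp add: power_add)
  have mm: "int m \<le> 2 ^ l * 2 ^ l"
  proof -
    have "m \<le> 2 ^ l * 2 ^ l" using m by (rule order_trans) simp
    then have "int m \<le> int (2 ^ l * 2 ^ l)" by (simp only: of_nat_le_iff)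
    then show ?thesis by simp
  qed
  have xx: "int x \<le> 4 * (2 ^ l * 2 ^ l)"
  proof -
    have "int x \<le> int (4 * (2 ^ l * 2 ^ l))" using a(3) by (simp only: of_nat_le_iff)
    then show ?thesis by simp
  qed
  have pp: "(2::int) ^ p = 256 * (2 ^ l * 2 ^ l)"
  proof -
    have "int (2 ^ p) = int (256 * (2 ^ l * 2 ^ l))" by (simp only: two_p)
    then show ?thesis by simp
  qed
  have rx: "val F (flt (2 ^ (p - 1))) (2 ^ (p - 1))" by (intro val_flt representable_two_power) simp
  have "\<bar>int x\<bar> < 2 ^ p" using xx pp pow by linarith
  from representable_int[OF this] have "\<exists>f. val F f (real x / 2 ^ (p - 1) * 2 ^ (p - 1))" by simp
  then have "val F (fmul F (X $$ (i, a)) (flt (2 ^ (p - 1)))) (of_int (int x))"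
    using fmul_exact[OF a(2) rx] by auto
  then have d: "val F (dot d (\<lambda>l. X $$ (i, l)) (\<lambda>l. ?w1 l t)) (of_int (int x))" for t
    using X a by (intro dot_single[where a=a]) (auto simp: fin_mat_def)
  have hid: "val F (hidden d X ?w1 ?b1 i t) (of_int (?h t))" if "t < 3" for t
    using that pp mm xx pow by (intro hidden_val d) auto
  show ?thesis
  proof (cases "j = s")
    case True
    have v: "val F (mlp_eval F (equal_mlp d m a s) X $$ (i, s)) (of_int ((\<Sum>t<3. ?h t * ?w t) + 0))"
      unfolding equal_mlp_def
    proof (rule mlp_eval_main[OF X' X(2) _ hid])
      show "s < d" using j True by simp
      show "\<bar>?w t\<bar> < 2 ^ p" for t :: nat by (intro small_int) auto
      \<comment> \<open>Each ramp is at most \<open>x + 1\<close> and each weight at most 2 in size;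
        the total \<open>6 * (x + 1)\<close> fits below \<open>2 ^ p\<close> thanks to the factor
        256 in \<open>two_p\<close>.\<close>
      have "(\<Sum>t<3. \<bar>?h t * ?w t\<bar>) \<le> (\<Sum>t<(3::nat). (int x + 1) * 2)"
        unfolding abs_mult by (intro sum_mono mult_mono) auto
      then show "(\<Sum>t<3. \<bar>?h t * ?w t\<bar>) + \<bar>0\<bar> < 2 ^ p" using pp xx pow by simp
    qed auto
    have eq: "(\<Sum>t<3. ?h t * ?w t) + 0 = (if x = m then 1 else 0)"
    proof -
      have "x = m \<or> int x + 1 \<le> int m \<or> int m + 1 \<le> int x" by linarith
      then show ?thesis by (elim disjE) (auto simp: sum_3 max_absorb1 max_absorb2)
    qed
    show ?thesis using v True unfolding eq by (cases "x = m") simp_all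
  next
    case False
    then show ?thesis unfolding equal_mlp_def using mlp_eval_other[OF X' X(2) j False val_fin[OF hid]] by simp
  qed
qed

end

section \<open>The logic with divisibility tests\<close>

text \<open>The logic in the form the layers can evaluate: thresholds on the prefix are replaced by
  existence and by divisibility of a fixed number by the count, and one layer handles one
  constructor.\<close>

datatype 'a xform = XBot | XProp 'a | XNeg "'a xform" | XConj "'a xform" "'a xform"
  | XEx "'a xform" | XDvd nat "'a xform" | XPSuf "'a xform"

fun xsat :: "'a tsgraph \<Rightarrow> nat \<Rightarrow> 'a xform \<Rightarrow> bool" where
  "xsat G w XBot = False"
| "xsat G w (XProp a) = (lab G w = Tok a)"
| "xsat G w (XNeg \<phi>) = (\<not> xsat G w \<phi>)"
| "xsat G w (XConj \<phi> \<psi>) = (xsat G w \<phi> \<and> xsat G w \<psi>)"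
| "xsat G w (XEx \<phi>) = (\<exists>v \<in> prefix_verts G. xsat G v \<phi>)"
| "xsat G w (XDvd m \<phi>) = (card {v \<in> prefix_verts G. xsat G v \<phi>} dvd m)"
| "xsat G w (XPSuf \<phi>) = (\<exists>v \<in> suffix_verts G. v < w \<and> xsat G v \<phi>)"

text \<open>A count \<open>c\<close> satisfies \<open>1 \<le> c < k\<close> iff it divides some \<open>j\<close> with \<open>1 \<le> j < k\<close>.\<close>

fun translate :: "'a gptl \<Rightarrow> 'a xform" where
  "translate Bot = XBot"
| "translate (Prop a) = XProp a"
| "translate (Neg \<phi>) = XNeg (translate \<phi>)"
| "translate (Conj \<phi> \<psi>) = XConj (translate \<phi>) (translate \<psi>)"
| "translate (GPre k \<phi>) = (if k = 0 then XNeg XBot else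
     foldr (\<lambda>j \<psi>. XConj (XNeg (XDvd j (translate \<phi>))) \<psi>) [1..<k] (XEx (translate \<phi>)))"
| "translate (PSuf \<phi>) = XPSuf (translate \<phi>)"

lemma xsat_foldr:
  "xsat G w (foldr (\<lambda>j \<psi>. XConj (XNeg (XDvd j \<phi>)) \<psi>) js \<chi>) \<longleftrightarrow>
   (\<forall>j\<in>set js. \<not> card {v \<in> prefix_verts G. xsat G v \<phi>} dvd j) \<and> xsat G w \<chi>"
  by (induction js) auto

lemma xsat_translate:
  assumes "finite (prefix_verts G)" shows "xsat G w (translate \<phi>) \<longleftrightarrow> sat G w \<phi>"
proof (induction \<phi> arbitrary: w)
  case (GPre k \<phi>)
  let ?S = "{v \<in> prefix_verts G. sat G v \<phi>}"
  have fin: "finite ?S" using assms by simp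
  have ex: "(\<exists>v \<in> prefix_verts G. sat G v \<phi>) \<longleftrightarrow> 1 \<le> card ?S"
    using fin by (auto simp: Suc_le_eq card_gt_0_iff)
  have "k \<le> card ?S \<longleftrightarrow> (\<forall>j\<in>{1..<k}. \<not> card ?S dvd j) \<and> 1 \<le> card ?S" if "k \<noteq> 0"
  proof
    assume "k \<le> card ?S"
    moreover have "\<not> card ?S dvd j" if "j \<in> {1..<k}" for j
      using dvd_imp_le[of "card ?S" j] that \<open>k \<le> card ?S\<close> by auto
    ultimately show "(\<forall>j\<in>{1..<k}. \<not> card ?S dvd j) \<and> 1 \<le> card ?S" using that by simp
  next
    assume "(\<forall>j\<in>{1..<k}. \<not> card ?S dvd j) \<and> 1 \<le> card ?S"
    then show "k \<le> card ?S" by (meson atLeastLessThan_iff dvd_refl not_le)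
  qed
  then show ?case using ex by (cases "k = 0") (simp_all only: translate.simps sat.simps xsat.simps
      if_True if_False simp_thms xsat_foldr set_upt GPre.IH le0)
qed auto

section \<open>Subformula lists and the range of the moduli\<close>

fun max_threshold :: "'a gptl \<Rightarrow> nat" where
  "max_threshold (Neg \<phi>) = max_threshold \<phi>"
| "max_threshold (Conj \<phi> \<psi>) = max (max_threshold \<phi>) (max_threshold \<psi>)"
| "max_threshold (GPre k \<phi>) = max k (max_threshold \<phi>)"
| "max_threshold (PSuf \<phi>) = max_threshold \<phi>"
| "max_threshold _ = 0"

fun kids :: "'a xform \<Rightarrow> 'a xform set" where
  "kids (XNeg \<phi>) = {\<phi>}"
| "kids (XConj \<phi> \<psi>) = {\<phi>, \<psi>}"
| "kids (XEx \<phi>) = {\<phi>}"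
| "kids (XDvd m \<phi>) = {\<phi>}"
| "kids (XPSuf \<phi>) = {\<phi>}"
| "kids _ = {}"

text \<open>Post-order, so that operands are evaluated in earlier layers than the formulas using
  them. Repetitions may occur; \<open>pos\<close> refers to first occurrences.\<close>

fun subs :: "'a xform \<Rightarrow> 'a xform list" where
  "subs (XNeg \<phi>) = subs \<phi> @ [XNeg \<phi>]"
| "subs (XConj \<phi> \<psi>) = subs \<phi> @ subs \<psi> @ [XConj \<phi> \<psi>]"
| "subs (XEx \<phi>) = subs \<phi> @ [XEx \<phi>]"
| "subs (XDvd m \<phi>) = subs \<phi> @ [XDvd m \<phi>]"
| "subs (XPSuf \<phi>) = subs \<phi> @ [XPSuf \<phi>]"
| "subs \<phi> = [\<phi>]"

lemma self_in_subs: "\<phi> \<in> set (subs \<phi>)"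
  by (cases \<phi>) auto

definition closed_list :: "'a xform list \<Rightarrow> bool" where
  "closed_list L \<longleftrightarrow> (\<forall>i<length L. kids (L ! i) \<subseteq> set (take i L))"

lemma closed_list_append: "closed_list A \<Longrightarrow> closed_list C \<Longrightarrow> closed_list (A @ C)"
  unfolding closed_list_def
proof (intro allI impI)
  fix i assume A: "\<forall>i<length A. kids (A ! i) \<subseteq> set (take i A)" and C: "\<forall>i<length C. kids (C ! i) \<subseteq> set (take i C)"
    and i: "i < length (A @ C)"
  show "kids ((A @ C) ! i) \<subseteq> set (take i (A @ C))"
  proof (cases "i < length A")
    case True
    then show ?thesis using A by (simp add: nth_append)
  next
    case False
    then have "kids (C ! (i - length A)) \<subseteq> set (take (i - length A) C)" using C i by auto
    then show ?thesis using False by (auto simp: nth_append)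
  qed
qed

lemma closed_list_snoc: "closed_list A \<Longrightarrow> kids \<phi> \<subseteq> set A \<Longrightarrow> closed_list (A @ [\<phi>])"
  by (auto simp: closed_list_def nth_append less_Suc_eq)

lemma closed_list_subs: "closed_list (subs \<phi>)"
proof (induction \<phi>)
  case (XConj \<phi> \<psi>)
  then have "closed_list ((subs \<phi> @ subs \<psi>) @ [XConj \<phi> \<psi>])"
    using self_in_subs by (intro closed_list_snoc closed_list_append) auto
  then show ?case by simp
qed (auto intro!: closed_list_snoc simp: self_in_subs, auto simp: closed_list_def)

lemma closed_list_concat: "\<forall>A\<in>set As. closed_list A \<Longrightarrow> closed_list (concat As)"
proof (induction As)
  case Nil
  then show ?case by (simp add: closed_list_def)
qed (simp add: closed_list_append)

text \<open>The range in which \<open>rounded_share\<close> decides divisibility.\<close>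

definition moduli_ok :: "nat \<Rightarrow> 'a xform set \<Rightarrow> bool" where
  "moduli_ok l S \<longleftrightarrow> (\<forall>m \<phi>. XDvd m \<phi> \<in> S \<longrightarrow> 1 \<le> m \<and> m \<le> 2 ^ l)"

lemma moduli_ok_simps:
  "moduli_ok l {}" "moduli_ok l (S \<union> T) \<longleftrightarrow> moduli_ok l S \<and> moduli_ok l T"
  "moduli_ok l (insert XBot S) \<longleftrightarrow> moduli_ok l S" "moduli_ok l (insert (XProp a) S) \<longleftrightarrow> moduli_ok l S"
  "moduli_ok l (insert (XNeg \<phi>) S) \<longleftrightarrow> moduli_ok l S" "moduli_ok l (insert (XConj \<phi> \<psi>) S) \<longleftrightarrow> moduli_ok l S"
  "moduli_ok l (insert (XEx \<phi>) S) \<longleftrightarrow> moduli_ok l S" "moduli_ok l (insert (XPSuf \<phi>) S) \<longleftrightarrow> moduli_ok l S"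
  "moduli_ok l (insert (XDvd k \<phi>) S) \<longleftrightarrow> 1 \<le> k \<and> k \<le> 2 ^ l \<and> moduli_ok l S"
  unfolding moduli_ok_def by blast+

lemma moduli_ok_foldr:
  assumes "\<forall>j\<in>set js. 1 \<le> j \<and> j \<le> 2 ^ l" "moduli_ok l (set (subs \<phi>))" "moduli_ok l (set (subs \<chi>))"
  shows "moduli_ok l (set (subs (foldr (\<lambda>j \<psi>. XConj (XNeg (XDvd j \<phi>)) \<psi>) js \<chi>)))"
  using assms(1)
proof (induction js)
  case Nil
  then show ?case using assms(3) by simp
next
  case (Cons j js)
  then show ?case using assms(2) by (simp add: moduli_ok_simps)
qed

lemma moduli_ok_translate: "max_threshold \<phi> \<le> l \<Longrightarrow> moduli_ok l (set (subs (translate \<phi>)))"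
proof (induction \<phi>)
  case (GPre k \<phi>)
  have "j \<le> 2 ^ l" if "j < k" for j
  proof -
    have "k \<le> l" using GPre.prems by simp
    moreover have "l < 2 ^ l" by (rule less_exp)
    ultimately show ?thesis using that by linarith
  qed
  moreover have "moduli_ok l (set (subs (translate \<phi>)))" using GPre by simp
  ultimately have "moduli_ok l (set (subs (foldr (\<lambda>j \<psi>. XConj (XNeg (XDvd j (translate \<phi>))) \<psi>) [1..<k]
      (XEx (translate \<phi>)))))"
    by (intro moduli_ok_foldr) (auto simp: moduli_ok_simps)
  then show ?case by (simp add: moduli_ok_simps)
qed (simp_all add: moduli_ok_simps)

section \<open>The transformer\<close>

lemma sorted_list_suffix: "sorted_list_of_set {a..b} = [a..<Suc b]" for a b :: nat
  by (simp only: sorted_list_of_set_range flip: atLeastLessThanSuc_atLeastAtMost)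

lemma image_add_lessThan: "(\<lambda>r. a + r) ` {..<b - a} = {a..<b}" for a b :: nat
proof (intro equalityI subsetI)
  fix x assume "x \<in> {a..<b}"
  then show "x \<in> (\<lambda>r. a + r) ` {..<b - a}" by (intro image_eqI[of _ _ "x - a"]) auto
qed auto

lemma tsgraph_split:
  assumes "is_tsgraph \<Sigma> G"
  shows "\<exists>n. 1 \<le> bos G \<and> bos G \<le> n \<and> prefix_verts G = {1..<bos G} \<and> suffix_verts G = {bos G..n}"
proof -
  obtain n where n: "verts G = {1..n}" using assms by (auto simp: is_tsgraph_def)
  have "\<exists>!w. w \<in> verts G \<and> lab G w = BOS" using assms by (simp add: is_tsgraph_def)
  then have "bos G \<in> verts G \<and> lab G (bos G) = BOS" unfolding bos_def by (rule theI')
  then have "bos G \<in> {1..n}" using n by simp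
  then show ?thesis unfolding prefix_verts_def suffix_verts_def n by (intro exI[of _ n]) auto
qed

text \<open>Layer \<open>k\<close> of the encoder and of the decoder evaluates the formula \<open>L ! k\<close>. Column 0 holds the constant 1,
  column \<open>feat k\<close> the truth value of \<open>L ! k\<close>, and column \<open>scr k\<close> receives what attention writes in
  layer \<open>k\<close>; later layers ignore it.\<close>

locale network = float_format F l p B \<delta> for F l p B \<delta> +
  fixes L :: "'a xform list"
  assumes closed: "closed_list L" and moduli: "moduli_ok l (set L)" and nonempty: "L \<noteq> []"
begin

abbreviation "m \<equiv> length L"
definition d :: nat where "d = 2 * m + 1"
definition feat :: "nat \<Rightarrow> nat" where "feat i = 1 + i"
definition scr :: "nat \<Rightarrow> nat" where "scr i = 1 + m + i"
definition pos :: "'a xform \<Rightarrow> nat" where "pos \<phi> = (LEAST i. i < m \<and> L ! i = \<phi>)"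

lemma pos_le: "i < m \<Longrightarrow> pos (L ! i) \<le> i" unfolding pos_def by (rule Least_le) simp

lemma pos_in: "\<phi> \<in> set L \<Longrightarrow> pos \<phi> < m \<and> L ! pos \<phi> = \<phi>"
  unfolding pos_def by (rule LeastI_ex) (auto simp: in_set_conv_nth)

text \<open>Closedness provides some occurrence before \<open>k\<close>, and the first occurrence is
  no later.\<close>

lemma kid_pos: "k < m \<Longrightarrow> \<phi> \<in> kids (L ! k) \<Longrightarrow> pos \<phi> < k \<and> L ! pos \<phi> = \<phi>"
proof -
  assume k: "k < m" "\<phi> \<in> kids (L ! k)"
  then have "\<phi> \<in> set (take k L)" using closed by (auto simp: closed_list_def)
  then obtain i where i: "i < k" "L ! i = \<phi>" using k by (auto simp: in_set_conv_nth)
  then show ?thesis using pos_le[of i] k pos_in[of \<phi>] by auto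
qed

lemma coord: "i < m \<Longrightarrow> feat i < d" "i < m \<Longrightarrow> scr i < d" "0 < feat i" "0 < scr i"
  "feat i = feat j \<longleftrightarrow> i = j" "scr i = scr j \<longleftrightarrow> i = j" "i < m \<Longrightarrow> feat i \<noteq> scr j" "i < m \<Longrightarrow> scr j \<noteq> feat i" "0 < d"
  by (auto simp: feat_def scr_def d_def)

text \<open>Column \<open>d\<close> does not exist: this head reads and writes nothing.\<close>

definition idle_mha :: mha where "idle_mha = exists_mha d d d"

definition enc_att :: "nat \<Rightarrow> mha" where
  "enc_att i = (case L ! i of XEx \<phi> \<Rightarrow> exists_mha d (feat (pos \<phi>)) (scr i)
     | XDvd k \<phi> \<Rightarrow> dvd_mha d k (feat (pos \<phi>)) (scr i) | _ \<Rightarrow> idle_mha)"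

text \<open>Idle in three cases: \<open>XBot\<close> and, on the prefix, \<open>XPSuf\<close> are
  false and keep the initial 0, and atoms are already set by the embedding.\<close>

definition enc_net :: "nat \<Rightarrow> mlp" where
  "enc_net i = (case L ! i of XNeg \<phi> \<Rightarrow> neg_mlp d (feat (pos \<phi>)) (feat i)
     | XConj \<phi> \<psi> \<Rightarrow> conj_mlp d (feat (pos \<phi>)) (feat (pos \<psi>)) (feat i)
     | XEx \<phi> \<Rightarrow> threshold_mlp d (scr i) (feat i)
     | XDvd k \<phi> \<Rightarrow> equal_mlp d k (scr i) (feat i) | _ \<Rightarrow> idle_mlp d)"

definition dec_att :: "nat \<Rightarrow> mha" where
  "dec_att i = (case L ! i of XPSuf \<phi> \<Rightarrow> exists_mha d (feat (pos \<phi>)) (scr i) | _ \<Rightarrow> idle_mha)"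

text \<open>Prefix formulas have the same truth value at every vertex, so the decoder only has to find a
  prefix vertex at which the encoder found them true; on the empty prefix they are false.\<close>

definition dec_cross_att :: "nat \<Rightarrow> mha" where
  "dec_cross_att i = (case L ! i of XEx \<phi> \<Rightarrow> exists_mha d (feat i) (scr i)
     | XDvd k \<phi> \<Rightarrow> exists_mha d (feat i) (scr i) | _ \<Rightarrow> idle_mha)"

text \<open>For \<open>XEx\<close>, \<open>XDvd\<close> and \<open>XPSuf\<close> alike, attention
  leaves 0 or a number of at least 1 in the scratch column, so one threshold serves all
  three.\<close>

definition dec_net :: "nat \<Rightarrow> mlp" where
  "dec_net i = (case L ! i of XNeg \<phi> \<Rightarrow> neg_mlp d (feat (pos \<phi>)) (feat i)
     | XConj \<phi> \<psi> \<Rightarrow> conj_mlp d (feat (pos \<phi>)) (feat (pos \<psi>)) (feat i)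
     | XBot \<Rightarrow> idle_mlp d | XProp a \<Rightarrow> idle_mlp d | _ \<Rightarrow> threshold_mlp d (scr i) (feat i))"

text \<open>Preservation is up to value, because adding a zero in a residual connection can change
  the sign bit of a zero entry.\<close>

definition keeps :: "nat \<Rightarrow> nat set \<Rightarrow> fp mat \<Rightarrow> fp mat \<Rightarrow> bool" where
  "keeps n S X X' \<longleftrightarrow> fin_mat n d X' \<and> (\<forall>i<n. \<forall>j<d. j \<notin> S \<longrightarrow> val F (X' $$ (i, j)) (rval F (X $$ (i, j))))"

lemma keeps_trans:
  assumes "keeps n S X X'" "keeps n S' X' X''" shows "keeps n (S \<union> S') X X''"
  using assms unfolding keeps_def val_def by auto

lemma keeps_val:
  assumes "keeps n S X X'" "i < n" "j < d" "j \<notin> S" "val F (X $$ (i, j)) r"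
  shows "val F (X' $$ (i, j)) r"
  using assms unfolding keeps_def val_def by auto

text \<open>A column that is still 0 takes over the output of the sublayer, and all others receive
  an exact 0. Fresh columns thus turn the residual addition into an assignment.\<close>

lemma residual:
  assumes X: "fin_mat n d X" and A: "A \<in> carrier_mat n d"
    and out: "\<And>i j. i < n \<Longrightarrow> j < d \<Longrightarrow> \<exists>y. val F (A $$ (i, j)) y \<and> (j \<noteq> s \<longrightarrow> y = 0)"
    and zero: "\<And>i. i < n \<Longrightarrow> s < d \<Longrightarrow> val F (X $$ (i, s)) 0"
  shows "keeps n {s} X (madd F A X)"
    and "\<And>i y. i < n \<Longrightarrow> s < d \<Longrightarrow> val F (A $$ (i, s)) y \<Longrightarrow> val F (madd F A X $$ (i, s)) y"
proof -
  have ix: "madd F A X $$ (i, j) = fadd F (A $$ (i, j)) (X $$ (i, j))" if "i < n" "j < d" for i j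
    using that A by (auto simp: madd_def)
  have car: "madd F A X \<in> carrier_mat n d" using A by (auto simp: madd_def)
  show s: "val F (madd F A X $$ (i, s)) y" if "i < n" "s < d" "val F (A $$ (i, s)) y" for i y
    using fadd_zero_right[OF that(3) zero[OF that(1,2)]] ix that by simp
  have o: "val F (madd F A X $$ (i, j)) (rval F (X $$ (i, j)))" if "i < n" "j < d" "j \<noteq> s" for i j
  proof -
    have "val F (A $$ (i, j)) 0" using out[OF that(1,2)] that(3) by auto
    moreover have "X $$ (i, j) \<in> fin_floats F" using X that by (simp add: fin_mat_def)
    ultimately show ?thesis using fadd_zero_left valI ix that by simp
  qed
  have "madd F A X $$ (i, j) \<in> fin_floats F" if "i < n" "j < d" for i j
    using s o out[OF that] that val_fin by (cases "j = s") blast+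
  then show "keeps n {s} X (madd F A X)" using car o by (auto simp: keeps_def fin_mat_def)
qed

lemma exists_residual:
  assumes X: "fin_mat nX d X" and Y: "fin_mat nY d Y"
    and Q: "\<And>t. t < nX \<Longrightarrow> if a < d then val F (X $$ (t, a)) (if Q t then 1 else 0) else \<not> Q t"
    and zero: "\<And>i. i < nY \<Longrightarrow> s < d \<Longrightarrow> val F (Y $$ (i, s)) 0"
  shows "keeps nY {s} Y (madd F (mha_eval F masked (exists_mha d a s) X Y) Y)"
    and "\<And>i. i < nY \<Longrightarrow> s < d \<Longrightarrow> \<exists>y. val F (madd F (mha_eval F masked (exists_mha d a s) X Y) Y $$ (i, s)) y \<and>
      (if \<exists>t<nX. (masked \<longrightarrow> t < i) \<and> Q t then 1 \<le> y else y = 0)"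
proof -
  let ?A = "mha_eval F masked (exists_mha d a s) X Y"
  have A: "?A \<in> carrier_mat nY d" unfolding exists_mha_def
    by (rule simple_mha_carrier) (use Y in \<open>simp add: fin_mat_def\<close>)
  have ex: "\<exists>y. val F (?A $$ (i, j)) y \<and> (if j = s \<and> (\<exists>t<nX. (masked \<longrightarrow> t < i) \<and> Q t) then 1 \<le> y else y = 0)"
    if "i < nY" "j < d" for i j using exists_mha[OF X Y that Q] .
  have out: "\<exists>y. val F (?A $$ (i, j)) y \<and> (j \<noteq> s \<longrightarrow> y = 0)" if "i < nY" "j < d" for i j
    using ex[OF that] by (auto split: if_splits)
  show "keeps nY {s} Y (madd F ?A Y)" by (rule residual(1)[OF Y A out zero])
  show "\<exists>y. val F (madd F ?A Y $$ (i, s)) y \<and> (if \<exists>t<nX. (masked \<longrightarrow> t < i) \<and> Q t then 1 \<le> y else y = 0)"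
    if b: "i < nY" "s < d" for i
  proof -
    obtain y where "val F (?A $$ (i, s)) y" "if \<exists>t<nX. (masked \<longrightarrow> t < i) \<and> Q t then 1 \<le> y else y = 0"
      using ex[OF b] by (simp only: simp_thms) blast
    then show ?thesis using residual(2)[OF Y A out zero b] by blast
  qed
qed

lemma idle_residual:
  assumes "fin_mat nX d X" "fin_mat nY d Y"
  shows "keeps nY {} Y (madd F (mha_eval F masked idle_mha X Y) Y)"
  using exists_residual(1)[OF assms, of d "\<lambda>_. False" d masked] by (auto simp: keeps_def idle_mha_def)

lemma mlp_residual:
  assumes X: "fin_mat n d X" and A: "mlp_eval F M X \<in> carrier_mat n d"
    and out: "\<And>i j. i < n \<Longrightarrow> j < d \<Longrightarrow> val F (mlp_eval F M X $$ (i, j)) (if j = s \<and> R i then 1 else 0)"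
    and zero: "\<And>i. i < n \<Longrightarrow> val F (X $$ (i, s)) 0" and s: "s < d"
  shows "keeps n {s} X (madd F (mlp_eval F M X) X)"
    and "\<And>i. i < n \<Longrightarrow> val F (madd F (mlp_eval F M X) X $$ (i, s)) (if R i then 1 else 0)"
proof -
  have out': "\<exists>y. val F (mlp_eval F M X $$ (i, j)) y \<and> (j \<noteq> s \<longrightarrow> y = 0)" if "i < n" "j < d" for i j
    using out[OF that] by auto
  show "keeps n {s} X (madd F (mlp_eval F M X) X)" by (rule residual(1)[OF X A out' zero])
  show "val F (madd F (mlp_eval F M X) X $$ (i, s)) (if R i then 1 else 0)" if "i < n" for i
    using residual(2)[OF X A out' zero that s] out[OF that s] by simp
qed

lemma idle_mlp_residual:
  assumes "fin_mat n d X" shows "keeps n {} X (madd F (mlp_eval F (idle_mlp d) X) X)"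
proof -
  have "keeps n {d} X (madd F (mlp_eval F (idle_mlp d) X) X)"
  proof (rule residual(1)[OF assms])
    show "mlp_eval F (idle_mlp d) X \<in> carrier_mat n d" unfolding idle_mlp_def
      by (rule simple_mlp_carrier) (use assms in \<open>simp add: fin_mat_def\<close>)
  qed (use idle_mlp[OF assms] in auto)
  then show ?thesis by (auto simp: keeps_def)
qed

text \<open>The invariant before layer \<open>k\<close>, with \<nu> sending rows to vertices. Atoms
  are correct from the start; the remaining features and the scratch columns from \<open>k\<close>
  on must still be 0 to be writable through residual connections.\<close>

definition state :: "'a tsgraph \<Rightarrow> (nat \<Rightarrow> nat) \<Rightarrow> nat \<Rightarrow> nat \<Rightarrow> fp mat \<Rightarrow> bool" where
  "state G \<nu> n k X \<longleftrightarrow> fin_mat n d X \<and> (\<forall>r<n. val F (X $$ (r, 0)) 1 \<and>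
     (\<forall>i<m. val F (X $$ (r, feat i)) (if (i < k \<or> (\<exists>a. L ! i = XProp a)) \<and> xsat G (\<nu> r) (L ! i) then 1 else 0)) \<and>
     (\<forall>i<m. k \<le> i \<longrightarrow> val F (X $$ (r, scr i)) 0))"

lemma state_fin: "state G \<nu> n k X \<Longrightarrow> fin_mat n d X" by (simp add: state_def)

lemma state_one: "state G \<nu> n k X \<Longrightarrow> r < n \<Longrightarrow> val F (X $$ (r, 0)) 1" by (simp add: state_def)

lemma state_value:
  "state G \<nu> n k X \<Longrightarrow> r < n \<Longrightarrow> i < m \<Longrightarrow> val F (X $$ (r, feat i))
     (if (i < k \<or> (\<exists>a. L ! i = XProp a)) \<and> xsat G (\<nu> r) (L ! i) then 1 else 0)"
  unfolding state_def by blast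

lemma state_feat:
  "state G \<nu> n k X \<Longrightarrow> r < n \<Longrightarrow> i < k \<Longrightarrow> k \<le> m \<Longrightarrow>
   val F (X $$ (r, feat i)) (if xsat G (\<nu> r) (L ! i) then 1 else 0)"
  using state_value[of G \<nu> n k X r i] by simp

lemma state_kid:
  "state G \<nu> n k X \<Longrightarrow> r < n \<Longrightarrow> k < m \<Longrightarrow> \<phi> \<in> kids (L ! k) \<Longrightarrow>
   val F (X $$ (r, feat (pos \<phi>))) (if xsat G (\<nu> r) \<phi> then 1 else 0)"
  using state_feat[of G \<nu> n k X r "pos \<phi>"] kid_pos[of k \<phi>] by simp

lemma state_scr: "state G \<nu> n k X \<Longrightarrow> r < n \<Longrightarrow> k < m \<Longrightarrow> val F (X $$ (r, scr k)) 0"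
  by (simp add: state_def)

lemma state_new: "state G \<nu> n k X \<Longrightarrow> r < n \<Longrightarrow> k < m \<Longrightarrow> \<nexists>a. L ! k = XProp a \<Longrightarrow> val F (X $$ (r, feat k)) 0"
  using state_value[of G \<nu> n k X r k] by simp

lemma state_step:
  assumes st: "state G \<nu> n k X" and k: "k < m" and kp: "keeps n {feat k, scr k} X X'"
    and new: "\<And>r. r < n \<Longrightarrow> val F (X' $$ (r, feat k)) (if xsat G (\<nu> r) (L ! k) then 1 else 0)"
  shows "state G \<nu> n (Suc k) X'"
  unfolding state_def
proof (intro conjI allI impI)
  show "fin_mat n d X'" using kp by (simp add: keeps_def)
  fix r assume r: "r < n"
  show "val F (X' $$ (r, 0)) 1"
    by (rule keeps_val[OF kp r _ _ state_one[OF st r]]) (auto simp: feat_def scr_def d_def)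
  fix i assume i: "i < m"
  show "val F (X' $$ (r, scr i)) 0" if "Suc k \<le> i"
  proof (rule keeps_val[OF kp r])
    show "val F (X $$ (r, scr i)) 0" using st r i that by (simp add: state_def)
  qed (use coord i k that in auto)
  show "val F (X' $$ (r, feat i)) (if (i < Suc k \<or> (\<exists>a. L ! i = XProp a)) \<and> xsat G (\<nu> r) (L ! i) then 1 else 0)"
  proof (cases "i = k")
    case True
    then show ?thesis using new[OF r] by simp
  next
    case False
    then have "(i < Suc k) = (i < k)" by auto
    moreover have "val F (X' $$ (r, feat i)) (if (i < k \<or> (\<exists>a. L ! i = XProp a)) \<and> xsat G (\<nu> r) (L ! i) then 1 else 0)"
    proof (rule keeps_val[OF kp r])
      show "val F (X $$ (r, feat i)) (if (i < k \<or> (\<exists>a. L ! i = XProp a)) \<and> xsat G (\<nu> r) (L ! i) then 1 else 0)"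
        using st r i unfolding state_def by blast
    qed (use coord i k False in auto)
    ultimately show ?thesis by simp
  qed
qed

lemma mlp_carrier:
  assumes "fin_mat n d X"
  shows "mlp_eval F (neg_mlp d a s) X \<in> carrier_mat n d" "mlp_eval F (conj_mlp d a b s) X \<in> carrier_mat n d"
    "mlp_eval F (threshold_mlp d a s) X \<in> carrier_mat n d" "mlp_eval F (equal_mlp d k a s) X \<in> carrier_mat n d"
  unfolding neg_mlp_def conj_mlp_def threshold_mlp_def equal_mlp_def
  using assms by (auto intro!: simple_mlp_carrier simp: fin_mat_def)

lemma keeps_fin: "keeps n S X X' \<Longrightarrow> fin_mat n d X'" by (simp add: keeps_def)

lemma keeps_mono: "keeps n S X X' \<Longrightarrow> S \<subseteq> T \<Longrightarrow> keeps n T X X'" unfolding keeps_def by blast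

section \<open>The perceptron half of a layer, common to encoder and decoder\<close>

context
  fixes G :: "'a tsgraph" and \<nu> n k X X1
  assumes st: "state G \<nu> n k X" and k: "k < m" and kp: "keeps n {scr k} X X1"
begin

text \<open>For formulas whose column is right before the layer: atoms, and formulas false at all
  vertices in question.\<close>

lemma finish_idle:
  assumes "\<And>r. r < n \<Longrightarrow> val F (X $$ (r, feat k)) (if xsat G (\<nu> r) (L ! k) then 1 else 0)"
  shows "state G \<nu> n (Suc k) (madd F (mlp_eval F (idle_mlp d) X1) X1)"
proof (rule state_step[OF st k])
  have K: "keeps n ({scr k} \<union> {}) X (madd F (mlp_eval F (idle_mlp d) X1) X1)"
    by (rule keeps_trans[OF kp idle_mlp_residual[OF keeps_fin[OF kp]]])
  then show "keeps n {feat k, scr k} X (madd F (mlp_eval F (idle_mlp d) X1) X1)"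
    by (rule keeps_mono) auto
  show "val F (madd F (mlp_eval F (idle_mlp d) X1) X1 $$ (r, feat k)) (if xsat G (\<nu> r) (L ! k) then 1 else 0)"
    if "r < n" for r
    by (rule keeps_val[OF K that]) (use assms[OF that] coord k in auto)
qed

lemma finish_active:
  assumes "\<nexists>a. L ! k = XProp a" "mlp_eval F M X1 \<in> carrier_mat n d"
    and "\<And>r j. r < n \<Longrightarrow> j < d \<Longrightarrow>
      val F (mlp_eval F M X1 $$ (r, j)) (if j = feat k \<and> xsat G (\<nu> r) (L ! k) then 1 else 0)"
  shows "state G \<nu> n (Suc k) (madd F (mlp_eval F M X1) X1)"
proof (rule state_step[OF st k])
  have zero: "val F (X1 $$ (r, feat k)) 0" if "r < n" for r
    by (rule keeps_val[OF kp that]) (use coord k state_new[OF st that k assms(1)] in auto)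
  note res = mlp_residual[OF keeps_fin[OF kp] assms(2,3) zero coord(1)[OF k]]
  show "keeps n {feat k, scr k} X (madd F (mlp_eval F M X1) X1)"
    by (rule keeps_mono[OF keeps_trans[OF kp res(1)]]) auto
  show "val F (madd F (mlp_eval F M X1) X1 $$ (r, feat k)) (if xsat G (\<nu> r) (L ! k) then 1 else 0)"
    if "r < n" for r using res(2)[OF _ _ _ that] .
qed

lemma kid_value:
  assumes "\<phi> \<in> kids (L ! k)" "r < n"
  shows "feat (pos \<phi>) < d" "val F (X1 $$ (r, feat (pos \<phi>))) (if xsat G (\<nu> r) \<phi> then 1 else 0)"
proof -
  have pos: "pos \<phi> < m" using kid_pos[OF k assms(1)] k by simp
  then show "feat (pos \<phi>) < d" by (rule coord)
  then show "val F (X1 $$ (r, feat (pos \<phi>))) (if xsat G (\<nu> r) \<phi> then 1 else 0)"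
    using keeps_val[OF kp assms(2) _ _ state_kid[OF st assms(2) k assms(1)]] coord(7)[OF pos] by simp
qed

lemma neg_step:
  assumes "L ! k = XNeg \<phi>"
  shows "state G \<nu> n (Suc k) (madd F (mlp_eval F (neg_mlp d (feat (pos \<phi>)) (feat k)) X1) X1)"
proof (rule finish_active)
  have kid: "\<phi> \<in> kids (L ! k)" by (simp add: assms)
  show "val F (mlp_eval F (neg_mlp d (feat (pos \<phi>)) (feat k)) X1 $$ (r, j))
    (if j = feat k \<and> xsat G (\<nu> r) (L ! k) then 1 else 0)" if "r < n" "j < d" for r j
    using neg_mlp[OF keeps_fin[OF kp] that kid_value[OF kid that(1)]] by (simp add: assms)
qed (use assms mlp_carrier[OF keeps_fin[OF kp]] in auto)

lemma conj_step:
  assumes "L ! k = XConj \<phi> \<psi>"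
  shows "state G \<nu> n (Suc k) (madd F (mlp_eval F (conj_mlp d (feat (pos \<phi>)) (feat (pos \<psi>)) (feat k)) X1) X1)"
proof (rule finish_active)
  have kid: "\<phi> \<in> kids (L ! k)" "\<psi> \<in> kids (L ! k)" by (simp_all add: assms)
  show "val F (mlp_eval F (conj_mlp d (feat (pos \<phi>)) (feat (pos \<psi>)) (feat k)) X1 $$ (r, j))
    (if j = feat k \<and> xsat G (\<nu> r) (L ! k) then 1 else 0)" if "r < n" "j < d" for r j
    using conj_mlp[OF keeps_fin[OF kp] that kid_value[OF kid(1) that(1)] kid_value[OF kid(2) that(1)]]
    by (simp add: assms)
qed (use assms mlp_carrier[OF keeps_fin[OF kp]] in auto)

lemma threshold_step:
  assumes "\<nexists>a. L ! k = XProp a"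
    and "\<And>r. r < n \<Longrightarrow> \<exists>y. val F (X1 $$ (r, scr k)) y \<and> (if xsat G (\<nu> r) (L ! k) then 1 \<le> y else y = 0)"
  shows "state G \<nu> n (Suc k) (madd F (mlp_eval F (threshold_mlp d (scr k) (feat k)) X1) X1)"
proof (rule finish_active[OF assms(1)])
  show "val F (mlp_eval F (threshold_mlp d (scr k) (feat k)) X1 $$ (r, j))
    (if j = feat k \<and> xsat G (\<nu> r) (L ! k) then 1 else 0)" if r: "r < n" "j < d" for r j
  proof -
    obtain y where "val F (X1 $$ (r, scr k)) y" "if xsat G (\<nu> r) (L ! k) then 1 \<le> y else y = 0"
      using assms(2)[OF r(1)] by blast
    from threshold_mlp[OF keeps_fin[OF kp] r coord(2)[OF k] this] show ?thesis .
  qed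
qed (use mlp_carrier[OF keeps_fin[OF kp]] in auto)

end

section \<open>One layer evaluates one formula\<close>

definition enc_layer_at :: "nat \<Rightarrow> enc_layer" where
  "enc_layer_at k = \<lparr>enc_self = enc_att k, enc_mlp = enc_net k\<rparr>"

definition dec_layer_at :: "nat \<Rightarrow> dec_layer" where
  "dec_layer_at k = \<lparr>dec_self = dec_att k, dec_cross = dec_cross_att k, dec_mlp = dec_net k\<rparr>"

lemma keeps_idle: "fin_mat nX d X \<Longrightarrow> fin_mat n d Y \<Longrightarrow>
    keeps n {s} Y (madd F (mha_eval F masked idle_mha X Y) Y)"
  using keeps_mono idle_residual by blast

lemma moduliD: "k < m \<Longrightarrow> L ! k = XDvd j \<phi> \<Longrightarrow> 1 \<le> j \<and> j \<le> 2 ^ l"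
  using moduli unfolding moduli_ok_def by (metis nth_mem)

lemma encoder_step:
  assumes st: "state G \<nu> n k X" and k: "k < m"
    and pre: "prefix_verts G = \<nu> ` {..<n}" "inj_on \<nu> {..<n}"
  shows "state G \<nu> n (Suc k) (enc_layer_eval F (enc_layer_at k) X)"
proof -
  let ?X1 = "madd F (mha_eval F False (enc_att k) X X) X"
  have ev: "enc_layer_eval F (enc_layer_at k) X = madd F (mlp_eval F (enc_net k) ?X1) ?X1"
    by (simp add: enc_layer_eval_def enc_layer_at_def Let_def)
  note fin = state_fin[OF st]
  note val = state_value[OF st _ k]
  have idle: "keeps n {scr k} X ?X1" if "enc_att k = idle_mha"
    unfolding that by (rule keeps_idle[OF fin fin])
  show ?thesis
  proof (cases "L ! k")
    case XBot
    then show ?thesis using finish_idle[OF st k idle] val by (simp add: ev enc_att_def enc_net_def)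
  next
    case (XProp a)
    then show ?thesis using finish_idle[OF st k idle] val by (simp add: ev enc_att_def enc_net_def)
  next
    case (XPSuf \<phi>)
    \<comment> \<open>All suffix vertices come after every prefix vertex, so nothing in the suffix
      precedes \<open>\<nu> r\<close>.\<close>
    have no: "\<not> xsat G (\<nu> r) (L ! k)" if "r < n" for r
    proof -
      have "\<nu> r \<in> prefix_verts G" using pre(1) that by simp
      then show ?thesis by (auto simp: XPSuf prefix_verts_def suffix_verts_def)
    qed
    have att: "enc_att k = idle_mha" and net: "enc_net k = idle_mlp d"
      by (simp_all add: enc_att_def enc_net_def XPSuf)
    show ?thesis unfolding ev net
      by (rule finish_idle[OF st k idle[OF att]]) (use val no in simp)
  next
    case (XNeg \<phi>)
    then show ?thesis using neg_step[OF st k idle XNeg] by (simp add: ev enc_att_def enc_net_def)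
  next
    case (XConj \<phi> \<psi>)
    then show ?thesis using conj_step[OF st k idle XConj] by (simp add: ev enc_att_def enc_net_def)
  next
    case (XEx \<phi>)
    have att: "enc_att k = exists_mha d (feat (pos \<phi>)) (scr k)" and net: "enc_net k = threshold_mlp d (scr k) (feat k)"
      by (simp_all add: enc_att_def enc_net_def XEx)
    have Q: "if feat (pos \<phi>) < d then val F (X $$ (t, feat (pos \<phi>))) (if xsat G (\<nu> t) \<phi> then 1 else 0)
      else \<not> xsat G (\<nu> t) \<phi>" if "t < n" for t
      using state_kid[OF st that k] XEx kid_pos[OF k, of \<phi>] k coord(1)[of "pos \<phi>"] by simp
    note res = exists_residual[OF fin fin Q state_scr[OF st _ k], where masked = False, folded att]
    have "(\<exists>t<n. xsat G (\<nu> t) \<phi>) \<longleftrightarrow> xsat G (\<nu> r) (L ! k)" for r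
      using pre(1) by (auto simp: XEx)
    then show ?thesis unfolding ev net
      using res(2)[OF _ _ _ coord(2)[OF k]] XEx by (intro threshold_step[OF st k res(1)]) simp_all
  next
    case (XDvd j \<phi>)
    have j: "1 \<le> j" "j \<le> 2 ^ l" using moduliD[OF k XDvd] by auto
    have att: "enc_att k = dvd_mha d j (feat (pos \<phi>)) (scr k)" and net: "enc_net k = equal_mlp d j (scr k) (feat k)"
      by (simp_all add: enc_att_def enc_net_def XDvd)
    have kid: "\<phi> \<in> kids (L ! k)" by (simp add: XDvd)
    have p: "feat (pos \<phi>) < d" using kid_pos[OF k kid] k coord(1) by simp
    \<comment> \<open>Rows enumerate the prefix without repetition, so counting rows counts
      vertices.\<close>
    have card: "card {t. t < n \<and> xsat G (\<nu> t) \<phi>} = card {v \<in> prefix_verts G. xsat G v \<phi>}"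
    proof -
      have "{v \<in> prefix_verts G. xsat G v \<phi>} = \<nu> ` {t. t < n \<and> xsat G (\<nu> t) \<phi>}" unfolding pre(1) by auto
      moreover have "inj_on \<nu> {t. t < n \<and> xsat G (\<nu> t) \<phi>}" using pre(2) by (rule inj_on_subset) auto
      ultimately show ?thesis by (simp add: card_image)
    qed
    let ?A = "mha_eval F False (enc_att k) X X"
    have out: "\<exists>t::nat. val F (?A $$ (r, i)) (if i = scr k then real t / 2 ^ (p - 1) else 0) \<and>
      t \<le> 4 * (2 ^ l * 2 ^ l) \<and> (t = j \<longleftrightarrow> xsat G (\<nu> r) (L ! k))" if "r < n" "i < d" for r i
      using dvd_mha[OF fin that coord(3) p j state_one[OF st] state_kid[OF st _ k kid], of "scr k"]
      unfolding att card by (simp add: XDvd)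
    have A: "?A \<in> carrier_mat n d" unfolding att dvd_mha_def
      by (rule simple_mha_carrier) (use fin in \<open>simp add: fin_mat_def\<close>)
    have out': "\<exists>y. val F (?A $$ (r, i)) y \<and> (i \<noteq> scr k \<longrightarrow> y = 0)" if "r < n" "i < d" for r i
      using out[OF that] by auto
    note res = residual[OF fin A out' state_scr[OF st _ k]]
    have mlp: "val F (mlp_eval F (enc_net k) ?X1 $$ (r, i)) (if i = feat k \<and> xsat G (\<nu> r) (L ! k) then 1 else 0)"
      if r: "r < n" "i < d" for r i
    proof -
      obtain t :: nat where t: "val F (?A $$ (r, scr k)) (real t / 2 ^ (p - 1))"
        "t \<le> 4 * (2 ^ l * 2 ^ l)" "t = j \<longleftrightarrow> xsat G (\<nu> r) (L ! k)"
        using out[OF r(1) coord(2)[OF k]] by auto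
      have "val F (?X1 $$ (r, scr k)) (real t / 2 ^ (p - 1))"
        using res(2)[OF _ _ _ r(1) coord(2)[OF k] t(1)] by simp
      from equal_mlp[OF keeps_fin[OF res(1)] r j(2) coord(2)[OF k] this t(2)] show ?thesis
        unfolding net t(3) by simp
    qed
    have car: "mlp_eval F (enc_net k) ?X1 \<in> carrier_mat n d"
      unfolding net using mlp_carrier(4)[OF keeps_fin[OF res(1)]] by simp
    show ?thesis unfolding ev
      by (rule finish_active[OF st k res(1) _ car mlp]) (simp_all add: XDvd)
  qed
qed

text \<open>Since \<nu> preserves order, the strict causal mask on rows expresses
  \<open>v < w\<close> on vertices. The encoder matrix is the final one, with all formulas
  evaluated, and is the same in every decoder layer.\<close>

lemma decoder_step:
  assumes st: "state G \<nu> n k Y" and k: "k < m"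
    and suf: "suffix_verts G = \<nu> ` {..<n}" "\<And>r t. r < n \<Longrightarrow> t < n \<Longrightarrow> \<nu> t < \<nu> r \<longleftrightarrow> t < r"
    and X: "state G \<mu> nX m X" and pre: "prefix_verts G = \<mu> ` {..<nX}"
  shows "state G \<nu> n (Suc k) (dec_layer_eval F (dec_layer_at k) X Y)"
proof -
  let ?Y1 = "madd F (mha_eval F True (dec_att k) Y Y) Y"
  let ?Y2 = "madd F (mha_eval F False (dec_cross_att k) X ?Y1) ?Y1"
  have ev: "dec_layer_eval F (dec_layer_at k) X Y = madd F (mlp_eval F (dec_net k) ?Y2) ?Y2"
    by (simp add: dec_layer_eval_def dec_layer_at_def Let_def)
  note fin = state_fin[OF st]
  note finX = state_fin[OF X]
  note val = state_value[OF st _ k]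
  have self: "keeps n {scr k} Y ?Y1" if "dec_att k = idle_mha"
    unfolding that by (rule keeps_idle[OF fin fin])
  have cross: "keeps n {} ?Y1 ?Y2" if "dec_cross_att k = idle_mha" "keeps n {scr k} Y ?Y1"
    unfolding that(1) by (rule idle_residual[OF finX keeps_fin[OF that(2)]])
  have idle: "keeps n {scr k} Y ?Y2" if "dec_att k = idle_mha" "dec_cross_att k = idle_mha"
    using keeps_trans[OF self[OF that(1)] cross[OF that(2) self[OF that(1)]]] by simp
  have global: "state G \<nu> n (Suc k) (madd F (mlp_eval F (threshold_mlp d (scr k) (feat k)) ?Y2) ?Y2)"
    if att: "dec_att k = idle_mha" and cr: "dec_cross_att k = exists_mha d (feat k) (scr k)"
      and np: "\<nexists>a. L ! k = XProp a"
      and gl: "\<And>r. (\<exists>t<nX. xsat G (\<mu> t) (L ! k)) \<longleftrightarrow> xsat G (\<nu> r) (L ! k)"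
  proof -
    note s = self[OF att]
    have Q: "if feat k < d then val F (X $$ (t, feat k)) (if xsat G (\<mu> t) (L ! k) then 1 else 0)
      else \<not> xsat G (\<mu> t) (L ! k)" if "t < nX" for t
      using state_feat[OF X that k] coord(1)[OF k] by simp
    \<comment> \<open>Cross-attention writes to the scratch column available to self-attention; it
      is still 0 as the latter is idle here.\<close>
    have zero: "val F (?Y1 $$ (r, scr k)) 0" if "r < n" for r
    proof -
      have "keeps n {} Y ?Y1" unfolding att by (rule idle_residual[OF fin fin])
      from keeps_val[OF this that coord(2)[OF k] _ state_scr[OF st that k]] show ?thesis by simp
    qed
    note res = exists_residual[OF finX keeps_fin[OF s] Q zero, where masked = False, folded cr]
    have kp: "keeps n {scr k} Y ?Y2" using keeps_trans[OF s res(1)] by simp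
    show ?thesis
      using res(2)[OF _ _ _ coord(2)[OF k]] gl by (intro threshold_step[OF st k kp np]) simp_all
  qed
  show ?thesis
  proof (cases "L ! k")
    case XBot
    then show ?thesis using finish_idle[OF st k idle] val by (simp add: ev dec_att_def dec_cross_att_def dec_net_def)
  next
    case (XProp a)
    then show ?thesis using finish_idle[OF st k idle] val by (simp add: ev dec_att_def dec_cross_att_def dec_net_def)
  next
    case (XNeg \<phi>)
    then show ?thesis using neg_step[OF st k idle XNeg] by (simp add: ev dec_att_def dec_cross_att_def dec_net_def)
  next
    case (XConj \<phi> \<psi>)
    then show ?thesis using conj_step[OF st k idle XConj] by (simp add: ev dec_att_def dec_cross_att_def dec_net_def)
  next
    case (XEx \<phi>)
    have "(\<exists>t<nX. xsat G (\<mu> t) (L ! k)) \<longleftrightarrow> xsat G (\<nu> r) (L ! k)" for r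
      by (auto simp: XEx pre)
    from global[OF _ _ _ this] show ?thesis by (simp add: ev dec_att_def dec_cross_att_def dec_net_def XEx)
  next
    case (XDvd j \<phi>)
    have "(\<exists>t<nX. xsat G (\<mu> t) (L ! k)) \<longleftrightarrow> xsat G (\<nu> r) (L ! k)" for r
    \<comment> \<open>Without prefix vertices the count is 0, which divides no
      \<open>j \<ge> 1\<close>; so the formula is false, just like the existential statement over no
      rows.\<close>
    proof (cases "nX = 0")
      case True
      then show ?thesis using moduliD[OF k XDvd] by (simp add: XDvd pre)
    qed (auto simp: XDvd)
    from global[OF _ _ _ this] show ?thesis by (simp add: ev dec_att_def dec_cross_att_def dec_net_def XDvd)
  next
    case (XPSuf \<phi>)
    have att: "dec_att k = exists_mha d (feat (pos \<phi>)) (scr k)" and cr: "dec_cross_att k = idle_mha"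
      and net: "dec_net k = threshold_mlp d (scr k) (feat k)"
      by (simp_all add: dec_att_def dec_cross_att_def dec_net_def XPSuf)
    have Q: "if feat (pos \<phi>) < d then val F (Y $$ (t, feat (pos \<phi>))) (if xsat G (\<nu> t) \<phi> then 1 else 0)
      else \<not> xsat G (\<nu> t) \<phi>" if "t < n" for t
      using state_kid[OF st that k] XPSuf kid_pos[OF k, of \<phi>] k coord(1)[of "pos \<phi>"] by simp
    note res = exists_residual[OF fin fin Q state_scr[OF st _ k], where masked = True, folded att]
    have K1: "keeps n {scr k} Y ?Y1" using res(1) by simp
    have K2: "keeps n {} ?Y1 ?Y2" by (rule cross[OF cr K1])
    have kp: "keeps n {scr k} Y ?Y2" using keeps_trans[OF K1 K2] by simp
    have th: "\<exists>y. val F (?Y2 $$ (r, scr k)) y \<and> (if xsat G (\<nu> r) (L ! k) then 1 \<le> y else y = 0)" if r: "r < n" for r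
    proof -
      obtain y where y: "val F (?Y1 $$ (r, scr k)) y" "if \<exists>t<n. (True \<longrightarrow> t < r) \<and> xsat G (\<nu> t) \<phi> then 1 \<le> y else y = 0"
        using res(2)[OF _ _ r coord(2)[OF k]] by blast
      have "(\<exists>t<n. (True \<longrightarrow> t < r) \<and> xsat G (\<nu> t) \<phi>) \<longleftrightarrow> xsat G (\<nu> r) (L ! k)"
        using suf(2)[OF r] by (auto simp: XPSuf suf(1))
      with y(2) keeps_val[OF K2 r coord(2)[OF k] _ y(1)] show ?thesis by auto
    qed
    show ?thesis unfolding ev net by (rule threshold_step[OF st k kp _ th]) (simp_all add: XPSuf)
  qed
qed

section \<open>The complete network\<close>

lemma encoder_state:
  assumes "state G \<nu> n 0 X" "prefix_verts G = \<nu> ` {..<n}" "inj_on \<nu> {..<n}"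
  shows "state G \<nu> n m (encoder_eval F (map enc_layer_at [0..<m]) X)"
proof -
  have "k \<le> m \<Longrightarrow> state G \<nu> n k (encoder_eval F (map enc_layer_at [0..<k]) X)" for k
  proof (induction k)
    case (Suc k)
    then show ?case using encoder_step[OF _ _ assms(2,3), of k] by (simp add: encoder_eval_def)
  qed (simp add: encoder_eval_def assms(1))
  then show ?thesis by simp
qed

lemma decoder_state:
  assumes "state G \<nu> n 0 Y" "suffix_verts G = \<nu> ` {..<n}" "\<And>r t. r < n \<Longrightarrow> t < n \<Longrightarrow> \<nu> t < \<nu> r \<longleftrightarrow> t < r"
    "state G \<mu> nX m X" "prefix_verts G = \<mu> ` {..<nX}"
  shows "state G \<nu> n m (decoder_eval F (map dec_layer_at [0..<m]) X Y)"
proof -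
  have "k \<le> m \<Longrightarrow> state G \<nu> n k (decoder_eval F (map dec_layer_at [0..<k]) X Y)" for k
  proof (induction k)
    case (Suc k)
    then show ?case using decoder_step[OF _ _ assms(2,3,4,5), of k] by (simp add: decoder_eval_def)
  qed (simp add: decoder_eval_def assms(1))
  then show ?thesis by simp
qed

text \<open>\<open>BOS\<close> is no \<open>Tok a\<close>, so its embedding has only the constant
  column set.\<close>

definition token_emb :: "'a token \<Rightarrow> fp vec" where
  "token_emb t = vec d (\<lambda>j. flt (if j = 0 \<or> (\<exists>i<m. j = feat i \<and> (\<exists>a. L ! i = XProp a \<and> t = Tok a)) then 1 else 0))"

lemma embed_state:
  assumes "vs = sorted_list_of_set S" "\<And>r. r < length vs \<Longrightarrow> vs ! r = \<nu> r"
  shows "state G \<nu> (length vs) 0 (embed d token_emb G S)"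
proof -
  let ?one = "\<lambda>r j. j = 0 \<or> (\<exists>i<m. j = feat i \<and> (\<exists>a. L ! i = XProp a \<and> lab G (\<nu> r) = Tok a))"
  let ?E = "embed d token_emb G S"
  have E: "val F (?E $$ (r, j)) (if ?one r j then 1 else 0)" if "r < length vs" "j < d" for r j
  proof -
    have "?E $$ (r, j) = flt (if ?one r j then 1 else 0)"
      using that assms(2)[OF that(1)] by (simp add: embed_def token_emb_def flip: assms(1))
    then show ?thesis using val_flt_small by simp
  qed
  have "?E \<in> carrier_mat (length vs) d" by (simp add: embed_def flip: assms(1))
  then have "fin_mat (length vs) d ?E" using val_fin[OF E] by (simp add: fin_mat_def)
  moreover have "val F (?E $$ (r, 0)) 1" if "r < length vs" for r using E[OF that coord(9)] by simp
  moreover have "val F (?E $$ (r, feat i)) (if (i < 0 \<or> (\<exists>a. L ! i = XProp a)) \<and> xsat G (\<nu> r) (L ! i) then 1 else 0)"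
    if "r < length vs" "i < m" for r i
  proof -
    have "?one r (feat i) \<longleftrightarrow> (i < 0 \<or> (\<exists>a. L ! i = XProp a)) \<and> xsat G (\<nu> r) (L ! i)"
      using that by (auto simp: feat_def)
    then show ?thesis using E[OF that(1) coord(1)[OF that(2)]] by simp
  qed
  moreover have "val F (?E $$ (r, scr i)) 0" if "r < length vs" "i < m" for r i
  proof -
    have "\<not> ?one r (scr i)" using coord by auto
    then show ?thesis using E[OF that(1) coord(2)[OF that(2)]] by (simp only: if_False)
  qed
  ultimately show ?thesis unfolding state_def by blast
qed

definition net_transformer :: "'a xform list \<Rightarrow> 'a transformer" where
  "net_transformer \<psi>s = \<lparr>emb = token_emb, enc_layers = map enc_layer_at [0..<m],
     dec_layers = map dec_layer_at [0..<m],
     W_out = mat d (length \<psi>s) (\<lambda>(i, c). flt (if i = feat (pos (\<psi>s ! c)) then 1 else 0)),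
     b_out = vec (length \<psi>s) (\<lambda>_. flt 0)\<rparr>"

definition net_dims :: "'a xform list \<Rightarrow> dims" where
  "net_dims \<psi>s = \<lparr>d_model = d, d_k = 1, d_v = 1, d_ff = 3, d_out = length \<psi>s\<rparr>"

section \<open>Well-formed parameters and the output\<close>

lemma flt_floats: "val F (flt r) r \<Longrightarrow> flt r \<in> floats F" by (rule val_floats)

lemma is_mha_simple:
  assumes "\<And>i. val F (flt (q i)) (q i)" "\<And>i. val F (flt (k i)) (k i)" "\<And>i. val F (flt (v i)) (v i)"
    "\<And>i. val F (flt (w i)) (w i)"
  shows "is_mha F (net_dims \<psi>s) (simple_mha d q k v w)"
  using assms[THEN flt_floats] by (simp add: is_mha_def simple_mha_def is_head_def fmats_def net_dims_def)

lemma is_mha_exists: "is_mha F (net_dims \<psi>s) (exists_mha d a s)"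
  unfolding exists_mha_def using val_flt_small val_flt_two_p by (intro is_mha_simple) auto

lemma is_mha_dvd: "j \<le> 2 ^ l \<Longrightarrow> is_mha F (net_dims \<psi>s) (dvd_mha d j a s)"
  unfolding dvd_mha_def using val_flt_small val_flt_two_B val_flt_big val_flt_mdelta
  by (intro is_mha_simple) auto

lemma is_mlp_simple:
  assumes "\<And>i t. t < 3 \<Longrightarrow> val F (flt (w1 i t)) (w1 i t)" "\<And>t. t < 3 \<Longrightarrow> val F (flt (b1 t)) (b1 t)"
    "\<And>t. t < 3 \<Longrightarrow> val F (flt (w2 t)) (w2 t)" "val F (flt b2) b2"
  shows "is_mlp F (net_dims \<psi>s) (simple_mlp d s w1 b1 w2 b2)"
  using assms(1-3)[THEN flt_floats] flt_floats[OF assms(4)] flt_floats[OF val_flt_small(1)]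
  by (simp add: is_mlp_def simple_mlp_def fmats_def fvecs_def net_dims_def)

lemma is_mlp_all:
  "is_mlp F (net_dims \<psi>s) (idle_mlp d)" "is_mlp F (net_dims \<psi>s) (neg_mlp d a s)"
  "is_mlp F (net_dims \<psi>s) (conj_mlp d a b s)" "is_mlp F (net_dims \<psi>s) (threshold_mlp d a s)"
  unfolding idle_mlp_def neg_mlp_def conj_mlp_def threshold_mlp_def
  using val_flt_small by (auto intro!: is_mlp_simple simp: on_first_def)

lemma is_mlp_equal: "j \<le> 2 ^ l \<Longrightarrow> is_mlp F (net_dims \<psi>s) (equal_mlp d j a s)"
proof -
  assume j: "j \<le> 2 ^ l"
  have b: "val F (flt (of_int (1 - int t - int j))) (of_int (1 - int t - int j))" if "t < 3" for t
  proof (rule val_flt_int)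
    have "j + 20 \<le> 2 ^ l * 2 ^ l + 20" using j by (rule order_trans[OF add_right_mono]) simp
    moreover have "1 \<le> (2::nat) ^ l * 2 ^ l" by simp
    ultimately have "j + 2 < 2 ^ p" unfolding two_p by linarith
    then have "int (j + 2) < int (2 ^ p)" by (simp only: of_nat_less_iff)
    then show "\<bar>1 - int t - int j\<bar> < 2 ^ p" using that by simp
  qed
  have "val F (flt (2 ^ (p - 1))) (2 ^ (p - 1))" by (intro val_flt representable_two_power) simp
  then show ?thesis unfolding equal_mlp_def using b val_flt_small by (intro is_mlp_simple) auto
qed

lemma is_transformer_net: "is_transformer \<Sigma> F (net_dims \<psi>s) (net_transformer \<psi>s)"
proof -
  have "is_mha F (net_dims \<psi>s) (enc_att k)" "is_mlp F (net_dims \<psi>s) (enc_net k)" if "k < m" for k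
    using moduliD[OF that] unfolding enc_att_def enc_net_def idle_mha_def
    by (auto split: xform.split intro: is_mha_exists is_mha_dvd is_mlp_all is_mlp_equal)
  moreover have "is_mha F (net_dims \<psi>s) (dec_att k)" "is_mha F (net_dims \<psi>s) (dec_cross_att k)"
    "is_mlp F (net_dims \<psi>s) (dec_net k)" for k
    unfolding dec_att_def dec_cross_att_def dec_net_def idle_mha_def
    by (auto split: xform.split intro: is_mha_exists is_mlp_all)
  moreover have "token_emb t \<in> fvecs F d" for t
    using val_flt_small[THEN flt_floats] by (simp add: fvecs_def token_emb_def)
  moreover have "W_out (net_transformer \<psi>s) \<in> fmats F d (length \<psi>s)" "b_out (net_transformer \<psi>s) \<in> fvecs F (length \<psi>s)"
    using val_flt_small[THEN flt_floats] by (auto simp: fmats_def fvecs_def net_transformer_def)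
  ultimately show ?thesis using nonempty
    by (auto simp: is_transformer_def net_dims_def net_transformer_def enc_layer_at_def dec_layer_at_def coord(9))
qed

lemma net_output:
  assumes G: "is_tsgraph \<Sigma> G" and v: "v \<in> suffix_verts G" and \<psi>s: "set \<psi>s \<subseteq> set L"
  shows "dim_vec (transformer_output F (net_dims \<psi>s) (net_transformer \<psi>s) G v) = length \<psi>s"
    and "\<And>c. c < length \<psi>s \<Longrightarrow> val F (transformer_output F (net_dims \<psi>s) (net_transformer \<psi>s) G v $ c)
      (if xsat G v (\<psi>s ! c) then 1 else 0)"
proof -
  define w where "w = bos G"
  obtain n where w: "1 \<le> w" "w \<le> n" and pre: "prefix_verts G = {1..<w}" and suf: "suffix_verts G = {w..n}"
    using tsgraph_split[OF G] unfolding w_def by blast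
  let ?T = "net_transformer \<psi>s"
  \<comment> \<open>Rows start at 0, prefix vertices at 1 and suffix vertices at \<open>w\<close>.
    For \<open>w = 1\<close> the encoder works on a matrix without rows.\<close>
  let ?\<mu> = "\<lambda>r. 1 + r" and ?\<nu> = "\<lambda>r. w + r"
  define X where "X = encoder_eval F (map enc_layer_at [0..<m]) (embed d token_emb G (prefix_verts G))"
  define Y where "Y = decoder_eval F (map dec_layer_at [0..<m]) X (embed d token_emb G (suffix_verts G))"
  have "state G ?\<mu> (length [1..<w]) 0 (embed d token_emb G (prefix_verts G))"
    by (rule embed_state) (simp_all add: pre)
  then have X0: "state G ?\<mu> (w - 1) 0 (embed d token_emb G (prefix_verts G))" by simp
  have im: "prefix_verts G = ?\<mu> ` {..<w - 1}"
    unfolding pre image_add_lessThan ..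
  have X: "state G ?\<mu> (w - 1) m X" unfolding X_def
    by (rule encoder_state[OF X0 im]) (simp add: inj_on_def)
  have "state G ?\<nu> (length [w..<Suc n]) 0 (embed d token_emb G (suffix_verts G))"
    by (rule embed_state) (simp_all add: suf sorted_list_suffix del: upt_Suc)
  then have Y0: "state G ?\<nu> (Suc n - w) 0 (embed d token_emb G (suffix_verts G))"
    by (simp only: length_upt)
  have im': "suffix_verts G = ?\<nu> ` {..<Suc n - w}"
    unfolding suf image_add_lessThan by auto
  have Y: "state G ?\<nu> (Suc n - w) m Y" unfolding Y_def
    by (rule decoder_state[OF Y0 im' _ X im]) simp
  have dims: "dim_row Y = Suc n - w" "dim_col Y = d" using state_fin[OF Y] by (auto simp: fin_mat_def)
  have ev: "transformer_eval F (net_dims \<psi>s) ?T G = add_bias F (mmul F Y (W_out ?T)) (b_out ?T)"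
    by (simp add: transformer_eval_def net_transformer_def net_dims_def X_def Y_def Let_def)
  have dc: "dim_col (W_out ?T) = length \<psi>s" by (simp add: net_transformer_def)
  have r: "v - w < Suc n - w" "w + (v - w) = v" using v suf by auto
  show "dim_vec (transformer_output F (net_dims \<psi>s) ?T G v) = length \<psi>s"
    by (simp add: transformer_output_def ev add_bias_def dc)
  fix c assume c: "c < length \<psi>s"
  then have in_L: "\<psi>s ! c \<in> set L" using \<psi>s by auto
  define a where "a = feat (pos (\<psi>s ! c))"
  have a: "a < d" using pos_in[OF in_L] coord(1) by (simp add: a_def)
  have Ya: "val F (Y $$ (v - w, a)) (if xsat G v (\<psi>s ! c) then 1 else 0)"
    using state_feat[OF Y r(1), of "pos (\<psi>s ! c)"] pos_in[OF in_L] r(2) by (simp add: a_def)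
  have "mmul F Y (W_out ?T) $$ (v - w, c) = dot d (\<lambda>i. Y $$ (v - w, i)) (\<lambda>i. if i = a then 1 else 0)"
    unfolding dot_def using c r(1)
    by (subst mmul_index) (auto simp: dims dc a_def net_transformer_def intro!: arg_cong[where f="fsum F"])
  moreover have "val F (dot d (\<lambda>i. Y $$ (v - w, i)) (\<lambda>i. if i = a then 1 else 0)) (if xsat G v (\<psi>s ! c) then 1 else 0)"
    using state_fin[OF Y] r(1) a fmul_one_right[OF Ya val_flt_small(2)]
    by (intro dot_single[where a=a]) (auto simp: fin_mat_def)
  ultimately have "val F (mmul F Y (W_out ?T) $$ (v - w, c)) (if xsat G v (\<psi>s ! c) then 1 else 0)" by simp
  moreover have "add_bias F (mmul F Y (W_out ?T)) (b_out ?T) $$ (v - w, c) =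
      fadd F (mmul F Y (W_out ?T) $$ (v - w, c)) (flt 0)"
    using c r(1) by (simp add: add_bias_def dims dc) (simp add: net_transformer_def)
  ultimately
  have "val F (add_bias F (mmul F Y (W_out ?T)) (b_out ?T) $$ (v - w, c)) (if xsat G v (\<psi>s ! c) then 1 else 0)"
    using fadd_zero_right[OF _ val_flt_small(1)] by simp
  then show "val F (transformer_output F (net_dims \<psi>s) ?T G v $ c) (if xsat G v (\<psi>s ! c) then 1 else 0)"
    using c r(1) by (simp add: transformer_output_def ev w_def add_bias_def dims dc)
qed

end

theorem theorem1:
  fixes \<Sigma> :: "'a set"
    and \<phi>s :: "'a gptl list"
    and N :: nat
    and ex :: "nat \<Rightarrow> nat \<Rightarrow> fp \<Rightarrow> fp"
  assumes "finite \<Sigma>"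
    and "\<forall>\<phi> \<in> set \<phi>s. set_gptl \<phi> \<subseteq> \<Sigma>"
    and "\<And>p q. 0 < p \<Longrightarrow> 0 < q \<Longrightarrow>
           exp_approx N \<lparr>sig_bits = p, exp_bits = q, fexp = ex p q\<rparr>"
  shows "\<exists>p q F D (T :: 'a transformer).
           0 < p \<and> 0 < q \<and> F = \<lparr>sig_bits = p, exp_bits = q, fexp = ex p q\<rparr> \<and>
           is_transformer \<Sigma> F D T \<and> d_out D = length \<phi>s \<and>
           featurewise_equiv \<Sigma> F D T \<phi>s"
proof -
  \<comment> \<open>A common bound for all thresholds; the sum is also defined for the empty
    tuple.\<close>
  define l where "l = sum_list (map max_threshold \<phi>s)"
  define p where "p = 2 * l + 8"
  define F where "F = \<lparr>sig_bits = p, exp_bits = p + 1, fexp = ex p (p + 1)\<rparr>"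
  define \<psi>s where "\<psi>s = map translate \<phi>s"
  \<comment> \<open>The leading \<open>XBot\<close> guarantees at least one layer, as required of a
    transformer, even for the empty tuple.\<close>
  define L where "L = XBot # concat (map subs \<psi>s)"
  have exp: "exp_approx N F" unfolding F_def by (rule assms(3)) (simp_all add: p_def)
  have le: "max_threshold \<phi> \<le> l" if "\<phi> \<in> set \<phi>s" for \<phi>
    unfolding l_def using that by (intro member_le_sum_list) auto
  define B :: nat where "B = 2 ^ p - 1"
  define \<delta> :: real where "\<delta> = 1 / 2 ^ (B + p - 1)"
  interpret network F l p B \<delta> L
  proof
    show "val F (fexp F x) 1" if "val F x 0" for x
      using exp that unfolding exp_approx_def
      by (intro represents_val) (auto simp: val_def floats_def)
    show "val F (fexp F (Inf True)) 0"
      using exp unfolding exp_approx_def by (intro represents_val) (auto simp: floats_def)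
    have "closed_list ([XBot] @ concat (map subs \<psi>s))"
      by (intro closed_list_append closed_list_concat) (auto simp: closed_list_subs, simp add: closed_list_def)
    then show "closed_list L" by (simp add: L_def)
    have "moduli_ok l (set (concat (map subs \<psi>s)))"
      using moduli_ok_translate[OF le] by (auto simp: moduli_ok_def \<psi>s_def)
    then show "moduli_ok l (set L)" by (simp add: L_def moduli_ok_simps)
  qed (simp_all add: F_def p_def L_def B_def \<delta>_def)
  have sub: "set \<psi>s \<subseteq> set L" using self_in_subs by (auto simp: L_def)
  have "featurewise_equiv \<Sigma> F (net_dims \<psi>s) (net_transformer \<psi>s) \<phi>s"
    unfolding featurewise_equiv_def Let_def
  proof (intro allI impI)
    fix G :: "'a tsgraph" and v assume G: "is_tsgraph \<Sigma> G" and v: "v \<in> suffix_verts G"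
    let ?o = "transformer_output F (net_dims \<psi>s) (net_transformer \<psi>s) G v"
    have dim: "dim_vec ?o = length \<phi>s" using net_output(1)[OF G v sub] by (simp add: \<psi>s_def)
    have "finite (prefix_verts G)" using tsgraph_split[OF G] by auto
    then have val: "val F (?o $ c) (if sat G v (\<phi>s ! c) then 1 else 0)" if "c < length \<phi>s" for c
      using net_output(2)[OF G v sub, of c] that by (simp add: \<psi>s_def xsat_translate)
    have "represents F y 0 \<or> represents F y 1" if "y \<in> set (list_of_vec ?o)" for y
    proof -
      obtain c where "c < length \<phi>s" "y = ?o $ c" using \<open>y \<in> _\<close> dim by (auto simp: in_set_conv_nth)
      then show ?thesis using val[of c] by (simp add: val_represents split: if_splits)
    qed
    moreover have "map (\<lambda>y. represents F y 1) (list_of_vec ?o) = formulas_output \<phi>s G v"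
      by (rule nth_equalityI) (simp_all add: dim formulas_output_def val_represents[OF val])
    ultimately show "(\<forall>y\<in>set (list_of_vec ?o). represents F y 0 \<or> represents F y 1) \<and>
        map (\<lambda>y. represents F y 1) (list_of_vec ?o) = formulas_output \<phi>s G v" by blast
  qed
  moreover have "d_out (net_dims \<psi>s) = length \<phi>s" by (simp add: net_dims_def \<psi>s_def)
  moreover have "0 < p" "0 < p + 1" by (simp_all add: p_def)
  ultimately show ?thesis using is_transformer_net[of \<Sigma> \<psi>s] F_def by blast
qed

end
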